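(* Assume the following. (A1) $\{\mathcal T_{g,n}:1\le g\le G_n\}$ is a partition of $\{1,\dots,n\}$ such that the collections $\{(u_{i,n},x_{i,n}'):i\in\mathcal T_{g,n}\}$ are independent over $g$ conditional on $\mathcal W_n$, and $\max_{1\le g\le G_n}\#\mathcal T_{g,n}=O(1)$. (A2) $\mathbb P[\lambda_{\min}(\sum_{i=1}^n w_{i,n}w_{i,n}')>0]\to1$, $\limsup_{n\to\infty}K_n/n<1$, $\mathcal C_n=O_p(1)$ and $\Sigma_n^{-1}=O_p(1)$. (A3) $\mathbb E[u_{i,n}|\mathcal X_n,\mathcal W_n]=0$ for all $i,n$, $\chi_n=O(1)$, and $\max_{1\le i\le n}\|\hat v_{i,n}\|/\sqrt n=o_p(1)$. If $\mathbb P[\lambda_{\min}(S_n'(M_n\otimes M_n)S_n)>0]\to1$ and $\|\kappa_n^{\mathrm{CR}}\|_\infty=O_p(1)$, then $$\hat\Sigma_n^{\mathrm{CR}}=\Sigma_n+o_p(1).$$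
   Context: All limits are as $n\to\infty$, in a triangular-array setting. For each $n$, the random data $\{(y_{i,n},x_{i,n}',w_{i,n}'):1\le i\le n\}$ are generated by $y_{i,n}=\beta'x_{i,n}+\gamma_n'w_{i,n}+u_{i,n}$, where $y_{i,n}$ is scalar, $x_{i,n}$ is $d\times1$ with $d$ fixed, $w_{i,n}$ is $K_n\times1$ ($K_n$ may grow with $n$), and $u_{i,n}$ is an unobserved scalar error. Put $\mathcal X_n=(x_{1,n},\dots,x_{n,n})$, $\mathcal W_n=(w_{1,n},\dots,w_{n,n})$. $\|\cdot\|$ is the Euclidean norm, $\lambda_{\min}(\cdot)$ the minimum eigenvalue, $\mathbb V$ the variance, $\#$ cardinality. $M_n=(M_{ij,n})$ is the $n\times n$ matrix $M_{ij,n}=\mathbf 1\{i=j\}-w_{i,n}'(\sum_{k=1}^n w_{k,n}w_{k,n}')^{-1}w_{j,n}$; $\hat v_{i,n}=\sum_{j=1}^nM_{ij,n}x_{j,n}$; the OLS estimator is $\hat\beta_n=(\sum_{i=1}^n\hat v_{i,n}\hat v_{i,n}')^{-1}\sum_{i=1}^n\hat v_{i,n}y_{i,n}$; residuals are $\hat u_{i,n}=\sum_{j=1}^nM_{ij,n}(y_{j,n}-\hat\beta_n'x_{j,n})$. $\Sigma_n=\mathbb V[\frac1{\sqrt n}\sum_{i=1}^n\hat v_{i,n}u_{i,n}|\mathcal X_n,\mathcal W_n]$. $v_{i,n}=x_{i,n}-(\sum_{j=1}^n\mathbb E[x_{j,n}w_{j,n}'])(\sum_{j=1}^n\mathbb E[w_{j,n}w_{j,n}'])^{-1}w_{i,n}$,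 $Q_{i,n}=\mathbb E[v_{i,n}|\mathcal W_n]$, $\chi_n=\frac1n\sum_{i=1}^n\mathbb E[\|Q_{i,n}\|^2]$. $V_{i,n}=x_{i,n}-\mathbb E[x_{i,n}|\mathcal W_n]$, $\tilde V_{i,n}=\sum_{j=1}^nM_{ij,n}V_{j,n}$, $\tilde\Gamma_n=\frac1n\sum_{i=1}^n\tilde V_{i,n}\tilde V_{i,n}'$, and $$\mathcal C_n=\max_{1\le i\le n}\{\mathbb E[u_{i,n}^4|\mathcal X_n,\mathcal W_n]+\mathbb E[\|V_{i,n}\|^4|\mathcal W_n]+1/\mathbb E[u_{i,n}^2|\mathcal X_n,\mathcal W_n]\}+1/\lambda_{\min}(\mathbb E[\tilde\Gamma_n|\mathcal W_n]).$$ Let $L_n=\sum_{g=1}^{G_n}(\#\mathcal T_{g,n})^2$, and let $\Omega_{u,n}=\mathbb E[u_nu_n'|\mathcal X_n,\mathcal W_n]$ with $u_n=(u_{1,n},\dots,u_{n,n})'$. $S_n$ is the $n^2\times L_n$ selection matrix of full column rank such that $S_n'\mathrm{vec}(\Omega_{u,n})$ is the $L_n\times1$ vector of the (within-cluster, i.e. possibly non-zero) elements of $\Omega_{u,n}$, i.e. of the entries $(i,j)$ with $i,j\in\mathcal T_{g,n}$ for some $g$, indexed by triples $(g,i,j)$ (ordered by cluster, then $i$, then $j$). With $\otimes$ the Kronecker product, $\kappa_n^{\mathrm{CR}}=(S_n'(M_n\otimes M_n)S_n)^{-1}$, with entry $\kappa^{\mathrm{CR}}_{g_1,g_2,i_1,j_1,i_2,j_2,n}$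 in row $(g_1,i_1,j_1)$ and column $(g_2,i_2,j_2)$; $\|\kappa_n^{\mathrm{CR}}\|_\infty=\max_{(g_1,i_1,j_1)}\sum_{g_2=1}^{G_n}\sum_{i_2,j_2\in\mathcal T_{g_2,n}}|\kappa^{\mathrm{CR}}_{g_1,g_2,i_1,j_1,i_2,j_2,n}|$. The proposed estimator is $$\hat\Sigma_n^{\mathrm{CR}}=\frac1n\sum_{g_1=1}^{G_n}\sum_{g_2=1}^{G_n}\sum_{i_1,j_1\in\mathcal T_{g_1,n}}\sum_{i_2,j_2\in\mathcal T_{g_2,n}}\kappa^{\mathrm{CR}}_{g_1,g_2,i_1,j_1,i_2,j_2,n}\hat v_{i_1,n}\hat v_{j_1,n}'\hat u_{i_2,n}\hat u_{j_2,n}.$$ *)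

theory Defs
  imports
    "HOL-Probability.Probability"
    "HOL-Library.Landau_Symbols"
    "Jordan_Normal_Form.Char_Poly"
    "Jordan_Normal_Form.Gauss_Jordan_Elimination"
begin

unbundle no vec_syntax
unbundle no inner_syntax
hide_const (open) Finite_Cartesian_Product.vec Finite_Cartesian_Product.mat
hide_const (open) Finite_Cartesian_Product.row Finite_Cartesian_Product.rows


section \<open>Matrices whose dimensions vary with the sample size\<close>

definition lambda_min :: "real mat \<Rightarrow> real" where
  "lambda_min A = Min {k. eigenvalue A k}"

text \<open>The value at singular matrices is a mere convention (the zero matrix).\<close>

definition mat_inv :: "real mat \<Rightarrow> real mat" where
  "mat_inv A = (case mat_inverse A of Some B \<Rightarrow> B | None \<Rightarrow> 0\<^sub>m (dim_row A) (dim_row A))"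

definition vec_norm :: "real vec \<Rightarrow> real" where
  "vec_norm v = sqrt (v \<bullet> v)"

definition mat_norm :: "real mat \<Rightarrow> real" where
  "mat_norm A = sqrt (\<Sum>i<dim_row A. \<Sum>j<dim_col A. (A $$ (i, j))\<^sup>2)"

text \<open>The norm of the inverse, where a singular matrix counts as having an infinitely
  large inverse; so stochastic boundedness of \<open>inverse_norm\<close> includes invertibility with
  probability close to one.\<close>

definition inverse_norm :: "real mat \<Rightarrow> ennreal" where
  "inverse_norm A = (if invertible_mat A then ennreal (mat_norm (mat_inv A)) else \<infinity>)"

definition kronecker :: "real mat \<Rightarrow> real mat \<Rightarrow> real mat" where
  "kronecker A B = mat (dim_row A * dim_row B) (dim_col A * dim_col B)
     (\<lambda>(i, j). A $$ (i div dim_row B, j div dim_col B) * B $$ (i mod dim_row B, j mod dim_col B))"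

text \<open>Stacking of columns.\<close>

definition mat_vec :: "real mat \<Rightarrow> real vec" where
  "mat_vec A = vec (dim_row A * dim_col A) (\<lambda>p. A $$ (p mod dim_row A, p div dim_row A))"

definition gram :: "nat \<Rightarrow> nat \<Rightarrow> (nat \<Rightarrow> real vec) \<Rightarrow> real mat" where
  "gram m n z = mat m m (\<lambda>(a, b). \<Sum>i<n. z i $ a * z i $ b)"


section \<open>Stochastic order symbols\<close>

text \<open>The rows of a triangular array may live on different probability spaces.\<close>

definition bounded_in_prob :: "(nat \<Rightarrow> 'a measure) \<Rightarrow> (nat \<Rightarrow> 'a \<Rightarrow> ennreal) \<Rightarrow> bool" where
  "bounded_in_prob P Z \<longleftrightarrow>
     (\<forall>\<epsilon>>0. \<exists>B::real. \<forall>\<^sub>F n in sequentially.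
        measure (P n) {\<omega> \<in> space (P n). Z n \<omega> > ennreal B} \<le> \<epsilon>)"

definition vanishes_in_prob :: "(nat \<Rightarrow> 'a measure) \<Rightarrow> (nat \<Rightarrow> 'a \<Rightarrow> real) \<Rightarrow> bool" where
  "vanishes_in_prob P Z \<longleftrightarrow>
     (\<forall>\<epsilon>>0. (\<lambda>n. measure (P n) {\<omega> \<in> space (P n). \<bar>Z n \<omega>\<bar> > \<epsilon>}) \<longlonglongrightarrow> 0)"

definition prob_to_one :: "(nat \<Rightarrow> 'a measure) \<Rightarrow> (nat \<Rightarrow> 'a \<Rightarrow> bool) \<Rightarrow> bool" where
  "prob_to_one P E \<longleftrightarrow> (\<lambda>n. measure (P n) {\<omega> \<in> space (P n). E n \<omega>}) \<longlonglongrightarrow> 1"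


section \<open>Generated sub-algebras and conditional independence\<close>

definition generated_by :: "'a measure \<Rightarrow> ('a \<Rightarrow> real) set \<Rightarrow> 'a measure" where
  "generated_by P F = sigma (space P) {f -` B \<inter> space P | f B. f \<in> F \<and> B \<in> sets borel}"

text \<open>The analogue of \<open>indep_sets\<close> given the sub-algebra \<open>H\<close>.\<close>

definition cond_indep_sets ::
    "'a measure \<Rightarrow> 'a measure \<Rightarrow> ('i \<Rightarrow> 'a set set) \<Rightarrow> 'i set \<Rightarrow> bool" where
  "cond_indep_sets P H A I \<longleftrightarrow>
     (\<forall>i\<in>I. A i \<subseteq> sets P) \<and>
     (\<forall>J\<subseteq>I. J \<noteq> {} \<longrightarrow> finite J \<longrightarrow> (\<forall>B\<in>Pi J A.
        AE \<omega> in P. real_cond_exp P H (indicator (\<Inter>j\<in>J. B j)) \<omega> =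
                   (\<Prod>j\<in>J. real_cond_exp P H (indicator (B j)) \<omega>)))"


section \<open>One row of the triangular array\<close>

text \<open>Observations are indexed by \<open>{..<nobs S}\<close> and clusters by \<open>{..<ncl S}\<close>,
  i.e. all indices are shifted down by one.\<close>

record 'a sample =
  Pr   :: "'a measure"
  nobs :: nat
  dimx :: nat
  dimw :: nat
  yv   :: "nat \<Rightarrow> 'a \<Rightarrow> real"
  xv   :: "nat \<Rightarrow> 'a \<Rightarrow> real vec"
  wv   :: "nat \<Rightarrow> 'a \<Rightarrow> real vec"
  uv   :: "nat \<Rightarrow> 'a \<Rightarrow> real"
  ncl  :: nat
  cl   :: "nat \<Rightarrow> nat set"

text \<open>Random vectors of the stated dimensions for which the expectations \<open>E[x w']\<close>,
  \<open>E[w w']\<close>, \<open>E[x | W]\<close> and \<open>E[u | X, W]\<close> exist.\<close>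

definition well_formed :: "'a sample \<Rightarrow> bool" where
  "well_formed S \<longleftrightarrow>
     prob_space (Pr S) \<and> 0 < dimx S \<and> 0 < dimw S \<and>
     (\<forall>i<nobs S.
        yv S i \<in> borel_measurable (Pr S) \<and>
        integrable (Pr S) (uv S i) \<and>
        (\<forall>\<omega>\<in>space (Pr S). xv S i \<omega> \<in> carrier_vec (dimx S) \<and> wv S i \<omega> \<in> carrier_vec (dimw S)) \<and>
        (\<forall>a<dimx S. integrable (Pr S) (\<lambda>\<omega>. xv S i \<omega> $ a)) \<and>
        (\<forall>b<dimw S. (\<lambda>\<omega>. wv S i \<omega> $ b) \<in> borel_measurable (Pr S)) \<and>
        (\<forall>a<dimx S. \<forall>b<dimw S. integrable (Pr S) (\<lambda>\<omega>. xv S i \<omega> $ a * wv S i \<omega> $ b)) \<and>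
        (\<forall>a<dimw S. \<forall>b<dimw S. integrable (Pr S) (\<lambda>\<omega>. wv S i \<omega> $ a * wv S i \<omega> $ b)))"

definition linear_model :: "'a sample \<Rightarrow> real vec \<Rightarrow> real vec \<Rightarrow> bool" where
  "linear_model S \<beta> \<gamma> \<longleftrightarrow>
     \<beta> \<in> carrier_vec (dimx S) \<and> \<gamma> \<in> carrier_vec (dimw S) \<and>
     (\<forall>i<nobs S. \<forall>\<omega>\<in>space (Pr S).
        yv S i \<omega> = \<beta> \<bullet> xv S i \<omega> + \<gamma> \<bullet> wv S i \<omega> + uv S i \<omega>)"

definition sigma_W :: "'a sample \<Rightarrow> 'a measure" where
  "sigma_W S = generated_by (Pr S) {\<lambda>\<omega>. wv S i \<omega> $ b | i b. i < nobs S \<and> b < dimw S}"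

definition sigma_XW :: "'a sample \<Rightarrow> 'a measure" where
  "sigma_XW S = generated_by (Pr S)
     ({\<lambda>\<omega>. xv S i \<omega> $ a | i a. i < nobs S \<and> a < dimx S} \<union>
      {\<lambda>\<omega>. wv S i \<omega> $ b | i b. i < nobs S \<and> b < dimw S})"

definition sigma_cluster :: "'a sample \<Rightarrow> nat \<Rightarrow> 'a measure" where
  "sigma_cluster S g = generated_by (Pr S)
     ({uv S i | i. i \<in> cl S g} \<union> {\<lambda>\<omega>. xv S i \<omega> $ a | i a. i \<in> cl S g \<and> a < dimx S})"

definition clusters_partition :: "'a sample \<Rightarrow> bool" where
  "clusters_partition S \<longleftrightarrow>
     inj_on (cl S) {..<ncl S} \<and> partition_on {..<nobs S} (cl S ` {..<ncl S})"


subsection \<open>Least squares after partialling out \<open>w\<close>\<close>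

definition gram_w :: "'a sample \<Rightarrow> 'a \<Rightarrow> real mat" where
  "gram_w S \<omega> = gram (dimw S) (nobs S) (\<lambda>i. wv S i \<omega>)"

definition annihilator :: "'a sample \<Rightarrow> 'a \<Rightarrow> real mat" where
  "annihilator S \<omega> = mat (nobs S) (nobs S)
     (\<lambda>(i, j). (if i = j then 1 else 0) - wv S i \<omega> \<bullet> (mat_inv (gram_w S \<omega>) *\<^sub>v wv S j \<omega>))"

definition partial_out :: "'a sample \<Rightarrow> (nat \<Rightarrow> 'a \<Rightarrow> real vec) \<Rightarrow> nat \<Rightarrow> 'a \<Rightarrow> real vec" where
  "partial_out S z i \<omega> =
     vec (dimx S) (\<lambda>a. \<Sum>j<nobs S. annihilator S \<omega> $$ (i, j) * z j \<omega> $ a)"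

definition v_hat :: "'a sample \<Rightarrow> nat \<Rightarrow> 'a \<Rightarrow> real vec" where
  "v_hat S = partial_out S (xv S)"

definition beta_hat :: "'a sample \<Rightarrow> 'a \<Rightarrow> real vec" where
  "beta_hat S \<omega> = mat_inv (gram (dimx S) (nobs S) (\<lambda>i. v_hat S i \<omega>)) *\<^sub>v
     vec (dimx S) (\<lambda>a. \<Sum>i<nobs S. v_hat S i \<omega> $ a * yv S i \<omega>)"

definition u_hat :: "'a sample \<Rightarrow> nat \<Rightarrow> 'a \<Rightarrow> real" where
  "u_hat S i \<omega> =
     (\<Sum>j<nobs S. annihilator S \<omega> $$ (i, j) * (yv S j \<omega> - beta_hat S \<omega> \<bullet> xv S j \<omega>))"


subsection \<open>Conditional moments\<close>

text \<open>\<open>score S a\<close> is the \<open>a\<close>-th coordinate of the normalised sum of the \<open>v_hat u\<close>, and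
  \<open>Sigma_cond\<close> is its conditional covariance matrix given the regressors. \<open>real_cond_exp\<close> subtracts
  the conditional expectations of the positive and negative parts, so no unconditional second
  moment is required here.\<close>

definition score :: "'a sample \<Rightarrow> nat \<Rightarrow> 'a \<Rightarrow> real" where
  "score S a \<omega> = (1 / sqrt (nobs S)) * (\<Sum>i<nobs S. v_hat S i \<omega> $ a * uv S i \<omega>)"

definition Sigma_cond :: "'a sample \<Rightarrow> 'a \<Rightarrow> real mat" where
  "Sigma_cond S \<omega> = mat (dimx S) (dimx S) (\<lambda>(a, b). real_cond_exp (Pr S) (sigma_XW S)
     (\<lambda>\<omega>'. (score S a \<omega>' - real_cond_exp (Pr S) (sigma_XW S) (score S a) \<omega>') *
            (score S b \<omega>' - real_cond_exp (Pr S) (sigma_XW S) (score S b) \<omega>')) \<omega>)"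

definition cond_exp_W :: "'a sample \<Rightarrow> ('a \<Rightarrow> real vec) \<Rightarrow> 'a \<Rightarrow> real vec" where
  "cond_exp_W S z \<omega> = vec (dimx S) (\<lambda>a. real_cond_exp (Pr S) (sigma_W S) (\<lambda>\<omega>'. z \<omega>' $ a) \<omega>)"

definition projection_coeff :: "'a sample \<Rightarrow> real mat" where
  "projection_coeff S =
     mat (dimx S) (dimw S) (\<lambda>(a, b). \<Sum>j<nobs S. \<integral>\<omega>. xv S j \<omega> $ a * wv S j \<omega> $ b \<partial>Pr S) *
     mat_inv (mat (dimw S) (dimw S) (\<lambda>(a, b). \<Sum>j<nobs S. \<integral>\<omega>. wv S j \<omega> $ a * wv S j \<omega> $ b \<partial>Pr S))"

definition v_pop :: "'a sample \<Rightarrow> nat \<Rightarrow> 'a \<Rightarrow> real vec" where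
  "v_pop S i \<omega> = xv S i \<omega> - projection_coeff S *\<^sub>v wv S i \<omega>"

definition Q_vec :: "'a sample \<Rightarrow> nat \<Rightarrow> 'a \<Rightarrow> real vec" where
  "Q_vec S i = cond_exp_W S (v_pop S i)"

definition chi :: "'a sample \<Rightarrow> ennreal" where
  "chi S = ennreal (1 / nobs S) *
     (\<Sum>i<nobs S. \<integral>\<^sup>+\<omega>. ennreal ((vec_norm (Q_vec S i \<omega>))\<^sup>2) \<partial>Pr S)"

definition V_vec :: "'a sample \<Rightarrow> nat \<Rightarrow> 'a \<Rightarrow> real vec" where
  "V_vec S i \<omega> = xv S i \<omega> - cond_exp_W S (xv S i) \<omega>"

definition Gamma_tilde :: "'a sample \<Rightarrow> 'a \<Rightarrow> real mat" where
  "Gamma_tilde S \<omega> =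
     (1 / nobs S) \<cdot>\<^sub>m gram (dimx S) (nobs S) (\<lambda>i. partial_out S (V_vec S) i \<omega>)"

definition cond_exp_Gamma_tilde :: "'a sample \<Rightarrow> 'a \<Rightarrow> real mat" where
  "cond_exp_Gamma_tilde S \<omega> = mat (dimx S) (dimx S)
     (\<lambda>(a, b). real_cond_exp (Pr S) (sigma_W S) (\<lambda>\<omega>'. Gamma_tilde S \<omega>' $$ (a, b)) \<omega>)"

text \<open>Extended-real-valued, so that \<open>1 / 0 = \<infinity>\<close> and infinite conditional moments count as
  infinite.\<close>

definition C_moment :: "'a sample \<Rightarrow> 'a \<Rightarrow> ennreal" where
  "C_moment S \<omega> =
     (MAX i\<in>{..<nobs S}.
        nn_cond_exp (Pr S) (sigma_XW S) (\<lambda>\<omega>'. ennreal ((uv S i \<omega>')^4)) \<omega> +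
        nn_cond_exp (Pr S) (sigma_W S) (\<lambda>\<omega>'. ennreal ((vec_norm (V_vec S i \<omega>'))^4)) \<omega> +
        1 / nn_cond_exp (Pr S) (sigma_XW S) (\<lambda>\<omega>'. ennreal ((uv S i \<omega>')\<^sup>2)) \<omega>) +
     1 / ennreal (lambda_min (cond_exp_Gamma_tilde S \<omega>))"


subsection \<open>The cluster-robust variance estimator\<close>

definition triples :: "'a sample \<Rightarrow> (nat \<times> nat \<times> nat) list" where
  "triples S = concat (map (\<lambda>g.
     map (Pair g) (List.product (sorted_list_of_set (cl S g)) (sorted_list_of_set (cl S g))))
     [0..<ncl S])"

definition selection :: "'a sample \<Rightarrow> real mat" where
  "selection S = mat (nobs S * nobs S) (length (triples S))
     (\<lambda>(p, q). case triples S ! q of (g, i, j) \<Rightarrow> if p = j * nobs S + i then 1 else 0)"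

definition selected_kronecker :: "'a sample \<Rightarrow> 'a \<Rightarrow> real mat" where
  "selected_kronecker S \<omega> =
     transpose_mat (selection S) * kronecker (annihilator S \<omega>) (annihilator S \<omega>) * selection S"

definition triple_pos :: "'a sample \<Rightarrow> nat \<times> nat \<times> nat \<Rightarrow> nat" where
  "triple_pos S t = (THE q. q < length (triples S) \<and> triples S ! q = t)"

definition kappa_CR :: "'a sample \<Rightarrow> 'a \<Rightarrow> nat \<times> nat \<times> nat \<Rightarrow> nat \<times> nat \<times> nat \<Rightarrow> real" where
  "kappa_CR S \<omega> t1 t2 = mat_inv (selected_kronecker S \<omega>) $$ (triple_pos S t1, triple_pos S t2)"

definition kappa_CR_norm :: "'a sample \<Rightarrow> 'a \<Rightarrow> real" where
  "kappa_CR_norm S \<omega> = (MAX t1\<in>set (triples S).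
     \<Sum>g2<ncl S. \<Sum>i2\<in>cl S g2. \<Sum>j2\<in>cl S g2. \<bar>kappa_CR S \<omega> t1 (g2, i2, j2)\<bar>)"

definition Sigma_hat_CR :: "'a sample \<Rightarrow> 'a \<Rightarrow> real mat" where
  "Sigma_hat_CR S \<omega> = mat (dimx S) (dimx S) (\<lambda>(a, b).
     (1 / nobs S) * (\<Sum>g1<ncl S. \<Sum>g2<ncl S. \<Sum>i1\<in>cl S g1. \<Sum>j1\<in>cl S g1. \<Sum>i2\<in>cl S g2. \<Sum>j2\<in>cl S g2.
        kappa_CR S \<omega> (g1, i1, j1) (g2, i2, j2) *
        (v_hat S i1 \<omega> $ a * v_hat S j1 \<omega> $ b) * u_hat S i2 \<omega> * u_hat S j2 \<omega>))"

lemma length_triples: "length (triples S) = (\<Sum>g<ncl S. (card (cl S g))\<^sup>2)"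
  by (simp add: triples_def length_concat comp_def power2_eq_square sum_list_sum_nth
      atLeast0LessThan)

lemma set_triples:
  assumes "clusters_partition S"
  shows "set (triples S) = {(g, i, j). g < ncl S \<and> i \<in> cl S g \<and> j \<in> cl S g}"
proof -
  have "finite (cl S g)" if "g < ncl S" for g
  proof (rule finite_subset)
    show "cl S g \<subseteq> {..<nobs S}"
      using assms that unfolding clusters_partition_def partition_on_def by blast
  qed simp
  then show ?thesis
    unfolding triples_def by (auto simp: image_iff)
qed

text \<open>\<open>selection\<close> indeed extracts the within-cluster entries of any square matrix, in
  particular of the conditional second moment matrix of the errors.\<close>

lemma selection_mat_vec:
  assumes part: "clusters_partition S" and A: "A \<in> carrier_mat (nobs S) (nobs S)"
  shows "transpose_mat (selection S) *\<^sub>v mat_vec A =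
         vec_of_list (map (\<lambda>(g, i, j). A $$ (i, j)) (triples S))"
proof (rule eq_vecI)
  fix q assume "q < dim_vec (vec_of_list (map (\<lambda>(g, i, j). A $$ (i, j)) (triples S)))"
  then have q: "q < length (triples S)" by simp
  obtain g i j where t: "triples S ! q = (g, i, j)" by (metis prod_cases3)
  have "(g, i, j) \<in> set (triples S)" using q t by (metis nth_mem)
  then have "g < ncl S" "i \<in> cl S g" "j \<in> cl S g" using set_triples[OF part] by auto
  then have ij: "i < nobs S" "j < nobs S"
    using part unfolding clusters_partition_def partition_on_def by blast+
  have "Suc j * nobs S \<le> nobs S * nobs S" using ij by (intro mult_right_mono) auto
  then have lt: "j * nobs S + i < nobs S * nobs S" using ij by simp
  show "(transpose_mat (selection S) *\<^sub>v mat_vec A) $ q =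
        vec_of_list (map (\<lambda>(g, i, j). A $$ (i, j)) (triples S)) $ q"
    using q t ij lt A
    by (simp add: selection_def mat_vec_def scalar_prod_def if_distrib[of "\<lambda>x. x * _"]
        sum.delta vec_of_list_index cong: if_cong)
qed (simp add: selection_def)

end

theory Submission
  imports Defs
begin

text \<open>The residuals are \<open>u_hat = M u - v_hat' (beta_hat - \<beta>)\<close>. With \<open>M u\<close> in place of \<open>u_hat\<close>
  the estimator is a quadratic form in the errors whose conditional mean given the regressors is
  exactly \<open>\<Sigma>\<close>, because \<open>\<kappa>\<close> inverts the map from the within-cluster entries of
  \<open>\<Omega>\<close> to those of \<open>M \<Omega> M\<close>. Its conditional variance is at most a constant times the
  squared Frobenius norm of the coefficient matrix: conditioning on everything except the errors
  of one cluster shows that products of errors are uncorrelated unless their clusters pair up.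
  Since \<open>M\<close> is a contraction, that squared norm is of order
  \<open>\<parallel>\<kappa>\<parallel>\<^sup>2 max \<parallel>v_hat\<parallel>\<^sup>2 / n\<close>, which vanishes. Replacing \<open>M u\<close> by \<open>u_hat\<close> costs
  \<open>max \<parallel>v_hat\<parallel> \<parallel>beta_hat - \<beta>\<parallel>\<close>, and \<open>\<parallel>beta_hat - \<beta>\<parallel>\<close> is of order \<open>1 / sqrt n\<close>
  because \<open>\<Sigma>\<close> is dominated by a multiple of the Gram matrix of the \<open>v_hat\<close>.

  Conditional moments exist only with probability close to one. Hence all errors are multiplied by the
  indicator of an event that is measurable with respect to the regressors and on which everything
  needed is bounded.\<close>

text \<open>Independence is assumed only given \<open>W\<close>, while the moments that enter the
  estimator are taken given both regressors. The bridge is a comparison of nested \<sigma>-algebras: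
  what concerns one cluster has the same conditional expectation given its own regressors and
  \<open>W\<close>, given all regressors, and given all regressors together with the errors of the
  other clusters. The last of these allows one error, or a product of two errors of one cluster, to
  be integrated out while all other factors stay fixed.

  No unconditional fourth moment of the errors is assumed. Measurability of the truncating event
  with respect to the regressors lets its indicator pass through every conditional expectation, so
  that zero means and within-cluster covariances survive.

  The truncating event depends on a bound \<zeta> for \<open>max |v_hat| / sqrt n\<close>. The
  expectations of the score and of the weighted squares of \<open>M u\<close> have bounds free of
  \<zeta>, so all other stochastic bounds can be fixed first. Every remaining error carries a factor
  \<zeta>, which is chosen last.\<close>

section \<open>Events of probability close to one\<close>

text \<open>The exceptional set is only required to be contained in a small measurable one, so that no
  measurability of \<open>E\<close> is needed.\<close>

definition with_prob :: "(nat \<Rightarrow> 'a measure) \<Rightarrow> real \<Rightarrow> (nat \<Rightarrow> 'a \<Rightarrow> bool) \<Rightarrow> bool" where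
  "with_prob P \<theta> E \<longleftrightarrow> (\<forall>\<^sub>F n in sequentially. \<exists>N\<in>sets (P n). measure (P n) N \<le> \<theta> \<and>
     (\<forall>\<omega>\<in>space (P n) - N. E n \<omega>))"

lemma with_prob_conj:
  assumes "\<And>n. prob_space (P n)" "with_prob P \<theta> E" "with_prob P \<theta>' E'"
  shows "with_prob P (\<theta> + \<theta>') (\<lambda>n \<omega>. E n \<omega> \<and> E' n \<omega>)"
  unfolding with_prob_def
  using assms(2,3)[unfolded with_prob_def]
proof eventually_elim
  case (elim n)
  then obtain N N' where N: "N \<in> sets (P n)" "measure (P n) N \<le> \<theta>" "\<forall>\<omega>\<in>space (P n) - N. E n \<omega>"
    and N': "N' \<in> sets (P n)" "measure (P n) N' \<le> \<theta>'" "\<forall>\<omega>\<in>space (P n) - N'. E' n \<omega>" by blast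
  interpret prob_space "P n" by fact
  have "measure (P n) (N \<union> N') \<le> \<theta> + \<theta>'"
    using measure_Un_le[of N "P n" N'] N N' by simp
  with N N' show ?case by (intro bexI[of _ "N \<union> N'"]) auto
qed

lemma with_prob_mono:
  assumes "with_prob P \<theta> E" "\<theta> \<le> \<theta>'"
    and "\<forall>\<^sub>F n in sequentially. \<forall>\<omega>\<in>space (P n). E n \<omega> \<longrightarrow> E' n \<omega>"
  shows "with_prob P \<theta>' E'"
  unfolding with_prob_def using assms(1)[unfolded with_prob_def] assms(3)
proof eventually_elim
  case (elim n)
  then show ?case using assms(2) by (meson DiffD1 order_trans)
qed

text \<open>Identities between conditional expectations hold only almost surely. Their exceptional
  set lies in a null set, and enlarging \<open>N\<close> by it costs no probability.\<close>

lemma with_prob_AE: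
  assumes "\<And>n. prob_space (P n)" "with_prob P \<theta> E"
    and "\<forall>\<^sub>F n in sequentially. AE \<omega> in P n. E n \<omega> \<longrightarrow> E' n \<omega>"
  shows "with_prob P \<theta> E'"
  unfolding with_prob_def using assms(2)[unfolded with_prob_def] assms(3)
proof eventually_elim
  case (elim n)
  then obtain N where N: "N \<in> sets (P n)" "measure (P n) N \<le> \<theta>" "\<forall>\<omega>\<in>space (P n) - N. E n \<omega>"
    by blast
  from elim(2) obtain N' where N': "N' \<in> null_sets (P n)"
    "{\<omega>\<in>space (P n). \<not> (E n \<omega> \<longrightarrow> E' n \<omega>)} \<subseteq> N'" by (auto simp: eventually_ae_filter)
  have "measure (P n) (N \<union> N') = measure (P n) N"
    using N(1) N'(1) by (simp add: measure_Un_null_set)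
  then show ?case using N N' by (intro bexI[of _ "N \<union> N'"]) auto
qed

lemma with_prob_finite_ball:
  assumes "\<And>n. prob_space (P n)" "finite J" "\<And>j. j \<in> J \<Longrightarrow> with_prob P \<theta> (E j)"
  shows "with_prob P (real (card J) * \<theta>) (\<lambda>n \<omega>. \<forall>j\<in>J. E j n \<omega>)"
  using assms(2,3)
proof (induction J rule: finite_induct)
  case empty
  then show ?case unfolding with_prob_def by (auto intro!: bexI[of _ "{}"] always_eventually)
next
  case (insert j J)
  have "with_prob P (\<theta> + real (card J) * \<theta>) (\<lambda>n \<omega>. E j n \<omega> \<and> (\<forall>j\<in>J. E j n \<omega>))"
    using insert by (intro with_prob_conj assms(1)) auto
  then show ?case
    by (rule with_prob_mono) (use insert in \<open>auto simp: algebra_simps\<close>)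
qed

lemma vanishes_in_probI:
  assumes P: "\<And>n. prob_space (P n)"
    and Z: "\<And>\<epsilon> \<theta>. \<epsilon> > 0 \<Longrightarrow> \<theta> > 0 \<Longrightarrow> with_prob P \<theta> (\<lambda>n \<omega>. \<bar>Z n \<omega>\<bar> \<le> \<epsilon>)"
  shows "vanishes_in_prob P Z"
  unfolding vanishes_in_prob_def
proof (intro allI impI)
  fix \<epsilon> :: real assume e: "\<epsilon> > 0"
  show "(\<lambda>n. measure (P n) {\<omega> \<in> space (P n). \<bar>Z n \<omega>\<bar> > \<epsilon>}) \<longlonglongrightarrow> 0"
  proof (rule tendstoI)
    fix \<theta> :: real assume t: "\<theta> > 0"
    from Z[OF e half_gt_zero[OF t], unfolded with_prob_def]
    show "\<forall>\<^sub>F n in sequentially. dist (measure (P n) {\<omega> \<in> space (P n). \<bar>Z n \<omega>\<bar> > \<epsilon>}) 0 < \<theta>"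
    proof eventually_elim
      case (elim n)
      interpret prob_space "P n" by fact
      from elim obtain N where N: "N \<in> events" "prob N \<le> \<theta> / 2"
        "\<forall>\<omega>\<in>space (P n) - N. \<bar>Z n \<omega>\<bar> \<le> \<epsilon>" by blast
      \<comment> \<open>Monotonicity asks for measurability of the larger set \<open>N\<close>
        alone: were the smaller set not measurable, its measure would be 0.\<close>
      have "prob {\<omega> \<in> space (P n). \<bar>Z n \<omega>\<bar> > \<epsilon>} \<le> prob N"
        using N by (intro finite_measure_mono) force+
      then show ?case using N t by simp
    qed
  qed
qed

text \<open>Measurability matters in this direction: a non-measurable exceptional set has measure 0
  by convention, which would say nothing about measurable sets containing it.\<close>

lemma vanishes_in_probD:
  assumes "vanishes_in_prob P Z" "\<epsilon> > 0" "\<theta> > 0"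
    and "\<forall>\<^sub>F n in sequentially. Z n \<in> borel_measurable (P n)"
  shows "with_prob P \<theta> (\<lambda>n \<omega>. \<bar>Z n \<omega>\<bar> \<le> \<epsilon>)"
proof -
  have "(\<lambda>n. measure (P n) {\<omega> \<in> space (P n). \<bar>Z n \<omega>\<bar> > \<epsilon>}) \<longlonglongrightarrow> 0"
    using assms unfolding vanishes_in_prob_def by auto
  then have "\<forall>\<^sub>F n in sequentially. measure (P n) {\<omega> \<in> space (P n). \<bar>Z n \<omega>\<bar> > \<epsilon>} < \<theta>"
    using assms(3) by (rule order_tendstoD)
  then show ?thesis
    unfolding with_prob_def using assms(4)
  proof eventually_elim
    case (elim n)
    note [measurable] = elim(2)
    show ?case using elim(1)
      by (intro bexI[of _ "{\<omega> \<in> space (P n). \<bar>Z n \<omega>\<bar> > \<epsilon>}"]) (auto simp: not_less)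
  qed
qed

lemma bounded_in_probD:
  assumes "bounded_in_prob P Z" "\<theta> > 0"
    and "\<forall>\<^sub>F n in sequentially. Z n \<in> borel_measurable (P n)"
  obtains B where "B > 0" "with_prob P \<theta> (\<lambda>n \<omega>. Z n \<omega> \<le> ennreal B)"
proof -
  obtain B where B: "\<forall>\<^sub>F n in sequentially.
        measure (P n) {\<omega> \<in> space (P n). Z n \<omega> > ennreal B} \<le> \<theta>"
    using assms unfolding bounded_in_prob_def by auto
  have "with_prob P \<theta> (\<lambda>n \<omega>. Z n \<omega> \<le> ennreal B)"
    unfolding with_prob_def using B assms(3)
  proof eventually_elim
    case (elim n)
    note [measurable] = elim(2)
    show ?case using elim(1)
      by (intro bexI[of _ "{\<omega> \<in> space (P n). Z n \<omega> > ennreal B}"]) (auto simp: not_less)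
  qed
  then have "with_prob P \<theta> (\<lambda>n \<omega>. Z n \<omega> \<le> ennreal (max B 1))"
    by (rule with_prob_mono)
       (auto intro!: always_eventually intro: order_trans[OF _ ennreal_leI[OF max.cobounded1]])
  then show ?thesis by (intro that[of "max B 1"]) auto
qed

lemma prob_to_oneD:
  assumes P: "\<And>n. prob_space (P n)" and "prob_to_one P E" "\<theta> > 0"
  shows "with_prob P \<theta> E"
proof -
  have lim: "(\<lambda>n. measure (P n) {\<omega> \<in> space (P n). E n \<omega>}) \<longlonglongrightarrow> 1"
    using assms unfolding prob_to_one_def by simp
  \<comment> \<open>The lower bound is kept at least 0 so that the event has strictly positive
    measure, which forces it to be measurable.\<close>
  have "\<forall>\<^sub>F n in sequentially. measure (P n) {\<omega> \<in> space (P n). E n \<omega>} > max 0 (1 - \<theta>)"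
    by (rule order_tendstoD(1)[OF lim]) (use assms(3) in auto)
  then show ?thesis unfolding with_prob_def
  proof eventually_elim
    case (elim n)
    interpret prob_space "P n" by fact
    \<comment> \<open>Non-measurable sets have measure zero.\<close>
    have E: "{\<omega> \<in> space (P n). E n \<omega>} \<in> events"
      using elim measure_notin_sets by fastforce
    have "prob (space (P n) - {\<omega> \<in> space (P n). E n \<omega>}) \<le> \<theta>"
      using prob_compl[OF E] elim by auto
    then show ?case
      by (intro bexI[of _ "space (P n) - {\<omega> \<in> space (P n). E n \<omega>}"]) (use E in auto)
  qed
qed

lemma with_prob_Markov:
  assumes P: "\<And>n. prob_space (P n)"
    and meas: "\<forall>\<^sub>F n in sequentially. Z n \<in> borel_measurable (P n)"
    and int: "\<forall>\<^sub>F n in sequentially. (\<integral>\<^sup>+\<omega>. Z n \<omega> \<partial>P n) \<le> ennreal C"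
    and "B > 0" "C \<ge> 0" "C / B \<le> \<theta>"
  shows "with_prob P \<theta> (\<lambda>n \<omega>. Z n \<omega> \<le> ennreal B)"
  unfolding with_prob_def using meas int
proof eventually_elim
  case (elim n)
  interpret prob_space "P n" by fact
  note [measurable] = elim(1)
  let ?N = "{\<omega>\<in>space (P n). Z n \<omega> > ennreal B}"
  have "emeasure (P n) ?N \<le> emeasure (P n) {\<omega>\<in>space (P n). 1 \<le> ennreal (1 / B) * Z n \<omega>}"
  proof (intro emeasure_mono subsetI)
    fix \<omega> assume "\<omega> \<in> ?N"
    then have "ennreal (1 / B) * ennreal B \<le> ennreal (1 / B) * Z n \<omega>" "\<omega> \<in> space (P n)"
      by (auto intro: mult_left_mono less_imp_le)
    then show "\<omega> \<in> {\<omega>\<in>space (P n). 1 \<le> ennreal (1 / B) * Z n \<omega>}"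
      using \<open>B > 0\<close> by (simp add: ennreal_mult[symmetric])
  qed simp
  also have "\<dots> \<le> ennreal (1 / B) * (\<integral>\<^sup>+\<omega>. Z n \<omega> * indicator (space (P n)) \<omega> \<partial>P n)"
    using nn_integral_Markov_inequality[of "Z n" "space (P n)" "P n" "ennreal (1/B)"] by simp
  also have "\<dots> = ennreal (1 / B) * (\<integral>\<^sup>+\<omega>. Z n \<omega> \<partial>P n)"
    by (intro arg_cong2[where f="(*)"] refl nn_integral_cong) auto
  also have "\<dots> \<le> ennreal (1 / B) * ennreal C" using elim by (intro mult_left_mono) auto
  also have "\<dots> \<le> ennreal \<theta>"
    using assms by (auto simp: ennreal_mult[symmetric] intro!: ennreal_leI)
  finally have "ennreal (prob ?N) \<le> ennreal \<theta>" by (simp add: emeasure_eq_measure)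
  moreover have "\<theta> \<ge> 0" using assms(4-6) by (meson divide_nonneg_pos order_trans)
  ultimately have "prob ?N \<le> \<theta>" by simp
  then show ?case by (intro bexI[of _ ?N]) (auto simp: not_less)
qed

section \<open>Conditional expectations\<close>

context sigma_finite_subalgebra
begin

text \<open>This is applied to products that may lack unconditional moments. Hence the positive part
  (\<open>s = 1\<close>) and the negative part (\<open>s = -1\<close>) are treated separately by the
  rule for nonnegative functions.\<close>

lemma real_cond_exp_indicator:
  assumes [measurable]: "A \<in> sets F" "f \<in> borel_measurable M"
  shows "AE x in M. real_cond_exp M F (\<lambda>x. indicator A x * f x) x = indicator A x * real_cond_exp M F f x"
proof -
  have A[measurable]: "A \<in> sets M" using subalg unfolding subalgebra_def by auto
  have eq: "(\<lambda>x. ennreal (s * (indicator A x * f x))) = (\<lambda>x. indicator A x * ennreal (s * f x))" for s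
    by (auto simp: fun_eq_iff split: split_indicator)
  have 1: "AE x in M. indicator A x * nn_cond_exp M F (\<lambda>x. ennreal (s * f x)) x
         = nn_cond_exp M F (\<lambda>x. ennreal (s * (indicator A x * f x))) x" for s
    unfolding eq by (rule nn_cond_exp_prod) auto
  show ?thesis
    using 1[of 1] 1[of "-1"] unfolding real_cond_exp_def
    by eventually_elim (auto split: split_indicator_asm)
qed

lemma real_cond_exp_finite_sum:
  assumes "finite I" "\<And>i. i \<in> I \<Longrightarrow> integrable M (f i)"
  shows "AE x in M. real_cond_exp M F (\<lambda>x. \<Sum>i\<in>I. f i x) x = (\<Sum>i\<in>I. real_cond_exp M F (f i) x)"
proof -
  let ?g = "\<lambda>i. if i \<in> I then f i else (\<lambda>_. 0)"
  have "AE x in M. real_cond_exp M F (\<lambda>x. \<Sum>i\<in>I. ?g i x) x = (\<Sum>i\<in>I. real_cond_exp M F (?g i) x)"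
    by (rule real_cond_exp_sum) (use assms in auto)
  then show ?thesis by (simp cong: sum.cong)
qed

text \<open>Boundedness of the coefficients carries integrability over from \<open>g i\<close> to
  \<open>f i * g i\<close>.\<close>

lemma real_cond_exp_weighted_sum:
  assumes I: "finite I" and f: "\<And>i. i \<in> I \<Longrightarrow> f i \<in> borel_measurable F"
    and D: "\<And>i x. i \<in> I \<Longrightarrow> \<bar>f i x\<bar> \<le> D" and g: "\<And>i. i \<in> I \<Longrightarrow> integrable M (g i)"
  shows "AE x in M. real_cond_exp M F (\<lambda>x. \<Sum>i\<in>I. f i x * g i x) x = (\<Sum>i\<in>I. f i x * real_cond_exp M F (g i) x)"
proof -
  have int: "integrable M (\<lambda>x. f i x * g i x)" if i: "i \<in> I" for i
  proof (rule Bochner_Integration.integrable_bound)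
    show "integrable M (\<lambda>x. D * g i x)" using g[OF i] by auto
    show "AE x in M. norm (f i x * g i x) \<le> norm (D * g i x)"
      unfolding real_norm_def abs_mult using D[OF i]
      by (intro AE_I2 mult_right_mono) (auto intro: order_trans[OF _ abs_ge_self])
  qed (use measurable_from_subalg[OF subalg f[OF i]] g[OF i] in auto)
  have "AE x in M. \<forall>i\<in>I. real_cond_exp M F (\<lambda>x. f i x * g i x) x = f i x * real_cond_exp M F (g i) x"
    using I f g int by (intro AE_finite_allI real_cond_exp_mult) auto
  moreover have "AE x in M. real_cond_exp M F (\<lambda>x. \<Sum>i\<in>I. f i x * g i x) x
      = (\<Sum>i\<in>I. real_cond_exp M F (\<lambda>x. f i x * g i x) x)"
    by (rule real_cond_exp_finite_sum[OF I int])
  ultimately show ?thesis by eventually_elim simp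
qed

end

lemma subalgebra_trans: "subalgebra A B \<Longrightarrow> subalgebra B C \<Longrightarrow> subalgebra A C"
  unfolding subalgebra_def by auto

lemma (in prob_space) sigma_finite_subalgebraI: "subalgebra M F \<Longrightarrow> sigma_finite_subalgebra M F"
  by (intro finite_measure_subalgebra_is_sigma_finite finite_measure_subalgebra.intro
      finite_measure_subalgebra_axioms.intro finite_measure_axioms)

section \<open>Conditional independence and leave-one-out \<sigma>-algebras\<close>

text \<open>The measures with densities \<open>h1\<close> and \<open>h2\<close>, restricted to
  \<open>F\<close>, agree on the \<pi>-system \<open>E\<close>. As \<open>E\<close> contains the
  whole space and these measures are finite, they agree on \<open>F\<close>, and so do the integrals
  of \<open>F\<close>-measurable functions.\<close>

lemma (in prob_space) nn_integral_eq_on_generator: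
  assumes F: "subalgebra M F" "sets F = sigma_sets (space M) E" "Int_stable E" "space M \<in> E"
    and [measurable]: "h1 \<in> borel_measurable M" "h2 \<in> borel_measurable M"
    and fin: "(\<integral>\<^sup>+x. h1 x \<partial>M) \<noteq> \<infinity>"
    and eq: "\<And>D. D \<in> E \<Longrightarrow> (\<integral>\<^sup>+x. indicator D x * h1 x \<partial>M) = (\<integral>\<^sup>+x. indicator D x * h2 x \<partial>M)"
    and \<phi>: "\<phi> \<in> borel_measurable F"
  shows "(\<integral>\<^sup>+x. \<phi> x * h1 x \<partial>M) = (\<integral>\<^sup>+x. \<phi> x * h2 x \<partial>M)"
proof -
  have ED: "E \<subseteq> sets M" using F(1,2) unfolding subalgebra_def by auto
  have sub: "subalgebra (density M h1) F" "subalgebra (density M h2) F"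
    using F(1) unfolding subalgebra_def by auto
  let ?R = "\<lambda>h. restr_to_subalg (density M h) F"
  have em: "emeasure (?R h) D = (\<integral>\<^sup>+x. indicator D x * h x \<partial>M)"
    if [measurable]: "h \<in> borel_measurable M" and "subalgebra (density M h) F" "D \<in> E" for h D
  proof -
    have [measurable]: "D \<in> sets M" using ED that by auto
    have "D \<in> sets F" using F(2) that by auto
    then show ?thesis using that
      by (subst emeasure_restr_to_subalg) (auto simp: emeasure_density mult.commute)
  qed
  have "?R h1 = ?R h2"
  proof (rule measure_eqI_generator_eq[where E=E and \<Omega>="space M" and A="\<lambda>_. space M"])
    show "E \<subseteq> Pow (space M)" using ED sets.sets_into_space by blast
    show "emeasure (?R h1) X = emeasure (?R h2) X" if "X \<in> E" for X
      using that eq em sub by simp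
    show "sets (?R h1) = sigma_sets (space M) E" "sets (?R h2) = sigma_sets (space M) E"
      using sets_restr_to_subalg[OF sub(1)] sets_restr_to_subalg[OF sub(2)] F(2) by auto
    show "emeasure (?R h1) (space M) \<noteq> \<infinity>" for i :: nat
    proof -
      have "(\<integral>\<^sup>+x. indicator (space M) x * h1 x \<partial>M) = (\<integral>\<^sup>+x. h1 x \<partial>M)"
        by (intro nn_integral_cong) auto
      then show ?thesis using em[OF _ sub(1) F(4)] fin by simp
    qed
  qed (use F in auto)
  moreover have "(\<integral>\<^sup>+x. \<phi> x * h x \<partial>M) = (\<integral>\<^sup>+x. \<phi> x \<partial>(?R h))"
    if [measurable]: "h \<in> borel_measurable M" and "subalgebra (density M h) F" for h
  proof -
    have [measurable]: "\<phi> \<in> borel_measurable M" by (rule measurable_from_subalg[OF F(1) \<phi>])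
    have "(\<integral>\<^sup>+x. \<phi> x \<partial>(?R h)) = (\<integral>\<^sup>+x. \<phi> x \<partial>density M h)"
      by (rule nn_integral_subalgebra2) (use that \<phi> in auto)
    then show ?thesis by (simp add: nn_integral_density mult.commute)
  qed
  ultimately show ?thesis using sub by simp
qed

text \<open>In the application \<open>H\<close> is generated by \<open>W\<close>,
  \<open>\<A>\<close> consists of the events of one cluster and \<open>\<B>\<close> of those of the
  others. \<open>G\<close> holds the cluster's own regressors and \<open>W\<close>, and
  \<open>L\<close> adds its errors; \<open>J\<close> holds all regressors, and \<open>K\<close> adds
  the errors of the other clusters. Given \<open>G\<close>, the events in \<open>\<B>\<close> carry
  no information on \<open>L\<close>, so conditioning on \<open>K\<close> amounts to conditioning on
  \<open>G\<close>; \<open>J\<close> lies between the two.\<close>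

lemma (in prob_space) nn_cond_exp_leave_one_out:
  assumes sub: "subalgebra M L" "subalgebra L G" "subalgebra G H" "subalgebra M K" "subalgebra K J"
      "subalgebra J G"
    and L: "sets L = sigma_sets (space M) {C \<inter> A | C A. C \<in> sets H \<and> A \<in> \<A>}"
    and K: "sets K = sigma_sets (space M) {C \<inter> B | C B. C \<in> sets G \<and> B \<in> \<B>}"
    and A: "Int_stable \<A>" "\<A> \<subseteq> events" "space M \<in> \<A>"
    and B: "Int_stable \<B>" "\<B> \<subseteq> events" "space M \<in> \<B>"
    and ci: "\<And>A B. A \<in> \<A> \<Longrightarrow> B \<in> \<B> \<Longrightarrow> AE x in M. real_cond_exp M H (indicator (A \<inter> B)) x =
        real_cond_exp M H (indicator A) x * real_cond_exp M H (indicator B) x"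
    and f: "f \<in> borel_measurable L"
  shows "AE x in M. nn_cond_exp M K f x = nn_cond_exp M J f x"
proof -
  note st = subalgebra_trans
  have sG: "subalgebra M G" and sH: "subalgebra M H" and sJ: "subalgebra M J"
    and sKG: "subalgebra K G" and sLH: "subalgebra L H"
    using sub st by blast+
  interpret H: sigma_finite_subalgebra M H by (rule sigma_finite_subalgebraI[OF sH])
  interpret G: sigma_finite_subalgebra M G by (rule sigma_finite_subalgebraI[OF sG])
  interpret J: sigma_finite_subalgebra M J by (rule sigma_finite_subalgebraI[OF sJ])
  interpret K: sigma_finite_subalgebra M K by (rule sigma_finite_subalgebraI[OF sub(4)])
  have HM: "C \<in> sets H \<Longrightarrow> C \<in> events" and GM: "C \<in> sets G \<Longrightarrow> C \<in> events"
    and LM: "C \<in> sets L \<Longrightarrow> C \<in> events" and HG: "C \<in> sets H \<Longrightarrow> C \<in> sets G"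
    and GL: "C \<in> sets G \<Longrightarrow> C \<in> sets L" and KM: "C \<in> sets K \<Longrightarrow> C \<in> events" for C
    using sH sG sub sKG unfolding subalgebra_def by auto
  have spH: "space M \<in> sets H" and spG: "space M \<in> sets G" and spL: "space M \<in> sets L"
    using sH sG sub(1) sets.top[of H] sets.top[of G] sets.top[of L] unfolding subalgebra_def by auto
  have IsH: "Int_stable {C \<inter> A | C A. C \<in> sets H \<and> A \<in> \<A>}"
  proof (rule Int_stableI)
    fix a b assume "a \<in> {C \<inter> A | C A. C \<in> sets H \<and> A \<in> \<A>}" "b \<in> {C \<inter> A | C A. C \<in> sets H \<and> A \<in> \<A>}"
    then obtain C A C' A' where *: "a = C \<inter> A" "b = C' \<inter> A'" "C \<in> sets H" "C' \<in> sets H" "A \<in> \<A>" "A' \<in> \<A>"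
      by blast
    then have "a \<inter> b = (C \<inter> C') \<inter> (A \<inter> A')" "C \<inter> C' \<in> sets H" "A \<inter> A' \<in> \<A>"
      using A(1) by (auto simp: Int_stable_def)
    then show "a \<inter> b \<in> {C \<inter> A | C A. C \<in> sets H \<and> A \<in> \<A>}" by blast
  qed
  have IsG: "Int_stable {C \<inter> B | C B. C \<in> sets G \<and> B \<in> \<B>}"
  proof (rule Int_stableI)
    fix a b assume "a \<in> {C \<inter> A | C A. C \<in> sets G \<and> A \<in> \<B>}" "b \<in> {C \<inter> A | C A. C \<in> sets G \<and> A \<in> \<B>}"
    then obtain C A C' A' where *: "a = C \<inter> A" "b = C' \<inter> A'" "C \<in> sets G" "C' \<in> sets G" "A \<in> \<B>" "A' \<in> \<B>"
      by blast
    then have "a \<inter> b = (C \<inter> C') \<inter> (A \<inter> A')" "C \<inter> C' \<in> sets G" "A \<inter> A' \<in> \<B>"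
      using B(1) by (auto simp: Int_stable_def)
    then show "a \<inter> b \<in> {C \<inter> A | C A. C \<in> sets G \<and> A \<in> \<B>}" by blast
  qed
  have fin: "(\<integral>\<^sup>+x. indicator D x \<partial>M) \<noteq> \<infinity>" if "D \<in> events" for D
    using that by (simp add: emeasure_eq_measure)

  define r where "r B x = ennreal (real_cond_exp M H (indicator B) x)" for B x
  have rH[measurable]: "r B \<in> borel_measurable H" "r B \<in> borel_measurable M" for B
    unfolding r_def by auto
  have rG: "r B \<in> borel_measurable G" for B by (rule measurable_from_subalg[OF sub(3)]) simp

  \<comment> \<open>The conditional probability \<open>r B\<close> given \<open>H\<close> is also
    one given the larger \<open>L\<close>: on the generators \<open>C \<inter> A\<close> this is the
    conditional independence given \<open>H\<close>.\<close>
  have *: "(\<integral>\<^sup>+x. \<phi> x * indicator B x \<partial>M) = (\<integral>\<^sup>+x. \<phi> x * r B x \<partial>M)"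
    if B': "B \<in> \<B>" and \<phi>: "\<phi> \<in> borel_measurable L" for \<phi> B
  proof (rule nn_integral_eq_on_generator[OF sub(1) L IsH _ _ _ _ _ \<phi>])
    have [measurable]: "B \<in> events" using B B' by auto
    show "space M \<in> {C \<inter> A |C A. C \<in> sets H \<and> A \<in> \<A>}" using spH A(3) by blast
    show "(\<lambda>x. indicator B x :: ennreal) \<in> borel_measurable M" by simp
    show "r B \<in> borel_measurable M" by simp
    show "(\<integral>\<^sup>+x. indicator B x \<partial>M) \<noteq> \<infinity>" by (rule fin) simp
    fix D assume "D \<in> {C \<inter> A |C A. C \<in> sets H \<and> A \<in> \<A>}"
    then obtain C A where D: "D = C \<inter> A" "C \<in> sets H" "A \<in> \<A>" by auto
    then have [measurable]: "C \<in> events" "A \<in> events" "C \<in> sets H" using HM A by auto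
    have pos: "AE x in M. real_cond_exp M H (indicator B) x \<ge> 0"
      by (intro H.real_cond_exp_pos) auto
    have le1: "AE x in M. real_cond_exp M H (indicator B) x \<le> 1"
      by (intro H.real_cond_exp_le_c) (auto simp: emeasure_eq_measure)
    have intr: "integrable M (\<lambda>x. indicator C x * indicator A x * real_cond_exp M H (indicator B) x)"
      by (rule integrable_const_bound[where B=1]) (use pos le1 in \<open>auto split: split_indicator\<close>)
    have "(\<integral>x. indicator (C \<inter> A) x * indicator B x \<partial>M) = (\<integral>x. indicator C x * (indicator (A \<inter> B) x :: real) \<partial>M)"
      by (intro Bochner_Integration.integral_cong) (auto split: split_indicator)
    also have "\<dots> = (\<integral>x. indicator C x * real_cond_exp M H (indicator (A \<inter> B)) x \<partial>M)"
      by (rule H.real_cond_exp_intg(2)[symmetric])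
         (auto intro!: integrable_const_bound[where B=1] split: split_indicator)
    also have "\<dots> = (\<integral>x. (indicator C x * real_cond_exp M H (indicator B) x) * real_cond_exp M H (indicator A) x \<partial>M)"
      by (rule integral_cong_AE) (use ci[OF D(3) B'] in \<open>auto simp: algebra_simps\<close>)
    also have "\<dots> = (\<integral>x. (indicator C x * real_cond_exp M H (indicator B) x) * indicator A x \<partial>M)"
      by (rule H.real_cond_exp_intg(2)) (use intr in \<open>auto simp: algebra_simps\<close>)
    finally have eq: "(\<integral>x. indicator (C \<inter> A) x * indicator B x \<partial>M) =
        (\<integral>x. indicator C x * indicator A x * real_cond_exp M H (indicator B) x \<partial>M)"
      by (simp add: algebra_simps)
    have "(\<integral>\<^sup>+x. indicator D x * indicator B x \<partial>M) =
        (\<integral>\<^sup>+x. ennreal (indicator (C \<inter> A) x * indicator B x) \<partial>M)"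
      unfolding D by (intro nn_integral_cong) (auto split: split_indicator)
    also have "\<dots> = ennreal (\<integral>x. indicator (C \<inter> A) x * indicator B x \<partial>M)"
      by (intro nn_integral_eq_integral)
         (auto intro!: integrable_const_bound[where B=1] split: split_indicator)
    also have "\<dots> = ennreal (\<integral>x. indicator C x * indicator A x * real_cond_exp M H (indicator B) x \<partial>M)"
      by (simp add: eq)
    also have "\<dots> = (\<integral>\<^sup>+x. ennreal (indicator C x * indicator A x * real_cond_exp M H (indicator B) x) \<partial>M)"
      by (intro nn_integral_eq_integral[symmetric] intr) (use pos in auto)
    also have "\<dots> = (\<integral>\<^sup>+x. indicator D x * r B x \<partial>M)"
      unfolding D r_def by (intro nn_integral_cong) (auto split: split_indicator)
    finally show "(\<integral>\<^sup>+x. indicator D x * indicator B x \<partial>M) = (\<integral>\<^sup>+x. indicator D x * r B x \<partial>M)" .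
  qed

  let ?e = "nn_cond_exp M G"
  \<comment> \<open>The conditional expectation of \<open>indicator F\<close> given \<open>G\<close>
    is also one given \<open>K\<close>. On a generator \<open>C \<inter> B\<close> the other factors
    are \<open>L\<close>-measurable, so the indicator of \<open>B\<close> may be exchanged for
    \<open>r B\<close>, which is \<open>G\<close>-measurable, and back.\<close>
  have **: "(\<integral>\<^sup>+x. \<phi> x * indicator F x \<partial>M) = (\<integral>\<^sup>+x. \<phi> x * ?e (indicator F) x \<partial>M)"
    if F: "F \<in> sets L" and \<phi>: "\<phi> \<in> borel_measurable K" for \<phi> F
  proof (rule nn_integral_eq_on_generator[OF sub(4) K IsG _ _ _ _ _ \<phi>])
    have [measurable]: "F \<in> events" using LM F by auto
    show "space M \<in> {C \<inter> A |C A. C \<in> sets G \<and> A \<in> \<B>}" using spG B(3) by blast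
    show "(\<lambda>x. indicator F x :: ennreal) \<in> borel_measurable M" by simp
    show "?e (indicator F) \<in> borel_measurable M" by simp
    show "(\<integral>\<^sup>+x. indicator F x \<partial>M) \<noteq> \<infinity>" by (rule fin) simp
    fix D assume "D \<in> {C \<inter> A |C A. C \<in> sets G \<and> A \<in> \<B>}"
    then obtain C B where D: "D = C \<inter> B" "C \<in> sets G" "B \<in> \<B>" by auto
    then have [measurable]: "C \<in> events" "B \<in> events" "C \<in> sets G" using GM B by auto
    note [measurable] = rG
    have e: "?e (indicator F) \<in> borel_measurable L"
      by (rule measurable_from_subalg[OF sub(2)]) simp
    have [measurable]: "C \<in> sets L" "F \<in> sets L" using GL D F by auto
    from e have m: "(\<lambda>x. indicator C x * ?e (indicator F) x) \<in> borel_measurable L"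
       "(\<lambda>x. indicator C x * indicator F x :: ennreal) \<in> borel_measurable L" by measurable
    have "(\<integral>\<^sup>+x. indicator D x * indicator F x \<partial>M) = (\<integral>\<^sup>+x. (indicator C x * indicator F x) * indicator B x \<partial>M)"
      unfolding D by (intro nn_integral_cong) (auto split: split_indicator)
    also have "\<dots> = (\<integral>\<^sup>+x. (indicator C x * indicator F x) * r B x \<partial>M)"
      by (rule *[OF D(3) m(2)])
    also have "\<dots> = (\<integral>\<^sup>+x. (indicator C x * r B x) * indicator F x \<partial>M)"
      by (simp add: ac_simps)
    also have "\<dots> = (\<integral>\<^sup>+x. (indicator C x * r B x) * ?e (indicator F) x \<partial>M)"
      by (rule G.nn_cond_exp_intg[symmetric]) auto
    also have "\<dots> = (\<integral>\<^sup>+x. (indicator C x * ?e (indicator F) x) * r B x \<partial>M)"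
      by (simp add: ac_simps)
    also have "\<dots> = (\<integral>\<^sup>+x. (indicator C x * ?e (indicator F) x) * indicator B x \<partial>M)"
      by (rule *[OF D(3) m(1), symmetric])
    also have "\<dots> = (\<integral>\<^sup>+x. indicator D x * ?e (indicator F) x \<partial>M)"
      unfolding D by (intro nn_integral_cong) (auto split: split_indicator)
    finally show "(\<integral>\<^sup>+x. indicator D x * indicator F x \<partial>M) = (\<integral>\<^sup>+x. indicator D x * ?e (indicator F) x \<partial>M)" .
  qed
  note [measurable] = measurable_from_subalg[OF sub(1) f]
  have "AE x in M. ?e f x = nn_cond_exp M K f x"
  proof (rule K.nn_cond_exp_charact)
    fix D assume D: "D \<in> sets K"
    then have [measurable]: "D \<in> events" using KM by auto
    let ?d = "?e (indicator D)"
    \<comment> \<open>Passage from indicators to \<open>f\<close> by exchanging roles: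
      \<open>indicator D\<close> and its conditional expectation \<open>?d\<close> given
      \<open>G\<close> have equal integrals over every \<open>F\<close> in \<open>L\<close> by the
      previous step, so they may be exchanged against the \<open>L\<close>-measurable
      \<open>f\<close>.\<close>
    have "(\<integral>\<^sup>+x. f x * indicator D x \<partial>M) = (\<integral>\<^sup>+x. f x * ?d x \<partial>M)"
    proof (rule nn_integral_eq_on_generator[OF sub(1) _ _ _ _ _ _ _ f])
      show "sets L = sigma_sets (space M) (sets L)"
        using sub(1) sets.sigma_sets_eq[of L] unfolding subalgebra_def by simp
      show "Int_stable (sets L)" by (rule sets.Int_stable)
      show "(\<integral>\<^sup>+x. indicator D x \<partial>M) \<noteq> \<infinity>" by (rule fin) simp
      fix F assume F: "F \<in> sets L"
      have [measurable]: "F \<in> events" using LM F by auto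
      have "(\<integral>\<^sup>+x. indicator F x * indicator D x \<partial>M) = (\<integral>\<^sup>+x. indicator D x * indicator F x \<partial>M)"
        by (simp add: ac_simps)
      also have "\<dots> = (\<integral>\<^sup>+x. indicator D x * ?e (indicator F) x \<partial>M)" using F D by (intro **) auto
      also have "\<dots> = (\<integral>\<^sup>+x. ?e (indicator F) x * indicator D x \<partial>M)" by (simp add: ac_simps)
      also have "\<dots> = (\<integral>\<^sup>+x. ?e (indicator F) x * ?d x \<partial>M)"
        by (rule G.nn_cond_exp_intg[symmetric]) auto
      also have "\<dots> = (\<integral>\<^sup>+x. ?d x * ?e (indicator F) x \<partial>M)" by (simp add: ac_simps)
      also have "\<dots> = (\<integral>\<^sup>+x. ?d x * indicator F x \<partial>M)"
        by (rule G.nn_cond_exp_intg) auto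
      finally show "(\<integral>\<^sup>+x. indicator F x * indicator D x \<partial>M) = (\<integral>\<^sup>+x. indicator F x * ?d x \<partial>M)"
        by (simp add: ac_simps)
    qed (use spL in auto)
    also have "\<dots> = (\<integral>\<^sup>+x. ?d x * f x \<partial>M)" by (simp add: ac_simps)
    also have "\<dots> = (\<integral>\<^sup>+x. ?d x * ?e f x \<partial>M)" by (rule G.nn_cond_exp_intg[symmetric]) auto
    also have "\<dots> = (\<integral>\<^sup>+x. ?e f x * ?d x \<partial>M)" by (simp add: ac_simps)
    also have "\<dots> = (\<integral>\<^sup>+x. ?e f x * indicator D x \<partial>M)" by (rule G.nn_cond_exp_intg) auto
    finally show "(\<integral>\<^sup>+x\<in>D. f x \<partial>M) = (\<integral>\<^sup>+x\<in>D. ?e f x \<partial>M)" .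
  next
    show "?e f \<in> borel_measurable K" by (rule measurable_from_subalg[OF sKG]) simp
  qed simp
  \<comment> \<open>Conditioning the version given \<open>K\<close> on the smaller \<open>J\<close>
    leaves it unchanged, because it equals a \<open>G\<close>-measurable function.\<close>
  moreover have "AE x in M. nn_cond_exp M J f x = nn_cond_exp M J (nn_cond_exp M K f) x"
    by (rule J.nn_cond_exp_nested_subalg[OF sub(4,5)]) simp
  moreover have "AE x in M. nn_cond_exp M J (?e f) x = nn_cond_exp M J (nn_cond_exp M K f) x"
    by (rule J.nn_cond_exp_cong) (use calculation(1) in auto)
  moreover have "AE x in M. ?e f x = nn_cond_exp M J (?e f) x"
    by (rule J.nn_cond_exp_F_meas) (rule measurable_from_subalg[OF sub(6)], simp)
  ultimately show ?thesis by auto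
qed

section \<open>Second moments of linear and quadratic forms in clustered errors\<close>

text \<open>Each \<open>a p\<close> occurs with weight 1/2 once per related index on either side.
  This turns a bound on the number of correlated partners of a term into a bound on a second
  moment.\<close>

lemma sum_symmetric_relation_le:
  fixes a :: "'b \<Rightarrow> real"
  assumes "finite I" "\<And>p q. R p q \<Longrightarrow> R q p" "\<And>p. p \<in> I \<Longrightarrow> card {q\<in>I. R p q} \<le> N"
    and "\<And>p. p \<in> I \<Longrightarrow> a p \<ge> 0"
  shows "(\<Sum>p\<in>I. \<Sum>q\<in>I. if R p q then (a p + a q) / 2 else 0) \<le> real N * (\<Sum>p\<in>I. a p)"
proof -
  have 1: "(\<Sum>p\<in>I. \<Sum>q\<in>I. if R p q then a p / 2 else 0) \<le> real N * (\<Sum>p\<in>I. a p) / 2"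
  proof -
    have "(\<Sum>q\<in>I. if R p q then a p / 2 else 0) \<le> real N * (a p / 2)" if "p \<in> I" for p
    proof -
      have "(\<Sum>q\<in>I. if R p q then a p / 2 else 0) = real (card {q\<in>I. R p q}) * (a p / 2)"
        using assms(1) by (simp add: sum.If_cases Int_def)
      also have "\<dots> \<le> real N * (a p / 2)"
        using assms(3,4)[OF that] by (intro mult_right_mono) auto
      finally show ?thesis .
    qed
    then have "(\<Sum>p\<in>I. \<Sum>q\<in>I. if R p q then a p / 2 else 0) \<le> (\<Sum>p\<in>I. real N * (a p / 2))"
      by (rule sum_mono)
    then show ?thesis by (simp add: sum_distrib_left sum_divide_distrib)
  qed
  have "(\<Sum>p\<in>I. \<Sum>q\<in>I. if R p q then a q / 2 else 0) = (\<Sum>q\<in>I. \<Sum>p\<in>I. if R q p then a q / 2 else 0)"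
    using assms(2) by (subst sum.swap) (auto intro!: sum.cong)
  moreover have "(\<Sum>p\<in>I. \<Sum>q\<in>I. if R p q then (a p + a q) / 2 else 0)
     = (\<Sum>p\<in>I. \<Sum>q\<in>I. if R p q then a p / 2 else 0) + (\<Sum>p\<in>I. \<Sum>q\<in>I. if R p q then a q / 2 else 0)"
    by (auto simp: sum.distrib[symmetric] add_divide_distrib intro!: sum.cong)
  ultimately show ?thesis using 1 by simp
qed

lemma abs_mult_le_sum_squares: "\<bar>x * y\<bar> \<le> (x\<^sup>2 + y\<^sup>2) / (2 :: real)"
proof -
  have "0 \<le> (\<bar>x\<bar> - \<bar>y\<bar>)\<^sup>2" by simp
  then show ?thesis unfolding power2_diff by (simp add: abs_mult)
qed

lemma square_le_one_plus_fourth: "x\<^sup>2 \<le> 1 + (x::real)^4"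
proof -
  have "0 \<le> (x\<^sup>2 - 1/2)\<^sup>2" by simp
  then show ?thesis by (simp add: power2_eq_square power4_eq_xxxx algebra_simps)
qed

text \<open>\<open>J\<close> stands for the regressors, \<open>K k\<close> for everything except the
  errors of the cluster of \<open>k\<close>, and \<open>cof\<close> assigns to an index its cluster.
  Independence enters through \<open>mean\<close> and \<open>second\<close>: knowledge of the other
  clusters changes neither the conditional means nor the within-cluster second moments.\<close>

locale clustered_errors = prob_space M for M :: "'a measure" +
  fixes J :: "'a measure" and K :: "nat \<Rightarrow> 'a measure" and e :: "nat \<Rightarrow> 'a \<Rightarrow> real"
    and n :: nat and cof :: "nat \<Rightarrow> nat" and B :: real and c :: nat
  assumes subJ: "subalgebra M J"
    and subK: "\<And>k. k < n \<Longrightarrow> subalgebra M (K k)"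
    and KJ: "\<And>k. k < n \<Longrightarrow> subalgebra (K k) J"
    and e_meas[measurable]: "\<And>k. k < n \<Longrightarrow> e k \<in> borel_measurable M"
    and e_K: "\<And>k l. k < n \<Longrightarrow> l < n \<Longrightarrow> cof k \<noteq> cof l \<Longrightarrow> e l \<in> borel_measurable (K k)"
    and B: "B \<ge> 0"
    and moment: "\<And>k. k < n \<Longrightarrow> AE x in M. nn_cond_exp M J (\<lambda>x. ennreal (e k x ^ 4)) x \<le> ennreal B"
    and mean: "\<And>k. k < n \<Longrightarrow> AE x in M. real_cond_exp M (K k) (e k) x = 0"
    and second: "\<And>k l. k < n \<Longrightarrow> l < n \<Longrightarrow> cof k = cof l \<Longrightarrow>
        AE x in M. real_cond_exp M (K k) (\<lambda>x. e k x * e l x) x = real_cond_exp M J (\<lambda>x. e k x * e l x) x"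
    and cluster_size: "\<And>k. k < n \<Longrightarrow> card {l\<in>{..<n}. cof l = cof k} \<le> c"
begin

text \<open>The entries of the conditional second moment matrix \<Omega> of the errors.\<close>

definition s :: "nat \<Rightarrow> nat \<Rightarrow> 'a \<Rightarrow> real" where
  "s k l = real_cond_exp M J (\<lambda>x. e k x * e l x)"

definition Z :: "nat \<Rightarrow> nat \<Rightarrow> 'a \<Rightarrow> real" where
  "Z k l x = e k x * e l x - s k l x"

sublocale J: sigma_finite_subalgebra M J by (rule sigma_finite_subalgebraI[OF subJ])

lemma s_measurable[measurable]: "s k l \<in> borel_measurable J" "s k l \<in> borel_measurable M"
  unfolding s_def by auto

lemma Z_measurable[measurable]: "k < n \<Longrightarrow> l < n \<Longrightarrow> Z k l \<in> borel_measurable M"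
  unfolding Z_def[abs_def] by auto

lemma s_commute: "s k l = s l k" unfolding s_def by (simp add: mult.commute)

lemma Z_commute: "Z k l = Z l k" unfolding Z_def by (auto simp: s_commute[of k l] fun_eq_iff)

lemma from_J: "f \<in> borel_measurable J \<Longrightarrow> f \<in> borel_measurable M"
  by (rule measurable_from_subalg[OF subJ])

text \<open>The weight stays inside the integral on the right, since the final bounds must involve
  the integrated squares of the coefficients and not just their maximum.\<close>

lemma weighted_fourth_moment:
  assumes k: "k < n" and a[measurable]: "a \<in> borel_measurable J" and "\<And>x. a x \<ge> 0" "\<And>x. a x \<le> C"
  shows "integrable M (\<lambda>x. a x * e k x ^ 4)" "(\<integral>x. a x * e k x ^ 4 \<partial>M) \<le> B * (\<integral>x. a x \<partial>M)"
proof -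
  note [measurable] = from_J[OF a] e_meas[OF k]
  have ai: "integrable M a" by (rule integrable_const_bound[where B=C]) (use assms in auto)
  have "(\<integral>\<^sup>+x. ennreal (a x * e k x ^ 4) \<partial>M) = (\<integral>\<^sup>+x. ennreal (a x) * ennreal (e k x ^ 4) \<partial>M)"
    using assms(3) by (intro nn_integral_cong) (auto simp: ennreal_mult)
  also have "\<dots> = (\<integral>\<^sup>+x. ennreal (a x) * nn_cond_exp M J (\<lambda>x. ennreal (e k x ^ 4)) x \<partial>M)"
    by (rule J.nn_cond_exp_intg[symmetric]) auto
  also have "\<dots> \<le> (\<integral>\<^sup>+x. ennreal (a x) * ennreal B \<partial>M)"
  proof (rule nn_integral_mono_AE)
    show "AE x in M. ennreal (a x) * nn_cond_exp M J (\<lambda>x. ennreal (e k x ^ 4)) x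
        \<le> ennreal (a x) * ennreal B"
      using moment[OF k] by eventually_elim (rule mult_left_mono, auto)
  qed
  also have "\<dots> = ennreal (B * (\<integral>x. a x \<partial>M))"
    using ai assms(3) B by (subst nn_integral_multc)
      (auto simp: nn_integral_eq_integral ennreal_mult'' mult.commute)
  finally have le: "(\<integral>\<^sup>+x. ennreal (a x * e k x ^ 4) \<partial>M) \<le> ennreal (B * (\<integral>x. a x \<partial>M))" .
  show i: "integrable M (\<lambda>x. a x * e k x ^ 4)"
    by (rule integrableI_nonneg) (use assms(3) le in \<open>auto simp: top.not_eq_extremum[symmetric] top_unique
        intro: le_less_trans\<close>)
  have "ennreal (\<integral>x. a x * e k x ^ 4 \<partial>M) \<le> ennreal (B * (\<integral>x. a x \<partial>M))"
    using le i assms(3) by (subst (asm) nn_integral_eq_integral) auto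
  then show "(\<integral>x. a x * e k x ^ 4 \<partial>M) \<le> B * (\<integral>x. a x \<partial>M)"
    using B assms(3) by (subst (asm) ennreal_le_iff) (auto intro!: mult_nonneg_nonneg integral_nonneg)
qed

lemma fourth_integrable: "k < n \<Longrightarrow> integrable M (\<lambda>x. e k x ^ 4)"
  using weighted_fourth_moment(1)[of k "\<lambda>_. 1" 1] by simp

lemma product_le: "\<bar>e k x * e l x\<bar> \<le> 1 + (e k x ^ 4 + e l x ^ 4) / 2"
proof -
  have "\<bar>e k x * e l x\<bar> \<le> ((e k x)\<^sup>2 + (e l x)\<^sup>2) / 2" by (rule abs_mult_le_sum_squares)
  also have "\<dots> \<le> ((1 + e k x ^ 4) + (1 + e l x ^ 4)) / 2"
    by (intro divide_right_mono add_mono square_le_one_plus_fourth) simp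
  also have "\<dots> = 1 + (e k x ^ 4 + e l x ^ 4) / 2" by (simp add: add_divide_distrib)
  finally show ?thesis .
qed

lemma product_integrable:
  assumes "k < n" "l < n" shows "integrable M (\<lambda>x. e k x * e l x)"
proof (rule Bochner_Integration.integrable_bound)
  show "integrable M (\<lambda>x. 1 + (e k x ^ 4 + e l x ^ 4) / 2)"
    using assms fourth_integrable by auto
qed (use assms product_le[of k _ l] in \<open>auto intro: order_trans[OF _ abs_ge_self]\<close>)

lemma error_integrable:
  assumes k: "k < n" shows "integrable M (e k)"
proof (rule Bochner_Integration.integrable_bound)
  show "integrable M (\<lambda>x. 2 + e k x ^ 4)" using fourth_integrable[OF k] by auto
  have "\<bar>e k x\<bar> \<le> 2 + e k x ^ 4" for x
    using abs_mult_le_sum_squares[of 1 "e k x"] square_le_one_plus_fourth[of "e k x"] by simp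
  then show "AE x in M. norm (e k x) \<le> norm (2 + e k x ^ 4)"
    by (auto intro: order_trans[OF _ abs_ge_self])
qed (rule e_meas[OF k])

text \<open>The majorant in \<open>product_le\<close> has conditional mean at most
  \<open>1 + B\<close>, and it dominates both the product and its negative.\<close>

lemma s_bound:
  assumes kl: "k < n" "l < n" shows "AE x in M. \<bar>s k l x\<bar> \<le> 1 + B"
proof -
  have four: "AE x in M. real_cond_exp M J (\<lambda>x. e k x ^ 4) x \<le> B" if "k < n" for k
  proof -
    have "AE x in M. enn2real (nn_cond_exp M J (\<lambda>x. ennreal (e k x ^ 4)) x) \<le> B"
      using moment[OF that] B by (auto simp: enn2real_leI)
    then show ?thesis unfolding real_cond_exp_def
      by eventually_elim (auto intro: order_trans[rotated])
  qed
  let ?b = "\<lambda>x. 1 + (e k x ^ 4 + e l x ^ 4) / 2"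
  note fi = fourth_integrable[OF kl(1)] fourth_integrable[OF kl(2)] product_integrable[OF kl]
  have ib: "integrable M ?b" using fi by auto
  have b: "AE x in M. real_cond_exp M J ?b x \<le> 1 + B"
  proof -
    have "AE x in M. real_cond_exp M J ?b x = real_cond_exp M J (\<lambda>x. 1) x + real_cond_exp M J (\<lambda>x. (e k x ^ 4 + e l x ^ 4) / 2) x"
      by (rule J.real_cond_exp_add) (use fi in auto)
    moreover have "AE x in M. real_cond_exp M J (\<lambda>x. 1) x = 1"
      by (rule J.real_cond_exp_F_meas) auto
    moreover have "AE x in M. real_cond_exp M J (\<lambda>x. (e k x ^ 4 + e l x ^ 4) / 2) x
        = real_cond_exp M J (\<lambda>x. e k x ^ 4 + e l x ^ 4) x / 2"
      by (rule J.real_cond_exp_cdiv) (use fi in auto)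
    moreover have "AE x in M. real_cond_exp M J (\<lambda>x. e k x ^ 4 + e l x ^ 4) x
        = real_cond_exp M J (\<lambda>x. e k x ^ 4) x + real_cond_exp M J (\<lambda>x. e l x ^ 4) x"
      by (rule J.real_cond_exp_add) (use fi in auto)
    ultimately show ?thesis using four[OF kl(1)] four[OF kl(2)] by eventually_elim auto
  qed
  have "AE x in M. s k l x \<le> real_cond_exp M J ?b x" unfolding s_def
    by (rule J.real_cond_exp_mono) (use fi ib product_le[of k _ l] in \<open>auto simp: abs_le_iff\<close>)
  moreover have "AE x in M. real_cond_exp M J (\<lambda>x. - 1 * (e k x * e l x)) x \<le> real_cond_exp M J ?b x"
    by (rule J.real_cond_exp_mono) (use fi ib product_le[of k _ l] in \<open>auto simp: abs_le_iff\<close>)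
  moreover have "AE x in M. real_cond_exp M J (\<lambda>x. - 1 * (e k x * e l x)) x = - 1 * s k l x"
    unfolding s_def by (rule J.real_cond_exp_cmult) (use fi in auto)
  ultimately show ?thesis using b by eventually_elim auto
qed

text \<open>Given \<open>K k\<close> the error \<open>e l\<close> is known and \<open>e k\<close>
  has mean zero; the tower property brings this down to \<open>J\<close>.\<close>

lemma s_cross:
  assumes kl: "k < n" "l < n" "cof k \<noteq> cof l" shows "AE x in M. s k l x = 0"
proof -
  interpret K: sigma_finite_subalgebra M "K k" by (rule sigma_finite_subalgebraI[OF subK[OF kl(1)]])
  note pi = product_integrable[OF kl(1,2)]
  have "AE x in M. real_cond_exp M (K k) (\<lambda>x. e l x * e k x) x = e l x * real_cond_exp M (K k) (e k) x"
    by (rule K.real_cond_exp_mult) (use kl e_K pi in \<open>auto simp: mult.commute\<close>)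
  then have z: "AE x in M. real_cond_exp M (K k) (\<lambda>x. e k x * e l x) x = 0"
    using mean[OF kl(1)] by (auto simp: mult.commute)
  have "AE x in M. real_cond_exp M J (real_cond_exp M (K k) (\<lambda>x. e k x * e l x)) x = s k l x"
    unfolding s_def by (rule J.real_cond_exp_nested_subalg[OF subK[OF kl(1)] KJ[OF kl(1)] pi])
  moreover have "AE x in M. real_cond_exp M J (real_cond_exp M (K k) (\<lambda>x. e k x * e l x)) x
      = real_cond_exp M J (\<lambda>x. 0) x"
    by (rule J.real_cond_exp_cong) (use z in auto)
  moreover have "AE x in M. real_cond_exp M J (\<lambda>x. 0) x = 0"
    by (rule J.real_cond_exp_F_meas) auto
  ultimately show ?thesis by eventually_elim auto
qed

lemma Z_square_le:
  assumes "\<bar>s k l x\<bar> \<le> 1 + B"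
  shows "(Z k l x)\<^sup>2 \<le> e k x ^ 4 + e l x ^ 4 + 2 * (1 + B)\<^sup>2"
proof -
  have "(Z k l x)\<^sup>2 \<le> 2 * (e k x * e l x)\<^sup>2 + 2 * (s k l x)\<^sup>2"
  proof -
    have "0 \<le> (e k x * e l x + s k l x)\<^sup>2" by simp
    then show ?thesis unfolding Z_def power2_diff power2_sum by (simp add: algebra_simps)
  qed
  moreover have "2 * (e k x * e l x)\<^sup>2 \<le> e k x ^ 4 + e l x ^ 4"
    using abs_mult_le_sum_squares[of "(e k x)\<^sup>2" "(e l x)\<^sup>2"]
    by (simp add: power_mult_distrib flip: power_mult)
  moreover have "(s k l x)\<^sup>2 \<le> (1 + B)\<^sup>2" using assms by (metis abs_ge_zero power2_abs power_mono)
  ultimately show ?thesis by simp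
qed

text \<open>The constant is read off \<open>Z_square_le\<close>: the two fourth moments contribute
  \<open>B\<close> each, and the bound on \<open>s\<close> contributes the rest.\<close>

lemma weighted_Z_square:
  assumes kl: "k < n" "l < n" and a[measurable]: "a \<in> borel_measurable J"
    and "\<And>x. a x \<ge> 0" "\<And>x. a x \<le> C"
  shows "integrable M (\<lambda>x. a x * (Z k l x)\<^sup>2)"
    "(\<integral>x. a x * (Z k l x)\<^sup>2 \<partial>M) \<le> (2 * B + 2 * (1 + B)\<^sup>2) * (\<integral>x. a x \<partial>M)"
proof -
  note [measurable] = from_J[OF a] e_meas[OF kl(1)] e_meas[OF kl(2)] Z_measurable[OF kl]
  note fk = weighted_fourth_moment[OF kl(1) a assms(4,5)]
  note fl = weighted_fourth_moment[OF kl(2) a assms(4,5)]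
  let ?b = "\<lambda>x. a x * e k x ^ 4 + a x * e l x ^ 4 + 2 * (1 + B)\<^sup>2 * a x"
  have ai: "integrable M a" by (rule integrable_const_bound[where B=C]) (use assms in auto)
  have ib: "integrable M ?b" using fk fl ai by auto
  have le: "AE x in M. a x * (Z k l x)\<^sup>2 \<le> ?b x"
    using s_bound[OF kl]
  proof eventually_elim
    case (elim x)
    show ?case using mult_left_mono[OF Z_square_le[OF elim] assms(4)[of x]] by (simp add: algebra_simps)
  qed
  show i: "integrable M (\<lambda>x. a x * (Z k l x)\<^sup>2)"
    by (rule Bochner_Integration.integrable_bound[OF ib])
       (use le assms(4) in \<open>auto intro: order_trans[OF _ abs_ge_self]\<close>)
  have "(\<integral>x. a x * (Z k l x)\<^sup>2 \<partial>M) \<le> (\<integral>x. ?b x \<partial>M)"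
    by (rule integral_mono_AE[OF i ib le])
  also have "\<dots> = (\<integral>x. a x * e k x ^ 4 \<partial>M) + (\<integral>x. a x * e l x ^ 4 \<partial>M) + 2 * (1 + B)\<^sup>2 * (\<integral>x. a x \<partial>M)"
    using fk fl ai by simp
  also have "\<dots> \<le> (2 * B + 2 * (1 + B)\<^sup>2) * (\<integral>x. a x \<partial>M)"
    using fk(2) fl(2) by (simp add: algebra_simps)
  finally show "(\<integral>x. a x * (Z k l x)\<^sup>2 \<partial>M) \<le> (2 * B + 2 * (1 + B)\<^sup>2) * (\<integral>x. a x \<partial>M)" .
qed

text \<open>The second product, with one factor left uncentered, is the one to which conditioning on
  \<open>K k\<close> will be applied.\<close>

lemma ZZ_integrable:
  assumes "k < n" "l < n" "m < n" "r < n"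
    and w[measurable]: "w \<in> borel_measurable J" and "\<And>x. \<bar>w x\<bar> \<le> C"
  shows "integrable M (\<lambda>x. w x * (Z k l x * Z m r x))"
    "integrable M (\<lambda>x. w x * (e k x * e l x * Z m r x))"
proof -
  note [measurable] = from_J[OF w] e_meas[OF assms(1)] e_meas[OF assms(2)]
    Z_measurable[OF assms(1,2)] Z_measurable[OF assms(3,4)]
  have i: "integrable M (\<lambda>x. (Z k l x)\<^sup>2)" "integrable M (\<lambda>x. (Z m r x)\<^sup>2)"
    using weighted_Z_square(1)[of k l "\<lambda>_. 1" 1] weighted_Z_square(1)[of m r "\<lambda>_. 1" 1] assms by auto
  have C: "C \<ge> 0" using assms(6)[of undefined] by linarith
  show "integrable M (\<lambda>x. w x * (Z k l x * Z m r x))"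
  proof (rule Bochner_Integration.integrable_bound)
    show "integrable M (\<lambda>x. C * (((Z k l x)\<^sup>2 + (Z m r x)\<^sup>2) / 2))" using i by auto
    have "\<bar>w x * (Z k l x * Z m r x)\<bar> \<le> C * (((Z k l x)\<^sup>2 + (Z m r x)\<^sup>2) / 2)" for x
      unfolding abs_mult[of "w x"] using assms(6) C
      by (intro mult_mono abs_mult_le_sum_squares) auto
    then show "AE x in M. norm (w x * (Z k l x * Z m r x)) \<le> norm (C * (((Z k l x)\<^sup>2 + (Z m r x)\<^sup>2) / 2))"
      by (auto intro: order_trans[OF _ abs_ge_self])
  qed simp
  show "integrable M (\<lambda>x. w x * (e k x * e l x * Z m r x))"
  proof (rule Bochner_Integration.integrable_bound)
    show "integrable M (\<lambda>x. C * (((e k x ^ 4 + e l x ^ 4) / 2 + (Z m r x)\<^sup>2) / 2))"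
      using i fourth_integrable[OF assms(1)] fourth_integrable[OF assms(2)] by auto
    have "\<bar>w x * (e k x * e l x * Z m r x)\<bar> \<le> C * (((e k x ^ 4 + e l x ^ 4) / 2 + (Z m r x)\<^sup>2) / 2)" for x
    proof -
      have "(e k x * e l x)\<^sup>2 \<le> (e k x ^ 4 + e l x ^ 4) / 2"
        using abs_mult_le_sum_squares[of "(e k x)\<^sup>2" "(e l x)\<^sup>2"]
        by (simp add: power_mult_distrib flip: power_mult)
      then have "\<bar>e k x * e l x * Z m r x\<bar> \<le> ((e k x ^ 4 + e l x ^ 4) / 2 + (Z m r x)\<^sup>2) / 2"
        using abs_mult_le_sum_squares[of "e k x * e l x" "Z m r x"]
        by (elim order_trans) (intro divide_right_mono add_mono, auto)
      then show ?thesis unfolding abs_mult[of "w x"] using assms(6) C by (intro mult_mono) auto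
    qed
    then show "AE x in M. norm (w x * (e k x * e l x * Z m r x)) \<le> norm (C * (((e k x ^ 4 + e l x ^ 4) / 2 + (Z m r x)\<^sup>2) / 2))"
      by (auto intro: order_trans[OF _ abs_ge_self])
  qed simp
qed

text \<open>Given \<open>K k\<close> only the factor \<open>e k\<close> is not fixed, as the other
  three indices lie in other clusters. Since \<open>s k l\<close> vanishes, \<open>Z k l\<close> is
  the bare product, and \<open>e k\<close> integrates to zero.\<close>

lemma orthogonal_unique_index:
  assumes n: "k < n" "l < n" "m < n" "r < n"
    and u: "cof k \<noteq> cof l" "cof k \<noteq> cof m" "cof k \<noteq> cof r"
    and w: "w \<in> borel_measurable J" "\<And>x. \<bar>w x\<bar> \<le> C"
  shows "(\<integral>x. w x * (Z k l x * Z m r x) \<partial>M) = 0"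
proof -
  interpret K: sigma_finite_subalgebra M "K k" by (rule sigma_finite_subalgebraI[OF subK[OF n(1)]])
  note [measurable] = e_meas[OF n(1)] e_meas[OF n(2)] Z_measurable[OF n(1,2)] Z_measurable[OF n(3,4)]
    from_J[OF w(1)]
  have KJ': "f \<in> borel_measurable J \<Longrightarrow> f \<in> borel_measurable (K k)" for f :: "'a \<Rightarrow> real"
    by (rule measurable_from_subalg[OF KJ[OF n(1)]])
  let ?g = "\<lambda>x. w x * (e l x * Z m r x)"
  note [measurable] = e_K[OF n(1,2) u(1)] e_K[OF n(1,3) u(2)] e_K[OF n(1,4) u(3)] KJ'[OF w(1)]
    KJ'[OF s_measurable(1)]
  have g[measurable]: "?g \<in> borel_measurable (K k)" unfolding Z_def by measurable
  have gi: "integrable M (\<lambda>x. ?g x * e k x)" using ZZ_integrable(2)[OF n w] by (simp add: ac_simps)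
  have "(\<integral>x. w x * (Z k l x * Z m r x) \<partial>M) = (\<integral>x. ?g x * e k x \<partial>M)"
  proof (rule integral_cong_AE)
    show "AE x in M. w x * (Z k l x * Z m r x) = ?g x * e k x"
      using s_cross[OF n(1,2) u(1)] by eventually_elim (auto simp: Z_def[of k l])
  qed simp_all
  also have "\<dots> = (\<integral>x. ?g x * real_cond_exp M (K k) (e k) x \<partial>M)"
    by (rule K.real_cond_exp_intg(2)[symmetric]) (use gi in auto)
  also have "\<dots> = (\<integral>x. 0 \<partial>M)"
    by (rule integral_cong_AE) (use mean[OF n(1)] in \<open>auto intro: measurable_from_subalg[OF subK[OF n(1)]]\<close>)
  finally show ?thesis by simp
qed

text \<open>Given \<open>K k\<close> the factor \<open>Z m r\<close> is fixed, while
  \<open>e k * e l\<close> has conditional mean \<open>s k l\<close> by \<open>second\<close>, so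
  that \<open>Z k l\<close> is centered.\<close>

lemma orthogonal_clusters:
  assumes n: "k < n" "l < n" "m < n" "r < n"
    and u: "cof k = cof l" "cof m = cof r" "cof k \<noteq> cof m"
    and w: "w \<in> borel_measurable J" "\<And>x. \<bar>w x\<bar> \<le> C"
  shows "(\<integral>x. w x * (Z k l x * Z m r x) \<partial>M) = 0"
proof -
  interpret K: sigma_finite_subalgebra M "K k" by (rule sigma_finite_subalgebraI[OF subK[OF n(1)]])
  note [measurable] = e_meas[OF n(1)] e_meas[OF n(2)] Z_measurable[OF n(1,2)] Z_measurable[OF n(3,4)]
    from_J[OF w(1)]
  have KJ': "f \<in> borel_measurable J \<Longrightarrow> f \<in> borel_measurable (K k)" for f :: "'a \<Rightarrow> real"
    by (rule measurable_from_subalg[OF KJ[OF n(1)]])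
  let ?g = "\<lambda>x. w x * Z m r x"
  have u': "cof k \<noteq> cof r" using u by simp
  note [measurable] = e_K[OF n(1,3) u(3)] e_K[OF n(1,4) u'] KJ'[OF w(1)] KJ'[OF s_measurable(1)]
  have g[measurable]: "?g \<in> borel_measurable (K k)" unfolding Z_def by measurable
  have gi: "integrable M (\<lambda>x. ?g x * (e k x * e l x))" using ZZ_integrable(2)[OF n w] by (simp add: ac_simps)
  have gz: "integrable M (\<lambda>x. ?g x * Z k l x)" using ZZ_integrable(1)[OF n w] by (simp add: ac_simps)
  have "(\<integral>x. ?g x * (e k x * e l x) \<partial>M) = (\<integral>x. ?g x * real_cond_exp M (K k) (\<lambda>x. e k x * e l x) x \<partial>M)"
    by (rule K.real_cond_exp_intg(2)[symmetric]) (use gi in auto)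
  also have "\<dots> = (\<integral>x. ?g x * s k l x \<partial>M)" unfolding s_def
    by (rule integral_cong_AE) (use second[OF n(1,2) u(1)] in \<open>auto intro: measurable_from_subalg[OF subK[OF n(1)]]\<close>)
  finally have "(\<integral>x. ?g x * (e k x * e l x) \<partial>M) = (\<integral>x. ?g x * s k l x \<partial>M)" .
  moreover have "integrable M (\<lambda>x. ?g x * s k l x)"
  proof -
    have "(\<lambda>x. ?g x * s k l x) = (\<lambda>x. ?g x * (e k x * e l x) - ?g x * Z k l x)"
      by (auto simp: fun_eq_iff Z_def[of k l] algebra_simps)
    then show ?thesis using gi gz by simp
  qed
  moreover have "(\<integral>x. w x * (Z k l x * Z m r x) \<partial>M) = (\<integral>x. ?g x * (e k x * e l x) - ?g x * s k l x \<partial>M)"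
    by (rule Bochner_Integration.integral_cong) (auto simp: Z_def[of k l] algebra_simps)
  ultimately show ?thesis using gi by simp
qed

definition paired :: "nat \<times> nat \<Rightarrow> nat \<times> nat \<Rightarrow> bool" where
  "paired p q \<longleftrightarrow> (cof (fst p) = cof (fst q) \<and> cof (snd p) = cof (snd q)) \<or>
     (cof (fst p) = cof (snd q) \<and> cof (snd p) = cof (fst q))"

lemma orthogonal_unpaired:
  assumes n: "k < n" "l < n" "m < n" "r < n" and p: "\<not> paired (k, l) (m, r)"
    and w: "w \<in> borel_measurable J" "\<And>x. \<bar>w x\<bar> \<le> C"
  shows "(\<integral>x. w x * (Z k l x * Z m r x) \<partial>M) = 0"
proof -
  have swap: "(\<integral>x. w x * (Z k l x * Z m r x) \<partial>M) = (\<integral>x. w x * (Z m r x * Z k l x) \<partial>M)"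
    by (simp add: ac_simps)
  \<comment> \<open>If the pairs are not \<open>paired\<close>, either each lies inside one cluster
    and the two clusters differ, or some index is the only one of the four in its cluster. The last
    four cases are one case up to symmetry.\<close>
  consider "cof k = cof l" "cof m = cof r" "cof k \<noteq> cof m"
    | "cof k \<noteq> cof l" "cof k \<noteq> cof m" "cof k \<noteq> cof r"
    | "cof l \<noteq> cof k" "cof l \<noteq> cof m" "cof l \<noteq> cof r"
    | "cof m \<noteq> cof r" "cof m \<noteq> cof k" "cof m \<noteq> cof l"
    | "cof r \<noteq> cof m" "cof r \<noteq> cof k" "cof r \<noteq> cof l"
    using p unfolding paired_def by simp metis
  then show ?thesis
  proof cases
    case 1 then show ?thesis using orthogonal_clusters[OF n _ _ _ w] by simp
  next
    case 2 then show ?thesis using orthogonal_unique_index[OF n _ _ _ w] by simp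
  next
    case 3 then show ?thesis
      using orthogonal_unique_index[OF n(2,1,3,4) _ _ _ w] by (simp add: Z_commute[of k l])
  next
    case 4 then show ?thesis
      using orthogonal_unique_index[OF n(3,4,1,2) _ _ _ w] by (simp add: swap)
  next
    case 5 then show ?thesis
      using orthogonal_unique_index[OF n(4,3,1,2) _ _ _ w] by (simp add: Z_commute[of m r] mult.commute[of "Z r m _"])
  qed
qed

text \<open>The clusters can match in two orders, and each order leaves at most \<open>c\<close>
  choices per coordinate.\<close>

lemma card_paired:
  assumes "p \<in> {..<n} \<times> {..<n}"
  shows "card {q\<in>{..<n} \<times> {..<n}. paired p q} \<le> 2 * c\<^sup>2"
proof -
  obtain k l where p: "p = (k, l)" "k < n" "l < n" using assms by auto
  let ?S = "\<lambda>k. {i\<in>{..<n}. cof i = cof k}"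
  have "{q\<in>{..<n} \<times> {..<n}. paired p q} \<subseteq> ?S k \<times> ?S l \<union> ?S l \<times> ?S k"
    unfolding paired_def p by auto
  then have "card {q\<in>{..<n} \<times> {..<n}. paired p q} \<le> card (?S k \<times> ?S l \<union> ?S l \<times> ?S k)"
    by (intro card_mono) auto
  also have "\<dots> \<le> card (?S k \<times> ?S l) + card (?S l \<times> ?S k)" by (rule card_Un_le)
  also have "\<dots> \<le> c * c + c * c"
    unfolding card_cartesian_product using cluster_size[OF p(2)] cluster_size[OF p(3)]
    by (intro add_mono mult_mono) auto
  finally show ?thesis by (simp add: power2_eq_square)
qed

text \<open>After expanding the square, unpaired terms vanish and paired ones are split into
  weighted squares by the arithmetic-geometric mean inequality. The factor
  \<open>2 * (real c)\<^sup>2\<close> counts the partners of an index pair; the next factor is the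
  constant of \<open>weighted_Z_square\<close>.\<close>

lemma quadratic_form_second_moment:
  assumes h: "\<And>k l. k < n \<Longrightarrow> l < n \<Longrightarrow> h k l \<in> borel_measurable J"
    and hC: "\<And>k l x. k < n \<Longrightarrow> l < n \<Longrightarrow> \<bar>h k l x\<bar> \<le> C"
  shows "integrable M (\<lambda>x. (\<Sum>k<n. \<Sum>l<n. h k l x * Z k l x)\<^sup>2)"
    "(\<integral>x. (\<Sum>k<n. \<Sum>l<n. h k l x * Z k l x)\<^sup>2 \<partial>M)
      \<le> 2 * (real c)\<^sup>2 * (2 * B + 2 * (1 + B)\<^sup>2) * (\<integral>x. (\<Sum>k<n. \<Sum>l<n. (h k l x)\<^sup>2) \<partial>M)"
proof -
  let ?I = "{..<n} \<times> {..<n}"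
  let ?B = "2 * B + 2 * (1 + B)\<^sup>2"
  define f where "f p x = h (fst p) (snd p) x" for p x
  define z where "z p x = Z (fst p) (snd p) x" for p x
  define a where "a p = (\<integral>x. (f p x)\<^sup>2 \<partial>M)" for p
  have fm[measurable]: "f p \<in> borel_measurable J" if "p \<in> ?I" for p
    using h that by (auto simp: f_def[abs_def])
  have fC: "\<bar>f p x\<bar> \<le> C" if "p \<in> ?I" for p x using hC that by (auto simp: f_def)
  have fM[measurable]: "f p \<in> borel_measurable M" if "p \<in> ?I" for p
    using from_J[OF fm[OF that]] .
  have zM[measurable]: "z p \<in> borel_measurable M" if "p \<in> ?I" for p
    using that by (auto simp: z_def[abs_def])
  have Y: "(\<Sum>k<n. \<Sum>l<n. h k l x * Z k l x)\<^sup>2 = (\<Sum>p\<in>?I. \<Sum>q\<in>?I. (f p x * f q x) * (z p x * z q x))" for x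
    by (simp add: sum.cartesian_product power2_eq_square sum_product f_def z_def split_beta ac_simps)
  have C2: "\<bar>f p x * f q x\<bar> \<le> C * C" if "p \<in> ?I" "q \<in> ?I" for p q x
    unfolding abs_mult using fC[OF that(1), of x] fC[OF that(2), of x] by (intro mult_mono) auto
  have ffm: "(\<lambda>x. f p x * f q x) \<in> borel_measurable J" if "p \<in> ?I" "q \<in> ?I" for p q
    using that by measurable
  have i: "integrable M (\<lambda>x. (f p x * f q x) * (z p x * z q x))" if "p \<in> ?I" "q \<in> ?I" for p q
    unfolding z_def by (rule ZZ_integrable(1)[OF _ _ _ _ ffm[OF that] C2[OF that]]) (use that in auto)
  show "integrable M (\<lambda>x. (\<Sum>k<n. \<Sum>l<n. h k l x * Z k l x)\<^sup>2)"
    unfolding Y by (intro Bochner_Integration.integrable_sum i)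
  have sq: "0 \<le> (f p x)\<^sup>2" "(f p x)\<^sup>2 \<le> C * C" if "p \<in> ?I" for p x
    using C2[OF that that, of x] by (auto simp: power2_eq_square)
  have fi: "integrable M (\<lambda>x. (f p x)\<^sup>2)" if "p \<in> ?I" for p
    by (rule integrable_const_bound[where B="C*C"]) (use sq[OF that] fM[OF that] in auto)
  have fz: "integrable M (\<lambda>x. (f p x)\<^sup>2 * (z q x)\<^sup>2)" "(\<integral>x. (f p x)\<^sup>2 * (z q x)\<^sup>2 \<partial>M) \<le> ?B * a p"
    if "p \<in> ?I" "q \<in> ?I" for p q
    unfolding z_def a_def
    by (rule weighted_Z_square[OF _ _ _ sq[OF that(1)]]; use that fm[OF that(1)] in force)+
  have le_pair: "(\<integral>x. (f p x * f q x) * (z p x * z q x) \<partial>M) \<le> (if paired p q then (?B * a p + ?B * a q) / 2 else 0)"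
    if pq: "p \<in> ?I" "q \<in> ?I" for p q
  proof (cases "paired p q")
    case False
    have "(\<integral>x. (f p x * f q x) * (Z (fst p) (snd p) x * Z (fst q) (snd q) x) \<partial>M) = 0"
      by (rule orthogonal_unpaired[OF _ _ _ _ _ ffm[OF pq] C2[OF pq]]) (use pq False in auto)
    then show ?thesis using False by (simp add: z_def)
  next
    case True
    let ?b = "\<lambda>x. ((f p x)\<^sup>2 * (z q x)\<^sup>2 + (f q x)\<^sup>2 * (z p x)\<^sup>2) / 2"
    have "(\<integral>x. (f p x * f q x) * (z p x * z q x) \<partial>M) \<le> (\<integral>x. ?b x \<partial>M)"
    proof (rule integral_mono[OF i[OF pq]])
      show "integrable M ?b" using fz(1)[OF pq] fz(1)[OF pq(2,1)] by auto
      show "(f p x * f q x) * (z p x * z q x) \<le> ?b x" for x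
        using abs_mult_le_sum_squares[of "f p x * z q x" "f q x * z p x"]
        by (simp add: power_mult_distrib ac_simps abs_le_iff)
    qed
    also have "\<dots> = ((\<integral>x. (f p x)\<^sup>2 * (z q x)\<^sup>2 \<partial>M) + (\<integral>x. (f q x)\<^sup>2 * (z p x)\<^sup>2 \<partial>M)) / 2"
      using fz(1)[OF pq] fz(1)[OF pq(2,1)] by simp
    also have "\<dots> \<le> (?B * a p + ?B * a q) / 2"
      using fz(2)[OF pq] fz(2)[OF pq(2,1)] by simp
    finally show ?thesis using True by simp
  qed
  have "(\<integral>x. (\<Sum>k<n. \<Sum>l<n. h k l x * Z k l x)\<^sup>2 \<partial>M)
      = (\<Sum>p\<in>?I. \<Sum>q\<in>?I. (\<integral>x. (f p x * f q x) * (z p x * z q x) \<partial>M))"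
    unfolding Y using i by (simp add: Bochner_Integration.integral_sum Bochner_Integration.integrable_sum)
  also have "\<dots> \<le> (\<Sum>p\<in>?I. \<Sum>q\<in>?I. if paired p q then (?B * a p + ?B * a q) / 2 else 0)"
    by (intro sum_mono le_pair)
  also have "\<dots> \<le> real (2 * c\<^sup>2) * (\<Sum>p\<in>?I. ?B * a p)"
  proof (rule sum_symmetric_relation_le)
    show "paired q p" if "paired p q" for p q using that unfolding paired_def by metis
    show "0 \<le> ?B * a p" for p
      unfolding a_def by (intro mult_nonneg_nonneg integral_nonneg) (use B in auto)
  qed (use card_paired in auto)
  also have "\<dots> = 2 * (real c)\<^sup>2 * ?B * (\<Sum>p\<in>?I. a p)"
    by (simp add: sum_distrib_left[symmetric] mult.assoc)
  also have "(\<Sum>p\<in>?I. a p) = (\<integral>x. (\<Sum>p\<in>?I. (f p x)\<^sup>2) \<partial>M)"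
    unfolding a_def using fi by (simp add: Bochner_Integration.integral_sum)
  also have "\<dots> = (\<integral>x. (\<Sum>k<n. \<Sum>l<n. (h k l x)\<^sup>2) \<partial>M)"
    by (simp add: sum.cartesian_product f_def split_beta)
  finally show "(\<integral>x. (\<Sum>k<n. \<Sum>l<n. h k l x * Z k l x)\<^sup>2 \<partial>M)
      \<le> 2 * (real c)\<^sup>2 * ?B * (\<integral>x. (\<Sum>k<n. \<Sum>l<n. (h k l x)\<^sup>2) \<partial>M)" .
qed

text \<open>A term survives only if both errors share a cluster, which leaves at most
  \<open>c\<close> partners. The factor \<open>1 + B\<close> comes from bounding a square by one
  plus the fourth power.\<close>

lemma linear_form_second_moment:
  assumes a: "\<And>k. k < n \<Longrightarrow> a k \<in> borel_measurable J"
    and aC: "\<And>k x. k < n \<Longrightarrow> \<bar>a k x\<bar> \<le> C"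
  shows "integrable M (\<lambda>x. (\<Sum>k<n. a k x * e k x)\<^sup>2)"
    "(\<integral>x. (\<Sum>k<n. a k x * e k x)\<^sup>2 \<partial>M) \<le> real c * (1 + B) * (\<integral>x. (\<Sum>k<n. (a k x)\<^sup>2) \<partial>M)"
proof -
  have C2: "\<bar>a k x * a l x\<bar> \<le> C * C" if "k < n" "l < n" for k l x
    unfolding abs_mult using aC[OF that(1), of x] aC[OF that(2), of x] by (intro mult_mono) auto
  have am[measurable]: "a k \<in> borel_measurable M" if "k < n" for k using from_J[OF a[OF that]] .
  have Y: "(\<Sum>k<n. a k x * e k x)\<^sup>2 = (\<Sum>k<n. \<Sum>l<n. (a k x * a l x) * (e k x * e l x))" for x
    by (simp add: power2_eq_square sum_product ac_simps)
  have sq: "0 \<le> (a k x)\<^sup>2" "(a k x)\<^sup>2 \<le> C * C" if "k < n" for k x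
    using C2[OF that that, of x] by (auto simp: power2_eq_square)
  have ai: "integrable M (\<lambda>x. (a k x)\<^sup>2)" if "k < n" for k
    by (rule integrable_const_bound[where B="C*C"]) (use sq[OF that] am[OF that] in auto)
  have i: "integrable M (\<lambda>x. (a k x * a l x) * (e k x * e l x))" if kl: "k < n" "l < n" for k l
  proof (rule Bochner_Integration.integrable_bound)
    show "integrable M (\<lambda>x. (C * C) * (e k x * e l x))" using product_integrable[OF kl] by auto
    show "AE x in M. norm ((a k x * a l x) * (e k x * e l x)) \<le> norm ((C * C) * (e k x * e l x))"
      unfolding real_norm_def abs_mult[of _ "e _ _ * _"]
      using C2[OF kl] by (intro AE_I2 mult_right_mono) (auto intro: order_trans[OF _ abs_ge_self])
  qed (intro borel_measurable_times am e_meas kl)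
  have ae: "integrable M (\<lambda>x. (a k x)\<^sup>2 * (e l x)\<^sup>2)"
      "(\<integral>x. (a k x)\<^sup>2 * (e l x)\<^sup>2 \<partial>M) \<le> (1 + B) * (\<integral>x. (a k x)\<^sup>2 \<partial>M)" if kl: "k < n" "l < n" for k l
  proof -
    note [measurable] = am[OF kl(1)] e_meas[OF kl(2)] a[OF kl(1)]
    have m: "(\<lambda>x. (a k x)\<^sup>2) \<in> borel_measurable J" by simp
    note w = weighted_fourth_moment[OF kl(2) m sq[OF kl(1)]]
    have le: "(a k x)\<^sup>2 * (e l x)\<^sup>2 \<le> (a k x)\<^sup>2 + (a k x)\<^sup>2 * e l x ^ 4" for x
      using mult_left_mono[OF square_le_one_plus_fourth[of "e l x"] sq(1)[OF kl(1), of x]]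
      by (simp add: algebra_simps)
    have ib: "integrable M (\<lambda>x. (a k x)\<^sup>2 + (a k x)\<^sup>2 * e l x ^ 4)" using w ai[OF kl(1)] by auto
    show i: "integrable M (\<lambda>x. (a k x)\<^sup>2 * (e l x)\<^sup>2)"
      by (rule Bochner_Integration.integrable_bound[OF ib])
         (use le in \<open>auto intro: order_trans[OF _ abs_ge_self]\<close>)
    have "(\<integral>x. (a k x)\<^sup>2 * (e l x)\<^sup>2 \<partial>M) \<le> (\<integral>x. (a k x)\<^sup>2 + (a k x)\<^sup>2 * e l x ^ 4 \<partial>M)"
      by (rule integral_mono[OF i ib le])
    also have "\<dots> = (\<integral>x. (a k x)\<^sup>2 \<partial>M) + (\<integral>x. (a k x)\<^sup>2 * e l x ^ 4 \<partial>M)"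
      using w ai[OF kl(1)] by simp
    finally show "(\<integral>x. (a k x)\<^sup>2 * (e l x)\<^sup>2 \<partial>M) \<le> (1 + B) * (\<integral>x. (a k x)\<^sup>2 \<partial>M)"
      using w(2) by (simp add: algebra_simps)
  qed
  let ?A = "\<lambda>k. (1 + B) * (\<integral>x. (a k x)\<^sup>2 \<partial>M)"
  have le_pair: "(\<integral>x. (a k x * a l x) * (e k x * e l x) \<partial>M) \<le> (if cof k = cof l then (?A k + ?A l) / 2 else 0)"
    if kl: "k < n" "l < n" for k l
  proof (cases "cof k = cof l")
    case False
    note [measurable] = am[OF kl(1)] am[OF kl(2)] e_meas[OF kl(1)] e_meas[OF kl(2)] a[OF kl(1)] a[OF kl(2)]
    have "(\<integral>x. (a k x * a l x) * (e k x * e l x) \<partial>M) = (\<integral>x. (a k x * a l x) * s k l x \<partial>M)"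
      unfolding s_def by (rule J.real_cond_exp_intg(2)[symmetric]) (use i[OF kl] in auto)
    also have "\<dots> = (\<integral>x. 0 \<partial>M)"
      by (rule integral_cong_AE) (use s_cross[OF kl False] in auto)
    finally show ?thesis using False by simp
  next
    case True
    let ?b = "\<lambda>x. ((a k x)\<^sup>2 * (e l x)\<^sup>2 + (a l x)\<^sup>2 * (e k x)\<^sup>2) / 2"
    have "(\<integral>x. (a k x * a l x) * (e k x * e l x) \<partial>M) \<le> (\<integral>x. ?b x \<partial>M)"
    proof (rule integral_mono[OF i[OF kl]])
      show "integrable M ?b" using ae(1)[OF kl] ae(1)[OF kl(2,1)] by auto
      show "(a k x * a l x) * (e k x * e l x) \<le> ?b x" for x
        using abs_mult_le_sum_squares[of "a k x * e l x" "a l x * e k x"]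
        by (simp add: power_mult_distrib ac_simps abs_le_iff)
    qed
    also have "\<dots> = ((\<integral>x. (a k x)\<^sup>2 * (e l x)\<^sup>2 \<partial>M) + (\<integral>x. (a l x)\<^sup>2 * (e k x)\<^sup>2 \<partial>M)) / 2"
      using ae(1)[OF kl] ae(1)[OF kl(2,1)] by simp
    also have "\<dots> \<le> (?A k + ?A l) / 2" using ae(2)[OF kl] ae(2)[OF kl(2,1)] by simp
    finally show ?thesis using True by simp
  qed
  show "integrable M (\<lambda>x. (\<Sum>k<n. a k x * e k x)\<^sup>2)"
    unfolding Y using i by (intro Bochner_Integration.integrable_sum) auto
  have "(\<integral>x. (\<Sum>k<n. a k x * e k x)\<^sup>2 \<partial>M) = (\<Sum>k<n. \<Sum>l<n. (\<integral>x. (a k x * a l x) * (e k x * e l x) \<partial>M))"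
    unfolding Y using i
    by (subst Bochner_Integration.integral_sum; (intro Bochner_Integration.integrable_sum sum.cong refl)?)
       (auto intro!: Bochner_Integration.integral_sum)
  also have "\<dots> \<le> (\<Sum>k<n. \<Sum>l<n. if cof k = cof l then (?A k + ?A l) / 2 else 0)"
    by (intro sum_mono le_pair) auto
  also have "\<dots> \<le> real c * (\<Sum>k<n. ?A k)"
  proof (rule sum_symmetric_relation_le)
    show "card {l \<in> {..<n}. cof k = cof l} \<le> c" if "k \<in> {..<n}" for k
      using cluster_size[of k] that by (simp add: eq_commute)
    show "0 \<le> ?A k" for k by (intro mult_nonneg_nonneg integral_nonneg) (use B in auto)
  qed auto
  also have "\<dots> = real c * (1 + B) * (\<integral>x. (\<Sum>k<n. (a k x)\<^sup>2) \<partial>M)"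
    using ai by (simp add: Bochner_Integration.integral_sum sum_distrib_left[symmetric])
  finally show "(\<integral>x. (\<Sum>k<n. a k x * e k x)\<^sup>2 \<partial>M) \<le> real c * (1 + B) * (\<integral>x. (\<Sum>k<n. (a k x)\<^sup>2) \<partial>M)" .
qed

end

section \<open>Algebra of the cluster-robust estimator\<close>

lemma sum_if_eq_lessThan: "i < (n::nat) \<Longrightarrow> (\<Sum>j<n. f j * (if j = i then 1 else 0)) = (f i :: real)"
  by (simp add: if_distrib[of "\<lambda>x. _ * x"] cong: if_cong)

section \<open>Contraction properties of an orthogonal projection\<close>

locale orthogonal_projection =
  fixes n :: nat and M :: "nat \<Rightarrow> nat \<Rightarrow> real"
  assumes sym: "\<And>i j. i < n \<Longrightarrow> j < n \<Longrightarrow> M i j = M j i"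
    and idem: "\<And>i j. i < n \<Longrightarrow> j < n \<Longrightarrow> (\<Sum>k<n. M i k * M k j) = M i j"
begin

lemma inner_projection:
  "(\<Sum>i<n. (\<Sum>j<n. M i j * x j) * (\<Sum>j<n. M i j * y j)) = (\<Sum>i<n. x i * (\<Sum>j<n. M i j * y j))"
proof -
  have "(\<Sum>i<n. (\<Sum>j<n. M i j * x j) * (\<Sum>j<n. M i j * y j)) = (\<Sum>i<n. \<Sum>j<n. \<Sum>k<n. x j * y k * (M j i * M i k))"
    unfolding sum_product using sym by (intro sum.cong refl) (simp add: ac_simps)
  also have "\<dots> = (\<Sum>j<n. \<Sum>k<n. x j * y k * (\<Sum>i<n. M j i * M i k))"
    by (subst sum.swap, rule sum.cong[OF refl], subst sum.swap) (simp add: sum_distrib_left)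
  also have "\<dots> = (\<Sum>j<n. \<Sum>k<n. x j * y k * M j k)" using idem by simp
  finally show ?thesis by (simp add: sum_distrib_left ac_simps)
qed

text \<open>Pythagoras: the difference between \<open>z\<close> and its projection has nonnegative
  square norm, and the cross term equals the square norm of the projection.\<close>

lemma projection_contraction: "(\<Sum>i<n. (\<Sum>j<n. M i j * z j)\<^sup>2) \<le> (\<Sum>i<n. (z i)\<^sup>2)"
proof -
  let ?p = "\<lambda>i. \<Sum>j<n. M i j * z j"
  have "0 \<le> (\<Sum>i<n. (z i - ?p i)\<^sup>2)" by (intro sum_nonneg) auto
  also have "\<dots> = (\<Sum>i<n. (z i)\<^sup>2) + (\<Sum>i<n. (?p i)\<^sup>2) - 2 * (\<Sum>i<n. z i * ?p i)"
    by (simp add: power2_diff sum.distrib sum_subtractf sum_distrib_left mult.assoc)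
  also have "(\<Sum>i<n. z i * ?p i) = (\<Sum>i<n. (?p i)\<^sup>2)"
    using inner_projection[of z z] by (simp add: power2_eq_square)
  finally show ?thesis by simp
qed

text \<open>By symmetry, row \<open>i\<close> is the image of the \<open>i\<close>-th unit
  vector.\<close>

lemma row_square_sum_le: assumes "i < n" shows "(\<Sum>k<n. (M i k)\<^sup>2) \<le> 1"
proof -
  have "(\<Sum>k<n. (M i k)\<^sup>2) = (\<Sum>k<n. (\<Sum>j<n. M k j * (if j = i then 1 else 0))\<^sup>2)"
    unfolding sum_if_eq_lessThan[OF assms] using sym assms by (intro sum.cong) auto
  also have "\<dots> \<le> (\<Sum>k<n. (if k = i then 1 else 0)\<^sup>2)" by (rule projection_contraction)
  also have "\<dots> = 1" using assms by (simp add: if_distrib[of "\<lambda>x. x\<^sup>2"] cong: if_cong)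
  finally show ?thesis .
qed

text \<open>With one index held fixed, the inner sums form a projected vector; the contraction is
  used once for each side.\<close>

lemma two_sided_contraction:
  "(\<Sum>k<n. \<Sum>l<n. (\<Sum>i<n. \<Sum>j<n. M k i * C i j * M l j)\<^sup>2) \<le> (\<Sum>i<n. \<Sum>j<n. (C i j)\<^sup>2)"
proof -
  have "(\<Sum>i<n. \<Sum>j<n. M k i * C i j * M l j) = (\<Sum>j<n. M l j * (\<Sum>i<n. M k i * C i j))" for k l
    by (subst sum.swap) (simp add: sum_distrib_left ac_simps)
  then have "(\<Sum>k<n. \<Sum>l<n. (\<Sum>i<n. \<Sum>j<n. M k i * C i j * M l j)\<^sup>2)
      = (\<Sum>k<n. \<Sum>l<n. (\<Sum>j<n. M l j * (\<Sum>i<n. M k i * C i j))\<^sup>2)"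
    by simp
  also have "\<dots> \<le> (\<Sum>k<n. \<Sum>j<n. (\<Sum>i<n. M k i * C i j)\<^sup>2)"
    by (intro sum_mono projection_contraction)
  also have "\<dots> = (\<Sum>j<n. \<Sum>k<n. (\<Sum>i<n. M k i * C i j)\<^sup>2)" by (rule sum.swap)
  also have "\<dots> \<le> (\<Sum>j<n. \<Sum>i<n. (C i j)\<^sup>2)" by (intro sum_mono projection_contraction)
  also have "\<dots> = (\<Sum>i<n. \<Sum>j<n. (C i j)\<^sup>2)" by (rule sum.swap)
  finally show ?thesis .
qed

end

section \<open>Sums over pairs of indices in a common cluster\<close>

locale within_cluster_pairs =
  fixes n :: nat and T :: "(nat \<times> nat) set" and c :: nat
  assumes T: "T \<subseteq> {..<n} \<times> {..<n}"
    and T_sym: "\<And>i j. (i, j) \<in> T \<Longrightarrow> (j, i) \<in> T"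
    and card_T: "\<And>i. i < n \<Longrightarrow> card {j\<in>{..<n}. (i, j) \<in> T} \<le> c"
begin

lemma finite_T: "finite T" by (rule finite_subset[OF T]) simp

lemma sum_T: "(\<Sum>p\<in>T. f p) = (\<Sum>i<n. \<Sum>j<n. if (i, j) \<in> T then f (i, j) else (0::real))"
proof -
  have "(\<Sum>p\<in>T. f p) = (\<Sum>p\<in>{..<n} \<times> {..<n}. if p \<in> T then f p else 0)"
    using T by (simp add: sum.inter_filter[symmetric] Int_absorb2 Int_def[symmetric])
      (metis inf.absorb_iff2)
  also have "\<dots> = (\<Sum>i<n. \<Sum>j<n. if (i, j) \<in> T then f (i, j) else 0)"
    by (simp add: sum.cartesian_product split_beta cong: if_cong)
  finally show ?thesis .
qed

lemma sum_T_fst_le: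
  assumes "\<And>i. i < n \<Longrightarrow> f i \<ge> 0"
  shows "(\<Sum>p\<in>T. f (fst p)) \<le> real c * (\<Sum>i<n. f i)"
proof -
  have "(\<Sum>p\<in>T. f (fst p)) = (\<Sum>i<n. \<Sum>j<n. if (i, j) \<in> T then f i else 0)"
    by (simp add: sum_T cong: if_cong)
  also have "\<dots> = (\<Sum>i<n. real (card {j\<in>{..<n}. (i, j) \<in> T}) * f i)"
    by (simp add: sum.If_cases Int_def)
  also have "\<dots> \<le> (\<Sum>i<n. real c * f i)"
    using assms card_T by (intro sum_mono mult_right_mono) auto
  finally show ?thesis by (simp add: sum_distrib_left)
qed

lemma sum_T_swap: "(\<Sum>p\<in>T. f (snd p) (fst p)) = (\<Sum>p\<in>T. f (fst p) (snd p))"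
  by (rule sum.reindex_bij_witness[of _ prod.swap prod.swap]) (auto intro: T_sym)

lemma sum_T_snd_le:
  assumes "\<And>i. i < n \<Longrightarrow> f i \<ge> 0"
  shows "(\<Sum>p\<in>T. f (snd p)) \<le> real c * (\<Sum>i<n. f i)"
  using sum_T_fst_le[of f] assms sum_T_swap[of "\<lambda>i j. f i"] by simp

text \<open>Writing \<open>\<Sigma>\<close> for the matrix with inverse \<open>R\<close>, evaluate the bilinear form
  \<open>x' \<Sigma> z\<close> at \<open>z = R x\<close> and bound it by the weighted arithmetic-geometric mean
  inequality.\<close>
lemma norm_le_quadratic_form:
  fixes v :: "nat \<Rightarrow> nat \<Rightarrow> real" and S L A :: real
  assumes \<sigma>: "\<And>k l. k < n \<Longrightarrow> l < n \<Longrightarrow> (k, l) \<notin> T \<Longrightarrow> \<sigma> k l = 0"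
    and S: "\<And>k l. k < n \<Longrightarrow> l < n \<Longrightarrow> \<bar>\<sigma> k l\<bar> \<le> S" "S > 0" "c > 0" "n > 0"
    and inv: "\<And>a b. a < d \<Longrightarrow> b < d \<Longrightarrow>
        (\<Sum>r<d. ((1 / n) * (\<Sum>k<n. \<Sum>l<n. v k a * v l r * \<sigma> k l)) * R r b) = (if a = b then 1 else 0)"
    and R: "(\<Sum>a<d. \<Sum>b<d. (R a b)\<^sup>2) \<le> L\<^sup>2" "L > 0"
    and v: "(1 / n) * (\<Sum>i<n. \<Sum>a<d. (v i a)\<^sup>2) \<le> A" "A > 0"
  shows "(\<Sum>a<d. (x a)\<^sup>2) \<le> (c * S)\<^sup>2 * L\<^sup>2 * A * ((1 / n) * (\<Sum>i<n. (\<Sum>a<d. v i a * x a)\<^sup>2))"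
proof -
  define z where "z r = (\<Sum>b<d. R r b * x b)" for r
  define X where "X k = (\<Sum>a<d. v k a * x a)" for k
  define Z where "Z k = (\<Sum>a<d. v k a * z a)" for k
  define N where "N = (\<Sum>a<d. (x a)\<^sup>2)"
  define \<Phi> where "\<Phi> = (1 / n) * (\<Sum>i<n. (X i)\<^sup>2)"
  \<comment> \<open>With this \<tau> the \<open>Z\<close>-part of the arithmetic-geometric mean
    bound becomes exactly \<open>N / 2\<close>, which is absorbed on the left.\<close>
  define \<tau> where "\<tau> = c * S * L\<^sup>2 * A"
  have \<tau>: "\<tau> > 0" using assms unfolding \<tau>_def by simp
  let ?G = "\<lambda>a r. (1 / n) * (\<Sum>k<n. \<Sum>l<n. v k a * v l r * \<sigma> k l)"
  have Gz: "(\<Sum>r<d. ?G a r * z r) = x a" if a: "a < d" for a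
  proof -
    have "(\<Sum>r<d. ?G a r * z r) = (\<Sum>r<d. \<Sum>b<d. ?G a r * (R r b * x b))"
      unfolding z_def sum_distrib_left ..
    also have "\<dots> = (\<Sum>b<d. \<Sum>r<d. ?G a r * (R r b * x b))" by (rule sum.swap)
    also have "\<dots> = (\<Sum>b<d. (\<Sum>r<d. ?G a r * R r b) * x b)"
      unfolding sum_distrib_right by (simp add: mult.assoc)
    also have "\<dots> = (\<Sum>b<d. (if a = b then 1 else 0) * x b)" using inv a by simp
    finally show ?thesis using a by (simp add: if_distrib[of "\<lambda>x. x * _"] cong: if_cong)
  qed
  have "N = (\<Sum>a<d. x a * (\<Sum>r<d. ?G a r * z r))"
    unfolding N_def using Gz by (simp add: power2_eq_square)
  also have "\<dots> = (\<Sum>a<d. \<Sum>r<d. \<Sum>k<n. \<Sum>l<n. (1/n) * (\<sigma> k l * ((v k a * x a) * (v l r * z r))))"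
    by (simp add: sum_distrib_left sum_distrib_right ac_simps)
  also have "\<dots> = (\<Sum>a<d. \<Sum>k<n. \<Sum>l<n. \<Sum>r<d. (1/n) * (\<sigma> k l * ((v k a * x a) * (v l r * z r))))"
    by (rule sum.cong[OF refl], subst sum.swap, rule sum.cong[OF refl], rule sum.swap)
  also have "\<dots> = (\<Sum>k<n. \<Sum>l<n. \<Sum>a<d. \<Sum>r<d. (1/n) * (\<sigma> k l * ((v k a * x a) * (v l r * z r))))"
    by (subst sum.swap, rule sum.cong[OF refl], rule sum.swap)
  also have "\<dots> = (1/n) * (\<Sum>k<n. \<Sum>l<n. \<sigma> k l * (X k * Z l))"
    unfolding X_def Z_def sum_product by (simp add: sum_distrib_left)
  also have "(\<Sum>k<n. \<Sum>l<n. \<sigma> k l * (X k * Z l)) = (\<Sum>p\<in>T. \<sigma> (fst p) (snd p) * (X (fst p) * Z (snd p)))"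
    unfolding sum_T using \<sigma> by (intro sum.cong refl) auto
  also have "\<dots> \<le> (\<Sum>p\<in>T. S * ((\<tau> * (X (fst p))\<^sup>2 + (Z (snd p))\<^sup>2 / \<tau>) / 2))"
  proof (rule sum_mono)
    fix p assume "p \<in> T"
    then have p: "fst p < n" "snd p < n" using T by auto
    have "\<bar>X (fst p) * Z (snd p)\<bar> = \<bar>(sqrt \<tau> * X (fst p)) * (Z (snd p) / sqrt \<tau>)\<bar>"
      using \<tau> by simp
    also have "\<dots> \<le> ((sqrt \<tau> * X (fst p))\<^sup>2 + (Z (snd p) / sqrt \<tau>)\<^sup>2) / 2"
      by (rule abs_mult_le_sum_squares)
    also have "\<dots> = (\<tau> * (X (fst p))\<^sup>2 + (Z (snd p))\<^sup>2 / \<tau>) / 2"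
      using \<tau> by (simp add: power_mult_distrib power_divide)
    finally have "\<bar>\<sigma> (fst p) (snd p)\<bar> * \<bar>X (fst p) * Z (snd p)\<bar> \<le> S * ((\<tau> * (X (fst p))\<^sup>2 + (Z (snd p))\<^sup>2 / \<tau>) / 2)"
      using S(1)[OF p] S(2) by (intro mult_mono) auto
    then show "\<sigma> (fst p) (snd p) * (X (fst p) * Z (snd p)) \<le> S * ((\<tau> * (X (fst p))\<^sup>2 + (Z (snd p))\<^sup>2 / \<tau>) / 2)"
      by (simp add: abs_mult[symmetric] abs_le_iff)
  qed
  also have "(\<Sum>p\<in>T. S * ((\<tau> * (X (fst p))\<^sup>2 + (Z (snd p))\<^sup>2 / \<tau>) / 2))
      = S / 2 * (\<tau> * (\<Sum>p\<in>T. (X (fst p))\<^sup>2) + (\<Sum>p\<in>T. (Z (snd p))\<^sup>2) / \<tau>)"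
    by (simp add: sum.distrib sum_distrib_left sum_divide_distrib algebra_simps add_divide_distrib)
  also have "\<dots> \<le> S / 2 * (\<tau> * (c * (\<Sum>i<n. (X i)\<^sup>2)) + (c * (\<Sum>i<n. (Z i)\<^sup>2)) / \<tau>)"
    using \<tau> S(2) sum_T_fst_le[of "\<lambda>i. (X i)\<^sup>2"] sum_T_snd_le[of "\<lambda>i. (Z i)\<^sup>2"]
    by (intro mult_left_mono add_mono divide_right_mono) auto
  finally have N1: "N \<le> (1/n) * (S / 2 * (\<tau> * (c * (\<Sum>i<n. (X i)\<^sup>2)) + (c * (\<Sum>i<n. (Z i)\<^sup>2)) / \<tau>))"
    using \<open>n > 0\<close> by (simp add: divide_right_mono)
  \<comment> \<open>Two uses of Cauchy-Schwarz: \<open>A\<close> bounds the mean square norm of the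
    rows of \<open>v\<close>, and the bound \<open>L\<close> on the Frobenius norm of
    \<open>R\<close> gives \<open>|z| \<le> L * |x|\<close>.\<close>
  have Z: "(1/n) * (\<Sum>i<n. (Z i)\<^sup>2) \<le> A * (L\<^sup>2 * N)"
  proof -
    have "(Z i)\<^sup>2 \<le> (\<Sum>a<d. (v i a)\<^sup>2) * (\<Sum>a<d. (z a)\<^sup>2)" for i
      unfolding Z_def by (rule Cauchy_Schwarz_ineq_sum)
    then have "(\<Sum>i<n. (Z i)\<^sup>2) \<le> (\<Sum>i<n. \<Sum>a<d. (v i a)\<^sup>2) * (\<Sum>a<d. (z a)\<^sup>2)"
      unfolding sum_distrib_right by (intro sum_mono)
    then have "(1/n) * (\<Sum>i<n. (Z i)\<^sup>2) \<le> ((1/n) * (\<Sum>i<n. \<Sum>a<d. (v i a)\<^sup>2)) * (\<Sum>a<d. (z a)\<^sup>2)"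
      unfolding mult.assoc by (intro mult_left_mono) auto
    also have "\<dots> \<le> A * (L\<^sup>2 * N)"
    proof (rule mult_mono)
      have "(z r)\<^sup>2 \<le> (\<Sum>b<d. (R r b)\<^sup>2) * N" for r
        unfolding z_def N_def by (rule Cauchy_Schwarz_ineq_sum)
      then have "(\<Sum>r<d. (z r)\<^sup>2) \<le> (\<Sum>r<d. \<Sum>b<d. (R r b)\<^sup>2) * N"
        unfolding sum_distrib_right by (intro sum_mono)
      also have "\<dots> \<le> L\<^sup>2 * N" using R by (intro mult_right_mono) (auto simp: N_def sum_nonneg)
      finally show "(\<Sum>r<d. (z r)\<^sup>2) \<le> L\<^sup>2 * N" .
    qed (use v in \<open>auto intro: sum_nonneg\<close>)
    finally show ?thesis .
  qed
  have "N \<le> S / 2 * (\<tau> * c * \<Phi> + c * ((1/n) * (\<Sum>i<n. (Z i)\<^sup>2)) / \<tau>)"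
    using N1 unfolding \<Phi>_def by (simp add: algebra_simps)
  also have "\<dots> \<le> S / 2 * (\<tau> * c * \<Phi> + c * (A * (L\<^sup>2 * N)) / \<tau>)"
    using Z \<tau> S by (intro mult_left_mono add_left_mono divide_right_mono) auto
  also have "\<dots> = S / 2 * \<tau> * c * \<Phi> + N / 2"
    using assms unfolding \<tau>_def by (simp add: field_simps power2_eq_square)
  finally have "N \<le> S * \<tau> * c * \<Phi>" by simp
  also have "\<dots> = (c * S)\<^sup>2 * L\<^sup>2 * A * \<Phi>" unfolding \<tau>_def by (simp add: power2_eq_square)
  finally show ?thesis unfolding N_def \<Phi>_def X_def .
qed

end

text \<open>Pairing the normal equations with \<delta> turns the quadratic form into the inner
  product of \<delta> with the unnormalised score, so \<open>|\<delta>|\<^sup>2\<close> is at most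
  \<open>\<Lambda> / n\<close> times that product. Cancelling one power of \<open>|\<delta>|\<close>
  gives the rate \<open>1 / sqrt n\<close>.\<close>

lemma least_squares_error_bound:
  fixes v :: "nat \<Rightarrow> nat \<Rightarrow> real" and \<Lambda> :: real
  assumes "n > 0" "\<Lambda> \<ge> 0"
    and pd: "(\<Sum>a<d. (\<delta> a)\<^sup>2) \<le> \<Lambda> * ((1 / n) * (\<Sum>i<n. (\<Sum>a<d. v i a * \<delta> a)\<^sup>2))"
    and normal: "\<And>a. a < d \<Longrightarrow> (\<Sum>b<d. (\<Sum>i<n. v i a * v i b) * \<delta> b) = (\<Sum>i<n. v i a * u i)"
  shows "n * (\<Sum>a<d. (\<delta> a)\<^sup>2) \<le> \<Lambda>\<^sup>2 * (\<Sum>a<d. ((1 / sqrt n) * (\<Sum>i<n. v i a * u i))\<^sup>2)"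
proof -
  define r where "r a = (\<Sum>i<n. v i a * u i)" for a
  have "(\<Sum>i<n. (\<Sum>a<d. v i a * \<delta> a)\<^sup>2) = (\<Sum>i<n. \<Sum>a<d. \<Sum>b<d. \<delta> a * (v i a * v i b * \<delta> b))"
    unfolding power2_eq_square sum_product by (simp add: ac_simps)
  also have "\<dots> = (\<Sum>a<d. \<Sum>b<d. \<Sum>i<n. \<delta> a * (v i a * v i b * \<delta> b))"
    by (subst sum.swap, rule sum.cong[OF refl], rule sum.swap)
  also have "\<dots> = (\<Sum>a<d. \<delta> a * (\<Sum>b<d. (\<Sum>i<n. v i a * v i b) * \<delta> b))"
    by (simp add: sum_distrib_left sum_distrib_right)
  also have "\<dots> = (\<Sum>a<d. \<delta> a * r a)" using normal unfolding r_def by simp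
  finally have "(\<Sum>a<d. (\<delta> a)\<^sup>2) \<le> (\<Sum>a<d. \<delta> a * (\<Lambda> / n * r a))"
    using pd by (simp add: sum_distrib_left ac_simps)
  also have "\<dots> \<le> (\<Sum>a<d. ((\<delta> a)\<^sup>2 + (\<Lambda> / n * r a)\<^sup>2) / 2)"
    using abs_mult_le_sum_squares by (intro sum_mono) (meson abs_le_D1)
  finally have "(\<Sum>a<d. (\<delta> a)\<^sup>2) \<le> (\<Sum>a<d. (\<Lambda> / n * r a)\<^sup>2)"
    by (simp add: sum.distrib sum_divide_distrib[symmetric])
  then have "n * (\<Sum>a<d. (\<delta> a)\<^sup>2) \<le> n * (\<Sum>a<d. (\<Lambda> / n * r a)\<^sup>2)"
    by (intro mult_left_mono) auto
  also have "\<dots> = \<Lambda>\<^sup>2 * (\<Sum>a<d. ((1 / sqrt n) * r a)\<^sup>2)"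
    using \<open>n > 0\<close> unfolding sum_distrib_left
    by (intro sum.cong refl) (simp add: power_mult_distrib power_divide power2_eq_square)
  finally show ?thesis unfolding r_def .
qed

section \<open>The weights of the estimator and the quadratic form in the errors\<close>

locale cluster_kappa = orthogonal_projection n M + within_cluster_pairs n T c
  for n M T c +
  fixes \<kappa> :: "nat \<times> nat \<Rightarrow> nat \<times> nat \<Rightarrow> real" and \<kappa>b :: real and a b :: "nat \<Rightarrow> real"
  assumes \<kappa>_inv: "\<And>p q. p \<in> T \<Longrightarrow> q \<in> T \<Longrightarrow>
      (\<Sum>r\<in>T. \<kappa> p r * (M (fst r) (fst q) * M (snd r) (snd q))) = (if p = q then 1 else 0)"
    and \<kappa>_sym: "\<And>p q. p \<in> T \<Longrightarrow> q \<in> T \<Longrightarrow> \<kappa> p q = \<kappa> q p"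
    and \<kappa>_row: "\<And>p. p \<in> T \<Longrightarrow> (\<Sum>q\<in>T. \<bar>\<kappa> p q\<bar>) \<le> \<kappa>b"
    and \<kappa>b: "\<kappa>b \<ge> 0"
begin

text \<open>Carrying out the sum over the pair that belongs to \<open>v_hat\<close> leaves the
  estimator, up to the factor \<open>1 / n\<close>, as a sum of products of residuals weighted by
  \<open>w\<close>. Here \<open>a\<close> and \<open>b\<close> are two coordinates of
  \<open>v_hat\<close>.\<close>

definition w :: "nat \<times> nat \<Rightarrow> real" where
  "w p = (\<Sum>q\<in>T. \<kappa> q p * (a (fst q) * b (snd q)))"

text \<open>The matrix product \<open>M C M\<close>, where \<open>C\<close> carries the weights
  \<open>w\<close> on the positions in \<open>T\<close> and is zero elsewhere.\<close>

definition H :: "nat \<Rightarrow> nat \<Rightarrow> real" where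
  "H k l = (\<Sum>p\<in>T. w p * M (fst p) k * M (snd p) l)"

text \<open>The weight sums along a column of \<kappa>, whereas the norm controls rows; symmetry of
  \<kappa> closes the gap.\<close>

lemma w_bound:
  assumes "p \<in> T" "\<And>i. i < n \<Longrightarrow> (a i)\<^sup>2 \<le> m" "\<And>i. i < n \<Longrightarrow> (b i)\<^sup>2 \<le> m" "m \<ge> 0"
  shows "\<bar>w p\<bar> \<le> \<kappa>b * m"
proof -
  have ab: "\<bar>a (fst q) * b (snd q)\<bar> \<le> m" if "q \<in> T" for q
  proof -
    have "\<bar>a (fst q) * b (snd q)\<bar> \<le> ((a (fst q))\<^sup>2 + (b (snd q))\<^sup>2) / 2" by (rule abs_mult_le_sum_squares)
    also have "\<dots> \<le> (m + m) / 2" using that T assms by (intro divide_right_mono add_mono) auto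
    finally show ?thesis by simp
  qed
  have "\<bar>w p\<bar> \<le> (\<Sum>q\<in>T. \<bar>\<kappa> p q\<bar> * m)"
    unfolding w_def
  proof (rule order_trans[OF sum_abs], rule sum_mono)
    fix q assume q: "q \<in> T"
    show "\<bar>\<kappa> q p * (a (fst q) * b (snd q))\<bar> \<le> \<bar>\<kappa> p q\<bar> * m"
      unfolding \<kappa>_sym[OF q assms(1)] abs_mult[of "\<kappa> _ _"] using ab[OF q] by (intro mult_left_mono) auto
  qed
  also have "\<dots> \<le> \<kappa>b * m"
    using \<kappa>_row[OF assms(1)] assms(4) unfolding sum_distrib_right[symmetric] by (rule mult_right_mono)
  finally show ?thesis .
qed

text \<open>After exchanging the sums, the inner one runs along a row of \<kappa>. Together with
  \<open>w_bound\<close> this controls the sum of squared weights by maximum times sum.\<close>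

lemma w_sum_bound: "(\<Sum>p\<in>T. \<bar>w p\<bar>) \<le> \<kappa>b * (c * ((\<Sum>i<n. (a i)\<^sup>2) + (\<Sum>i<n. (b i)\<^sup>2)) / 2)"
proof -
  have "(\<Sum>p\<in>T. \<bar>w p\<bar>) \<le> (\<Sum>p\<in>T. \<Sum>q\<in>T. \<bar>\<kappa> q p\<bar> * \<bar>a (fst q) * b (snd q)\<bar>)"
    unfolding w_def by (intro sum_mono order_trans[OF sum_abs]) (simp add: abs_mult)
  also have "\<dots> = (\<Sum>q\<in>T. (\<Sum>p\<in>T. \<bar>\<kappa> q p\<bar>) * \<bar>a (fst q) * b (snd q)\<bar>)"
    by (subst sum.swap) (simp add: sum_distrib_right)
  also have "\<dots> \<le> (\<Sum>q\<in>T. \<kappa>b * (((a (fst q))\<^sup>2 + (b (snd q))\<^sup>2) / 2))"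
    using \<kappa>_row \<kappa>b by (intro sum_mono mult_mono abs_mult_le_sum_squares) auto
  also have "\<dots> = \<kappa>b * (((\<Sum>q\<in>T. (a (fst q))\<^sup>2) + (\<Sum>q\<in>T. (b (snd q))\<^sup>2)) / 2)"
    by (simp add: sum.distrib sum_distrib_left[symmetric] sum_divide_distrib[symmetric])
  also have "\<dots> \<le> \<kappa>b * ((c * (\<Sum>i<n. (a i)\<^sup>2) + c * (\<Sum>i<n. (b i)\<^sup>2)) / 2)"
    using sum_T_fst_le[of "\<lambda>i. (a i)\<^sup>2"] sum_T_snd_le[of "\<lambda>i. (b i)\<^sup>2"] \<kappa>b
    by (intro mult_left_mono divide_right_mono add_mono) auto
  finally show ?thesis by (simp add: algebra_simps)
qed

lemma H_square_sum_le: "(\<Sum>k<n. \<Sum>l<n. (H k l)\<^sup>2) \<le> (\<Sum>p\<in>T. (w p)\<^sup>2)"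
proof -
  define C where "C i j = (if (i, j) \<in> T then w (i, j) else 0)" for i j
  have "H k l = (\<Sum>i<n. \<Sum>j<n. M k i * C i j * M l j)" if "k < n" "l < n" for k l
    unfolding H_def sum_T C_def using sym that by (intro sum.cong refl) auto
  then have "(\<Sum>k<n. \<Sum>l<n. (H k l)\<^sup>2) = (\<Sum>k<n. \<Sum>l<n. (\<Sum>i<n. \<Sum>j<n. M k i * C i j * M l j)\<^sup>2)"
    by simp
  also have "\<dots> \<le> (\<Sum>i<n. \<Sum>j<n. (C i j)\<^sup>2)" by (rule two_sided_contraction)
  also have "\<dots> = (\<Sum>p\<in>T. (w p)\<^sup>2)" unfolding sum_T C_def by (intro sum.cong refl) auto
  finally show ?thesis .
qed

text \<open>The defining property of \<open>\<kappa>\<close> makes the infeasible estimator conditionally unbiased.\<close>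
lemma H_unbiased:
  assumes "\<And>k l. k < n \<Longrightarrow> l < n \<Longrightarrow> (k, l) \<notin> T \<Longrightarrow> \<sigma> k l = 0"
  shows "(\<Sum>k<n. \<Sum>l<n. H k l * \<sigma> k l) = (\<Sum>k<n. \<Sum>l<n. a k * b l * \<sigma> k l)"
proof -
  have "(\<Sum>k<n. \<Sum>l<n. H k l * \<sigma> k l) = (\<Sum>q\<in>T. H (fst q) (snd q) * \<sigma> (fst q) (snd q))"
    unfolding sum_T using assms by (intro sum.cong refl) auto
  also have "\<dots> = (\<Sum>q\<in>T. a (fst q) * b (snd q) * \<sigma> (fst q) (snd q))"
  proof (rule sum.cong[OF refl])
    fix q assume q: "q \<in> T"
    have "H (fst q) (snd q) = (\<Sum>p\<in>T. \<Sum>r\<in>T. a (fst r) * b (snd r) * (\<kappa> r p * (M (fst p) (fst q) * M (snd p) (snd q))))"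
      unfolding H_def w_def by (simp add: sum_distrib_left sum_distrib_right ac_simps)
    also have "\<dots> = (\<Sum>r\<in>T. a (fst r) * b (snd r) * (\<Sum>p\<in>T. \<kappa> r p * (M (fst p) (fst q) * M (snd p) (snd q))))"
      by (subst sum.swap) (simp add: sum_distrib_left)
    also have "\<dots> = (\<Sum>r\<in>T. a (fst r) * b (snd r) * (if r = q then 1 else 0))"
      using \<kappa>_inv q by (intro sum.cong refl) auto
    also have "\<dots> = a (fst q) * b (snd q)"
      using finite_T q by (simp add: if_distrib[of "\<lambda>x. _ * x"] cong: if_cong)
    finally show "H (fst q) (snd q) * \<sigma> (fst q) (snd q) = a (fst q) * b (snd q) * \<sigma> (fst q) (snd q)" by simp
  qed
  also have "\<dots> = (\<Sum>k<n. \<Sum>l<n. a k * b l * \<sigma> k l)"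
    unfolding sum_T using assms by (intro sum.cong refl) auto
  finally show ?thesis .
qed

lemma w_quadratic_form:
  "(\<Sum>p\<in>T. w p * ((\<Sum>k<n. M (fst p) k * u k) * (\<Sum>l<n. M (snd p) l * u l)))
    = (\<Sum>k<n. \<Sum>l<n. H k l * (u k * u l))"
proof -
  have "(\<Sum>p\<in>T. w p * ((\<Sum>k<n. M (fst p) k * u k) * (\<Sum>l<n. M (snd p) l * u l)))
      = (\<Sum>p\<in>T. \<Sum>k<n. \<Sum>l<n. w p * M (fst p) k * M (snd p) l * (u k * u l))"
    by (rule sum.cong[OF refl], subst sum_product, unfold sum_distrib_left) (intro sum.cong refl, simp)
  also have "\<dots> = (\<Sum>k<n. \<Sum>l<n. \<Sum>p\<in>T. w p * M (fst p) k * M (snd p) l * (u k * u l))"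
    by (subst sum.swap, rule sum.cong[OF refl], rule sum.swap)
  finally show ?thesis unfolding H_def by (simp add: sum_distrib_right)
qed

text \<open>The first term is the centered quadratic form. Replacing \<open>M u\<close> by
  \<open>uh\<close> produces terms linear in \<open>M u\<close>; they are majorised through
  \<open>\<bar>x\<bar> \<le> 1 + x\<^sup>2\<close>, because weighted squares of \<open>M u\<close>
  are what the second moments control.\<close>

lemma estimator_error_bound:
  assumes \<sigma>: "\<And>k l. k < n \<Longrightarrow> l < n \<Longrightarrow> (k, l) \<notin> T \<Longrightarrow> \<sigma> k l = 0"
    and uh: "\<And>i. i < n \<Longrightarrow> uh i = (\<Sum>k<n. M i k * u k) - f i"
    and f: "\<And>i. i < n \<Longrightarrow> \<bar>f i\<bar> \<le> \<phi>"
  shows "\<bar>(\<Sum>q\<in>T. \<Sum>p\<in>T. \<kappa> q p * (a (fst q) * b (snd q)) * uh (fst p) * uh (snd p))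
        - (\<Sum>k<n. \<Sum>l<n. a k * b l * \<sigma> k l)\<bar>
    \<le> \<bar>\<Sum>k<n. \<Sum>l<n. H k l * (u k * u l - \<sigma> k l)\<bar>
      + \<phi> * (2 * (\<Sum>p\<in>T. \<bar>w p\<bar>) + (\<Sum>p\<in>T. \<bar>w p\<bar> * ((\<Sum>k<n. M (fst p) k * u k)\<^sup>2 + (\<Sum>k<n. M (snd p) k * u k)\<^sup>2)))
      + \<phi>\<^sup>2 * (\<Sum>p\<in>T. \<bar>w p\<bar>)"
proof -
  let ?m = "\<lambda>i. \<Sum>k<n. M i k * u k"
  have "(\<Sum>q\<in>T. \<Sum>p\<in>T. \<kappa> q p * (a (fst q) * b (snd q)) * uh (fst p) * uh (snd p))
      = (\<Sum>p\<in>T. w p * (uh (fst p) * uh (snd p)))"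
    unfolding w_def by (subst sum.swap) (simp add: sum_distrib_left sum_distrib_right ac_simps)
  also have "\<dots> = (\<Sum>p\<in>T. w p * (?m (fst p) * ?m (snd p)))
      + (\<Sum>p\<in>T. w p * (uh (fst p) * uh (snd p) - ?m (fst p) * ?m (snd p)))"
    by (simp add: algebra_simps sum.distrib[symmetric] sum_subtractf)
  also have "(\<Sum>p\<in>T. w p * (?m (fst p) * ?m (snd p))) = (\<Sum>k<n. \<Sum>l<n. H k l * (u k * u l))"
    by (rule w_quadratic_form)
  also have "\<dots> = (\<Sum>k<n. \<Sum>l<n. H k l * (u k * u l - \<sigma> k l)) + (\<Sum>k<n. \<Sum>l<n. a k * b l * \<sigma> k l)"
    using H_unbiased[of \<sigma>] \<sigma> by (simp add: right_diff_distrib sum_subtractf)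
  finally have eq: "(\<Sum>q\<in>T. \<Sum>p\<in>T. \<kappa> q p * (a (fst q) * b (snd q)) * uh (fst p) * uh (snd p))
        - (\<Sum>k<n. \<Sum>l<n. a k * b l * \<sigma> k l) = (\<Sum>k<n. \<Sum>l<n. H k l * (u k * u l - \<sigma> k l))
      + (\<Sum>p\<in>T. w p * (uh (fst p) * uh (snd p) - ?m (fst p) * ?m (snd p)))" by simp
  have "\<bar>\<Sum>p\<in>T. w p * (uh (fst p) * uh (snd p) - ?m (fst p) * ?m (snd p))\<bar>
      \<le> (\<Sum>p\<in>T. \<bar>w p\<bar> * (\<phi> * (2 + ((?m (fst p))\<^sup>2 + (?m (snd p))\<^sup>2)) + \<phi>\<^sup>2))"
  proof (rule order_trans[OF sum_abs], rule sum_mono)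
    fix p assume "p \<in> T"
    then have p: "fst p < n" "snd p < n" using T by auto
    let ?i = "?m (fst p)" and ?j = "?m (snd p)"
    have \<phi>: "\<phi> \<ge> 0" using f[OF p(1)] by linarith
    have m1: "\<bar>x\<bar> \<le> 1 + x\<^sup>2" for x :: real
      using abs_mult_le_sum_squares[of 1 x] by (simp add: add_increasing2)
    have "uh (fst p) * uh (snd p) - ?i * ?j = - (f (snd p) * ?i) - f (fst p) * ?j + f (fst p) * f (snd p)"
      unfolding uh[OF p(1)] uh[OF p(2)] by (simp add: algebra_simps)
    then have "\<bar>uh (fst p) * uh (snd p) - ?i * ?j\<bar>
        \<le> \<bar>f (snd p)\<bar> * \<bar>?i\<bar> + \<bar>f (fst p)\<bar> * \<bar>?j\<bar> + \<bar>f (fst p)\<bar> * \<bar>f (snd p)\<bar>"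
      unfolding abs_mult[symmetric] by linarith
    also have "\<dots> \<le> \<phi> * (1 + ?i\<^sup>2) + \<phi> * (1 + ?j\<^sup>2) + \<phi> * \<phi>"
      using f[OF p(1)] f[OF p(2)] m1 \<phi> by (intro add_mono mult_mono) auto
    also have "\<dots> = \<phi> * (2 + (?i\<^sup>2 + ?j\<^sup>2)) + \<phi>\<^sup>2" by (simp add: algebra_simps power2_eq_square)
    finally show "\<bar>w p * (uh (fst p) * uh (snd p) - ?i * ?j)\<bar> \<le> \<bar>w p\<bar> * (\<phi> * (2 + (?i\<^sup>2 + ?j\<^sup>2)) + \<phi>\<^sup>2)"
      unfolding abs_mult[of "w p"] by (intro mult_left_mono) auto
  qed
  also have "\<dots> = \<phi> * (2 * (\<Sum>p\<in>T. \<bar>w p\<bar>) + (\<Sum>p\<in>T. \<bar>w p\<bar> * ((?m (fst p))\<^sup>2 + (?m (snd p))\<^sup>2)))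
      + \<phi>\<^sup>2 * (\<Sum>p\<in>T. \<bar>w p\<bar>)"
    by (simp add: distrib_left sum.distrib sum_distrib_left ac_simps)
  finally show ?thesis unfolding eq by linarith
qed

end

section \<open>Inverse and smallest eigenvalue of a random matrix\<close>

lemma mat_inv_carrier: assumes A: "A \<in> carrier_mat n n" shows "mat_inv A \<in> carrier_mat n n"
  using A mat_inverse(2)[OF A] unfolding mat_inv_def by (cases "mat_inverse A") auto

lemma mat_inv_inverse:
  assumes A: "A \<in> carrier_mat n n" and d: "det A \<noteq> 0"
  shows "A * mat_inv A = 1\<^sub>m n" "mat_inv A * A = 1\<^sub>m n"
proof -
  have "mat_inverse A \<noteq> None"
    using mat_inverse(1)[OF A, of undefined] det_non_zero_imp_unit[OF A d, of undefined] by blast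
  then obtain B where "mat_inverse A = Some B" by auto
  with mat_inverse(2)[OF A this] show "A * mat_inv A = 1\<^sub>m n" "mat_inv A * A = 1\<^sub>m n"
    unfolding mat_inv_def by auto
qed

lemma mat_inv_singular:
  assumes A: "A \<in> carrier_mat n n" and d: "det A = 0"
  shows "mat_inv A = 0\<^sub>m n n"
proof (cases "mat_inverse A")
  case None then show ?thesis using A unfolding mat_inv_def by auto
next
  case (Some B)
  with mat_inverse(2)[OF A this] have "A * B = 1\<^sub>m n" "B \<in> carrier_mat n n" by auto
  then have "det A * det B = 1" using det_mult[OF A, of B] by simp
  then show ?thesis using d by simp
qed

text \<open>Division by zero yields 0, so Cramer's rule also reproduces the conventional value of
  \<open>mat_inv\<close> at singular matrices. Having one formula for all matrices makes the entries
  measurable.\<close>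

lemma mat_inv_index:
  assumes A: "A \<in> carrier_mat n n" and ij: "i < n" "j < n"
  shows "mat_inv A $$ (i, j) = adj_mat A $$ (i, j) / det A"
proof (cases "det A = 0")
  case True then show ?thesis using mat_inv_singular[OF A] ij by simp
next
  case False
  note iA = mat_inv_carrier[OF A] and aA = adj_mat[OF A]
  have "adj_mat A = adj_mat A * (A * mat_inv A)"
    using mat_inv_inverse(1)[OF A False] right_mult_one_mat[OF aA(1)] by simp
  also have "\<dots> = (adj_mat A * A) * mat_inv A" by (rule assoc_mult_mat[OF aA(1) A iA, symmetric])
  also have "\<dots> = det A \<cdot>\<^sub>m (1\<^sub>m n * mat_inv A)"
    unfolding aA(3) by (rule mult_smult_assoc_mat[OF one_carrier_mat iA])
  also have "1\<^sub>m n * mat_inv A = mat_inv A" by (rule left_mult_one_mat[OF iA])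
  finally have "(det A \<cdot>\<^sub>m mat_inv A) $$ (i, j) = adj_mat A $$ (i, j)" by (rule arg_cong[OF sym])
  then show ?thesis using iA ij False by (simp add: field_simps)
qed

lemma invertible_mat_iff_det:
  fixes A :: "real mat"
  assumes A: "A \<in> carrier_mat n n" shows "invertible_mat A \<longleftrightarrow> det A \<noteq> 0"
proof
  assume "invertible_mat A"
  then obtain B where B: "A * B = 1\<^sub>m (dim_row A)" "B * A = 1\<^sub>m (dim_row B)"
    unfolding invertible_mat_def inverts_mat_def by auto
  have "dim_col B = n" using arg_cong[OF B(1), of dim_col] A by simp
  moreover have "dim_row B = n" using arg_cong[OF B(2), of dim_col] A by simp
  ultimately have "B \<in> carrier_mat n n" by auto
  then have "det A * det B = 1" using det_mult[OF A, of B] B A by simp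
  then show "det A \<noteq> 0" by auto
next
  assume "det A \<noteq> 0"
  then show "invertible_mat A"
    using mat_inv_inverse[OF A] mat_inv_carrier[OF A] A unfolding invertible_mat_def inverts_mat_def
    by (auto intro!: exI[of _ "mat_inv A"])
qed

lemma finite_eigenvalues:
  fixes A :: "real mat" assumes A: "A \<in> carrier_mat n n" shows "finite {k. eigenvalue A k}"
proof -
  have "char_poly A \<noteq> 0" using degree_monic_char_poly[OF A] by (metis coeff_0 zero_neq_one)
  then show ?thesis using poly_roots_finite eigenvalue_root_char_poly[OF A] by simp
qed

text \<open>A vanishing determinant would make 0 an eigenvalue, and the minimum of the finite
  spectrum could not exceed it.\<close>

lemma lambda_min_pos_det:
  assumes A: "A \<in> carrier_mat n n" and "lambda_min A > 0" shows "det A \<noteq> 0"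
proof
  assume 0: "det A = 0"
  have "char_matrix A 0 = A" using A unfolding char_matrix_def by (intro eq_matI) auto
  then have "eigenvalue A 0" using 0 eigenvalue_det[OF A] by simp
  then have "lambda_min A \<le> 0"
    unfolding lambda_min_def by (intro Min_le finite_eigenvalues[OF A]) simp
  then show False using assms by simp
qed

section \<open>Measurability of determinants, inverses and smallest eigenvalues\<close>

lemma det_measurable:
  fixes A :: "'a \<Rightarrow> real mat"
  assumes "\<And>x. x \<in> space N \<Longrightarrow> A x \<in> carrier_mat n n"
    and "\<And>i j. i < n \<Longrightarrow> j < n \<Longrightarrow> (\<lambda>x. A x $$ (i, j)) \<in> borel_measurable N"
  shows "(\<lambda>x. det (A x)) \<in> borel_measurable N"
proof -
  have "(\<lambda>x. \<Sum>p\<in>{p. p permutes {0..<n}}. signof p * (\<Prod>i = 0..<n. A x $$ (i, p i))) \<in> borel_measurable N"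
  proof (intro borel_measurable_sum borel_measurable_times borel_measurable_const borel_measurable_prod)
    fix p i assume "p \<in> {p. p permutes {0..<n}}" "i \<in> {0..<n}"
    then have "i < n" "p i < n" using permutes_in_image[of p "{0..<n}" i] by auto
    then show "(\<lambda>x. A x $$ (i, p i)) \<in> borel_measurable N" by (rule assms)
  qed
  then show ?thesis
    by (rule measurable_cong[THEN iffD1, rotated]) (rule det_def'[OF assms(1), symmetric])
qed

lemma mat_inv_measurable:
  fixes A :: "'a \<Rightarrow> real mat"
  assumes A: "\<And>x. x \<in> space N \<Longrightarrow> A x \<in> carrier_mat n n"
    and m: "\<And>i j. i < n \<Longrightarrow> j < n \<Longrightarrow> (\<lambda>x. A x $$ (i, j)) \<in> borel_measurable N"
    and ij: "i < n" "j < n"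
  shows "(\<lambda>x. mat_inv (A x) $$ (i, j)) \<in> borel_measurable N"
proof -
  have d[measurable]: "(\<lambda>x. det (A x)) \<in> borel_measurable N" by (rule det_measurable[OF A m])
  have del: "(\<lambda>x. det (mat_delete (A x) j i)) \<in> borel_measurable N"
  proof (rule det_measurable[where n="n-1"])
    show "mat_delete (A x) j i \<in> carrier_mat (n-1) (n-1)" if "x \<in> space N" for x
      using mat_delete_carrier[OF A[OF that]] .
    fix k l assume kl: "k < n - 1" "l < n - 1"
    let ?k = "if k < j then k else Suc k" and ?l = "if l < i then l else Suc l"
    have "(\<lambda>x. A x $$ (?k, ?l)) \<in> borel_measurable N" by (rule m) (use kl in auto)
    moreover have "mat_delete (A x) j i $$ (k, l) = A x $$ (?k, ?l)" if "x \<in> space N" for x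
      using A[OF that] kl unfolding mat_delete_def by auto
    ultimately show "(\<lambda>x. mat_delete (A x) j i $$ (k, l)) \<in> borel_measurable N"
      by (subst measurable_cong) auto
  qed
  have "(\<lambda>x. (-1)^(j + i) * det (mat_delete (A x) j i) / det (A x)) \<in> borel_measurable N"
    using del by measurable
  moreover have "mat_inv (A x) $$ (i, j) = (-1)^(j + i) * det (mat_delete (A x) j i) / det (A x)"
    if "x \<in> space N" for x
    using mat_inv_index[OF A[OF that] ij] A[OF that] ij by (simp add: adj_mat_def cofactor_def)
  ultimately show ?thesis by (subst measurable_cong) auto
qed

text \<open>The right-hand side only involves rational points, which makes the smallest root
  measurable.\<close>
lemma ex_root_le_iff:
  fixes q :: "real \<Rightarrow> real"
  assumes q: "continuous_on UNIV q"
  shows "(\<exists>k\<le>t. q k = 0) \<longleftrightarrow>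
    (\<exists>N::nat. \<forall>m::nat. \<exists>r\<in>\<rat>. - real N \<le> r \<and> r \<le> t + 1 / real (Suc m) \<and> \<bar>q r\<bar> < 1 / real (Suc m))"
proof
  assume "\<exists>k\<le>t. q k = 0"
  then obtain k where k: "k \<le> t" "q k = 0" by auto
  \<comment> \<open>The lower bound keeps the approximating rational points in a bounded set, as the
    converse needs for compactness.\<close>
  obtain N :: nat where N: "real N > - k" using reals_Archimedean2 by blast
  show "\<exists>N::nat. \<forall>m::nat. \<exists>r\<in>\<rat>. - real N \<le> r \<and> r \<le> t + 1 / real (Suc m) \<and> \<bar>q r\<bar> < 1 / real (Suc m)"
  proof (intro exI allI)
    fix m :: nat
    let ?e = "1 / real (Suc m)"
    have "?e > 0" by simp
    then obtain \<delta> where \<delta>: "\<delta> > 0" "\<And>r. dist r k < \<delta> \<Longrightarrow> dist (q r) (q k) < ?e"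
      using q unfolding continuous_on_iff by (metis UNIV_I)
    obtain r where r: "r \<in> \<rat>" "k < r" "r < k + min \<delta> ?e"
      using Rats_dense_in_real[of k "k + min \<delta> ?e"] \<delta> \<open>?e > 0\<close> by auto
    then have "dist r k < \<delta>" by (auto simp: dist_real_def)
    from \<delta>(2)[OF this] k have "\<bar>q r\<bar> < ?e" by (simp add: dist_real_def)
    then show "\<exists>r\<in>\<rat>. - real N \<le> r \<and> r \<le> t + ?e \<and> \<bar>q r\<bar> < ?e"
      using r N k by (intro bexI[of _ r]) auto
  qed
next
  assume "\<exists>N::nat. \<forall>m::nat. \<exists>r\<in>\<rat>. - real N \<le> r \<and> r \<le> t + 1 / real (Suc m) \<and> \<bar>q r\<bar> < 1 / real (Suc m)"
  then obtain N :: nat and r where r: "\<And>m::nat. - real N \<le> r m" "\<And>m::nat. r m \<le> t + 1 / real (Suc m)"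
    "\<And>m::nat. \<bar>q (r m)\<bar> < 1 / real (Suc m)" by metis
  have "1 / real (Suc m) \<le> 1" for m by simp
  then have "r m \<in> {- real N .. t + 1}" for m using r(1,2)[of m] by (auto intro: order_trans)
  \<comment> \<open>Compactness yields a limit point of the approximate roots; the two vanishing
    tolerances make it a root that does not exceed \<open>t\<close>.\<close>
  then obtain k \<rho> where k: "strict_mono \<rho>" "(r \<circ> \<rho>) \<longlonglongrightarrow> k"
    using compact_imp_seq_compact[OF compact_Icc[of "- real N" "t + 1"]] unfolding seq_compact_def by metis
  have inv: "(\<lambda>m. 1 / real (Suc (\<rho> m))) \<longlonglongrightarrow> 0"
    using LIMSEQ_subseq_LIMSEQ[OF LIMSEQ_inverse_real_of_nat k(1)] by (simp add: o_def inverse_eq_divide)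
  have "(\<lambda>m. t + 1 / real (Suc (\<rho> m))) \<longlonglongrightarrow> t + 0" by (intro tendsto_intros inv)
  then have "k \<le> t" using k(2) r(2) by (intro LIMSEQ_le[OF k(2)]) (auto simp: o_def)
  moreover have "(\<lambda>m. q (r (\<rho> m))) \<longlonglongrightarrow> q k"
    using continuous_on_tendsto_compose[OF q k(2)] by (simp add: o_def)
  moreover have "(\<lambda>m. q (r (\<rho> m))) \<longlonglongrightarrow> 0"
    by (rule Lim_null_comparison[OF _ inv]) (use r(3) in \<open>auto intro!: always_eventually less_imp_le\<close>)
  ultimately show "\<exists>k\<le>t. q k = 0" using LIMSEQ_unique by blast
qed

text \<open>If there is a real eigenvalue at all, \<open>lambda_min \<le> t\<close> says that the
  characteristic determinant has a root \<open>k \<le> t\<close>, which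
  \<open>ex_root_le_iff\<close> expresses by countably many conditions.\<close>

lemma lambda_min_measurable:
  fixes A :: "'a \<Rightarrow> real mat"
  assumes A: "\<And>x. x \<in> space N \<Longrightarrow> A x \<in> carrier_mat n n"
    and m: "\<And>i j. i < n \<Longrightarrow> j < n \<Longrightarrow> (\<lambda>x. A x $$ (i, j)) \<in> borel_measurable N"
  shows "(\<lambda>x. lambda_min (A x)) \<in> borel_measurable N"
proof -
  define q where "q x k = det (char_matrix (A x) k)" for x k
  have qm[measurable]: "(\<lambda>x. q x k) \<in> borel_measurable N" for k
    unfolding q_def
  proof (rule det_measurable)
    show "char_matrix (A x) k \<in> carrier_mat n n" if "x \<in> space N" for x using A[OF that] by simp
    fix i j assume ij: "i < n" "j < n"
    note [measurable] = m[OF ij]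
    have "(\<lambda>x. A x $$ (i, j) + (-k) * (if i = j then 1 else 0)) \<in> borel_measurable N" by measurable
    moreover have "char_matrix (A x) k $$ (i, j) = A x $$ (i, j) + (-k) * (if i = j then 1 else 0)"
      if "x \<in> space N" for x
      using A[OF that] ij unfolding char_matrix_def by simp
    ultimately show "(\<lambda>x. char_matrix (A x) k $$ (i, j)) \<in> borel_measurable N"
      by (subst measurable_cong) auto
  qed
  have qc: "continuous_on UNIV (q x)" if "x \<in> space N" for x
  proof -
    have "q x = (\<lambda>k. poly (char_poly (A x)) k * (-1)^n)"
    proof
      fix k
      have "poly (char_poly (A x)) k = det (- char_matrix (A x) k)" by (rule char_poly_matrix[OF A[OF that]])
      also have "- char_matrix (A x) k = (-1) \<cdot>\<^sub>m char_matrix (A x) k" by (intro eq_matI) auto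
      also have "det \<dots> = (-1)^n * q x k"
        using A[OF that] unfolding q_def by (simp add: char_matrix_def)
      finally show "q x k = poly (char_poly (A x)) k * (-1)^n" by (simp flip: power_mult_distrib)
    qed
    then show ?thesis by (auto intro!: continuous_intros)
  qed
  have ev: "eigenvalue (A x) k \<longleftrightarrow> q x k = 0" if "x \<in> space N" for x k
    unfolding q_def by (rule eigenvalue_det[OF A[OF that]])
  have S[measurable]: "{x\<in>space N. \<exists>k\<le>t. q x k = 0} \<in> sets N" for t
  proof -
    have "{x\<in>space N. \<exists>N::nat. \<forall>m::nat. \<exists>r\<in>\<rat>. - real N \<le> r \<and> r \<le> t + 1 / real (Suc m) \<and> \<bar>q x r\<bar> < 1 / real (Suc m)} \<in> sets N"
      using countable_rat by measurable
    also have "{x\<in>space N. \<exists>N::nat. \<forall>m::nat. \<exists>r\<in>\<rat>. - real N \<le> r \<and> r \<le> t + 1 / real (Suc m) \<and> \<bar>q x r\<bar> < 1 / real (Suc m)}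
        = {x\<in>space N. \<exists>k\<le>t. q x k = 0}"
      using ex_root_le_iff[OF qc] by blast
    finally show ?thesis .
  qed
  show ?thesis
    unfolding borel_measurable_iff_le
  proof
    fix t :: real
    \<comment> \<open>A matrix without real eigenvalues has \<open>lambda_min\<close> equal to the
      unspecified constant \<open>Min {}\<close>. The absence of roots is the complement of a
      countable union of the root events.\<close>
    let ?e = "{x\<in>space N. Min ({} :: real set) \<le> t} \<inter> (space N - (\<Union>i::nat. {x\<in>space N. \<exists>k\<le>real i. q x k = 0}))"
    have "{x \<in> space N. lambda_min (A x) \<le> t} = {x\<in>space N. \<exists>k\<le>t. q x k = 0} \<union> ?e" (is "?l = ?r")
    proof (rule Set.set_eqI)
      fix x
      show "x \<in> ?l \<longleftrightarrow> x \<in> ?r"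
      proof (cases "x \<in> space N")
        case True
        have E: "{k. eigenvalue (A x) k} = {k. q x k = 0}" using ev[OF True] by auto
        show ?thesis
        proof (cases "{k. q x k = 0} = {}")
          case empty: True
          then show ?thesis using True by (auto simp: lambda_min_def E)
        next
          case False
          have fin: "finite {k. q x k = 0}" using finite_eigenvalues[OF A[OF True]] E by simp
          obtain k where "q x k = 0" using False by auto
          moreover obtain i :: nat where "k \<le> real i" using real_arch_simple by blast
          ultimately have "x \<notin> ?e" by blast
          then show ?thesis using True Min_le_iff[OF fin False, of t] by (auto simp: lambda_min_def E)
        qed
      qed simp
    qed
    also have "\<dots> \<in> sets N" by measurable
    finally show "{x \<in> space N. lambda_min (A x) \<le> t} \<in> sets N" .
  qed
qed

lemma inverse_norm_measurable:
  assumes A: "\<And>x. x \<in> space N \<Longrightarrow> A x \<in> carrier_mat n n"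
    and m: "\<And>i j. i < n \<Longrightarrow> j < n \<Longrightarrow> (\<lambda>x. A x $$ (i, j)) \<in> borel_measurable N"
  shows "(\<lambda>x. inverse_norm (A x)) \<in> borel_measurable N"
proof -
  note [measurable] = det_measurable[OF A m] mat_inv_measurable[OF A m]
  have "(\<lambda>x. if det (A x) \<noteq> 0 then ennreal (sqrt (\<Sum>i<n. \<Sum>j<n. (mat_inv (A x) $$ (i, j))\<^sup>2)) else \<infinity>)
      \<in> borel_measurable N"
    by measurable
  moreover have "inverse_norm (A x) = (if det (A x) \<noteq> 0 then ennreal (sqrt (\<Sum>i<n. \<Sum>j<n. (mat_inv (A x) $$ (i, j))\<^sup>2)) else \<infinity>)"
    if "x \<in> space N" for x
    using invertible_mat_iff_det[OF A[OF that]] mat_inv_carrier[OF A[OF that]]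
    unfolding inverse_norm_def mat_norm_def by auto
  ultimately show ?thesis by (subst measurable_cong) auto
qed

section \<open>Least squares and the weights of the estimator for a single sample\<close>

lemma mult_mat_index_sum:
  fixes A B :: "real mat"
  assumes "A \<in> carrier_mat n m" "B \<in> carrier_mat m k" "i < n" "j < k"
  shows "(A * B) $$ (i, j) = (\<Sum>l<m. A $$ (i, l) * B $$ (l, j))"
  using assms by (simp add: scalar_prod_def atLeast0LessThan)

lemma mult_mat_vec_index_sum:
  fixes A :: "real mat"
  assumes "A \<in> carrier_mat n m" "v \<in> carrier_vec m" "i < n"
  shows "(A *\<^sub>v v) $ i = (\<Sum>l<m. A $$ (i, l) * v $ l)"
  using assms by (simp add: scalar_prod_def atLeast0LessThan)

lemma mat_inv_mult_index:
  fixes A :: "real mat"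
  assumes A: "A \<in> carrier_mat n n" "det A \<noteq> 0" "i < n" "j < n"
  shows "(\<Sum>l<n. A $$ (i, l) * mat_inv A $$ (l, j)) = (if i = j then 1 else 0)"
    "(\<Sum>l<n. mat_inv A $$ (i, l) * A $$ (l, j)) = (if i = j then 1 else 0)"
  using mat_inv_inverse[OF A(1,2)] mult_mat_index_sum[OF A(1) mat_inv_carrier[OF A(1)] A(3,4)]
    mult_mat_index_sum[OF mat_inv_carrier[OF A(1)] A(1) A(3,4)] A(3,4) by auto

text \<open>For the inverse \<open>J\<close>, the product of \<open>J\<close>, \<open>A\<close> and
  the transpose of \<open>J\<close> is evaluated from both ends.\<close>

lemma mat_inv_symmetric:
  assumes A: "A \<in> carrier_mat n n" "det A \<noteq> 0"
    and sym: "\<And>i j. i < n \<Longrightarrow> j < n \<Longrightarrow> A $$ (i, j) = A $$ (j, i)" and ij: "i < n" "j < n"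
  shows "mat_inv A $$ (i, j) = mat_inv A $$ (j, i)"
proof -
  let ?J = "\<lambda>i j. mat_inv A $$ (i, j)"
  have "?J i j = (\<Sum>k<n. ?J i k * (\<Sum>l<n. ?J j l * A $$ (l, k)))"
    using mat_inv_mult_index(2)[OF A ij(2)] ij
    by (simp add: if_distrib[of "\<lambda>x. _ * x"] cong: if_cong)
  also have "\<dots> = (\<Sum>l<n. (\<Sum>k<n. ?J i k * A $$ (k, l)) * ?J j l)"
    unfolding sum_distrib_left sum_distrib_right
    by (subst sum.swap) (use sym in \<open>auto intro!: sum.cong simp: ac_simps\<close>)
  also have "\<dots> = ?J j i"
    using mat_inv_mult_index(2)[OF A ij(1)] ij
    by (simp add: if_distrib[of "\<lambda>x. x * _"] cong: if_cong)
  finally show ?thesis .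
qed

lemma gram_carrier: "gram m n z \<in> carrier_mat m m"
  unfolding gram_def by simp

lemma gram_index: "i < m \<Longrightarrow> j < m \<Longrightarrow> gram m n z $$ (i, j) = (\<Sum>k<n. z k $ i * z k $ j)"
  unfolding gram_def by simp

lemma vec_norm_square: "v \<in> carrier_vec k \<Longrightarrow> (vec_norm v)\<^sup>2 = (\<Sum>a<k. (v $ a)\<^sup>2)"
  unfolding vec_norm_def by (auto simp: scalar_prod_def atLeast0LessThan power2_eq_square sum_nonneg)

lemma vec_norm_eq: "v \<in> carrier_vec k \<Longrightarrow> vec_norm v = sqrt (\<Sum>a<k. (v $ a)\<^sup>2)"
  unfolding vec_norm_def by (auto simp: scalar_prod_def atLeast0LessThan power2_eq_square)

locale sample_row =
  fixes S :: "'a sample"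
  assumes wf: "well_formed S" and part: "clusters_partition S"
begin

abbreviation "n \<equiv> nobs S"
abbreviation "d \<equiv> dimx S"
abbreviation "m \<equiv> dimw S"
abbreviation "\<Omega> \<equiv> space (Pr S)"

definition cof :: "nat \<Rightarrow> nat" where
  "cof i = (THE g. g < ncl S \<and> i \<in> cl S g)"

definition pairs :: "(nat \<times> nat) set" where
  "pairs = {(i, j). i < n \<and> j < n \<and> cof i = cof j}"

text \<open>Clusters are disjoint, so a triple is determined by its two indices, and sums over
  triples become sums over \<open>pairs\<close>.\<close>

definition triple :: "nat \<times> nat \<Rightarrow> nat \<times> nat \<times> nat" where
  "triple p = (cof (fst p), fst p, snd p)"

lemma cl_subset: "g < ncl S \<Longrightarrow> cl S g \<subseteq> {..<n}"
  using part unfolding clusters_partition_def partition_on_def by blast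

lemma cl_disjoint: "g < ncl S \<Longrightarrow> h < ncl S \<Longrightarrow> i \<in> cl S g \<Longrightarrow> i \<in> cl S h \<Longrightarrow> g = h"
  using part partition_onD2[of "{..<n}" "cl S ` {..<ncl S}"]
  unfolding clusters_partition_def disjoint_def inj_on_def
  by (metis Int_iff empty_iff imageI lessThan_iff)

lemma cof_eq: "g < ncl S \<Longrightarrow> i \<in> cl S g \<Longrightarrow> cof i = g"
  unfolding cof_def by (rule the_equality) (auto intro: cl_disjoint)

lemma cof: assumes "i < n" shows "cof i < ncl S" "i \<in> cl S (cof i)"
proof -
  obtain g where "g < ncl S" "i \<in> cl S g"
    using part assms unfolding clusters_partition_def partition_on_def by blast
  then show "cof i < ncl S" "i \<in> cl S (cof i)" using cof_eq by auto
qed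

lemma cl_eq: "g < ncl S \<Longrightarrow> cl S g = {i\<in>{..<n}. cof i = g}"
  using cl_subset cof cof_eq by auto

lemma finite_cl: "g < ncl S \<Longrightarrow> finite (cl S g)"
  by (rule finite_subset[OF cl_subset]) auto

lemma pairs_cl: "(i, j) \<in> pairs \<longleftrightarrow> (\<exists>g<ncl S. i \<in> cl S g \<and> j \<in> cl S g)"
proof
  assume "(i, j) \<in> pairs"
  then have "i < n" "j < n" "cof i = cof j" unfolding pairs_def by auto
  then show "\<exists>g<ncl S. i \<in> cl S g \<and> j \<in> cl S g" using cof[of i] cof[of j] by auto
next
  assume "\<exists>g<ncl S. i \<in> cl S g \<and> j \<in> cl S g"
  then obtain g where g: "g < ncl S" "i \<in> cl S g" "j \<in> cl S g" by auto
  then show "(i, j) \<in> pairs" using cof_eq[OF g(1)] cl_subset[OF g(1)] unfolding pairs_def by auto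
qed

lemma set_triples_image: "set (triples S) = triple ` pairs"
  unfolding set_triples[OF part] using cof_eq pairs_cl
  by (fastforce simp: triple_def image_iff)

lemma inj_triple: "inj_on triple pairs"
  unfolding inj_on_def triple_def by (auto simp: prod_eq_iff)

lemma sum_pairs:
  "(\<Sum>g<ncl S. \<Sum>i\<in>cl S g. \<Sum>j\<in>cl S g. f g i j) = (\<Sum>p\<in>pairs. f (cof (fst p)) (fst p) (snd p))"
proof -
  have "(\<Sum>g<ncl S. \<Sum>i\<in>cl S g. \<Sum>j\<in>cl S g. f g i j)
      = (\<Sum>x\<in>(SIGMA g:{..<ncl S}. cl S g \<times> cl S g). f (fst x) (fst (snd x)) (snd (snd x)))"
    using finite_cl by (simp add: sum.cartesian_product sum.Sigma split_beta)
  also have "\<dots> = (\<Sum>p\<in>pairs. f (cof (fst p)) (fst p) (snd p))"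
    by (rule sum.reindex_bij_witness[of _ triple snd])
       (use cof_eq cof pairs_cl in \<open>auto simp: triple_def pairs_def\<close>)
  finally show ?thesis .
qed

text \<open>The length of the list, a sum of squared cluster sizes, equals the number of its
  elements.\<close>

lemma distinct_triples: "distinct (triples S)"
proof -
  have "length (triples S) = card (SIGMA g:{..<ncl S}. cl S g \<times> cl S g)"
    using finite_cl by (simp add: length_triples card_cartesian_product power2_eq_square)
  also have "(SIGMA g:{..<ncl S}. cl S g \<times> cl S g) = set (triples S)"
    unfolding set_triples[OF part] by auto
  finally show ?thesis by (simp add: card_distinct)
qed

lemma triple_pos_nth: "q < length (triples S) \<Longrightarrow> triple_pos S (triples S ! q) = q"
  unfolding triple_pos_def using distinct_triples by (auto simp: nth_eq_iff_index_eq)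

lemma triple_pos:
  assumes "t \<in> set (triples S)" shows "triple_pos S t < length (triples S)" "triples S ! triple_pos S t = t"
  using assms triple_pos_nth by (auto simp: in_set_conv_nth)

lemma sum_triple_positions:
  "(\<Sum>q<length (triples S). f q) = (\<Sum>p\<in>pairs. f (triple_pos S (triple p)))"
proof -
  have "(\<Sum>q<length (triples S). f q) = (\<Sum>t\<in>set (triples S). f (triple_pos S t))"
    by (rule sum.reindex_bij_witness[of _ "triple_pos S" "\<lambda>q. triples S ! q"])
       (auto simp: triple_pos triple_pos_nth)
  also have "\<dots> = (\<Sum>p\<in>pairs. f (triple_pos S (triple p)))"
    unfolding set_triples_image by (simp add: sum.reindex[OF inj_triple])
  finally show ?thesis .
qed

lemma within_cluster_pairs:
  assumes "\<And>g. g < ncl S \<Longrightarrow> card (cl S g) \<le> c"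
  shows "within_cluster_pairs n pairs c"
proof
  fix i assume i: "i < n"
  have "{j\<in>{..<n}. (i, j) \<in> pairs} = cl S (cof i)"
    using i cof[OF i] cl_eq by (auto simp: pairs_def)
  then show "card {j\<in>{..<n}. (i, j) \<in> pairs} \<le> c" using assms cof[OF i] by simp
qed (auto simp: pairs_def)

subsection \<open>The selected Kronecker product\<close>

definition MM :: "'a \<Rightarrow> nat \<Rightarrow> nat \<Rightarrow> real" where
  "MM \<omega> i j = annihilator S \<omega> $$ (i, j)"

lemma selected_kronecker_carrier:
  "selected_kronecker S \<omega> \<in> carrier_mat (length (triples S)) (length (triples S))"
  unfolding selected_kronecker_def selection_def by (intro carrier_matI) auto

text \<open>Under column stacking the entry \<open>(i, j)\<close> sits at position
  \<open>j * n + i\<close>, whose remainder and quotient by \<open>n\<close> return \<open>i\<close>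
  and \<open>j\<close>. Each column of the selection matrix has a single 1, so both products merely
  pick a position.\<close>

lemma selected_kronecker_index:
  assumes "p \<in> pairs" "q \<in> pairs"
  shows "selected_kronecker S \<omega> $$ (triple_pos S (triple p), triple_pos S (triple q))
    = MM \<omega> (fst p) (fst q) * MM \<omega> (snd p) (snd q)"
proof -
  let ?L = "length (triples S)"
  let ?K = "kronecker (annihilator S \<omega>) (annihilator S \<omega>)"
  have t: "triple_pos S (triple r) < ?L" "triples S ! triple_pos S (triple r) = triple r" if "r \<in> pairs" for r
    using that triple_pos[of "triple r"] set_triples_image by auto
  have K: "?K \<in> carrier_mat (n * n) (n * n)" unfolding kronecker_def annihilator_def by simp
  have sel: "selection S \<in> carrier_mat (n * n) ?L" unfolding selection_def by simp
  have lt: "snd r * n + fst r < n * n" if "r \<in> pairs" for r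
  proof -
    have r: "fst r < n" "snd r < n" using that unfolding pairs_def by auto
    then have "Suc (snd r) * n \<le> n * n" by (intro mult_right_mono) auto
    then show ?thesis using r by simp
  qed
  have S: "selection S $$ (x, triple_pos S (triple r)) = (if x = snd r * n + fst r then 1 else 0)"
    if "x < n * n" "r \<in> pairs" for x r
    using t[OF that(2)] that unfolding selection_def by (simp add: triple_def split_beta)
  have KS: "(?K * selection S) $$ (x, triple_pos S (triple q)) = ?K $$ (x, snd q * n + fst q)" if "x < n * n" for x
    unfolding mult_mat_index_sum[OF K sel that t(1)[OF assms(2)]]
    using S[OF _ assms(2)] lt[OF assms(2)] by (simp add: if_distrib[of "\<lambda>x. _ * x"] cong: if_cong)
  have "selected_kronecker S \<omega> $$ (triple_pos S (triple p), triple_pos S (triple q))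
      = (transpose_mat (selection S) * (?K * selection S)) $$ (triple_pos S (triple p), triple_pos S (triple q))"
    unfolding selected_kronecker_def using K sel by (simp add: assoc_mult_mat[of _ ?L "n*n" _ "n*n" _ ?L])
  also have "\<dots> = (\<Sum>x<n*n. transpose_mat (selection S) $$ (triple_pos S (triple p), x) * (?K * selection S) $$ (x, triple_pos S (triple q)))"
    by (rule mult_mat_index_sum[of _ ?L _ _ ?L]) (use K sel t assms in auto)
  also have "\<dots> = (\<Sum>x<n*n. (if x = snd p * n + fst p then 1 else 0) * ?K $$ (x, snd q * n + fst q))"
    using KS S[OF _ assms(1)] sel t(1)[OF assms(1)] by (intro sum.cong refl) auto
  also have "\<dots> = ?K $$ (snd p * n + fst p, snd q * n + fst q)"
    using lt[OF assms(1)] by (simp add: if_distrib[of "\<lambda>x. x * _"] cong: if_cong)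
  also have "\<dots> = MM \<omega> (fst p) (fst q) * MM \<omega> (snd p) (snd q)"
    using lt[OF assms(1)] lt[OF assms(2)] assms
    unfolding kronecker_def annihilator_def MM_def by (simp add: pairs_def split_beta)
  finally show ?thesis .
qed

definition \<kappa> :: "'a \<Rightarrow> nat \<times> nat \<Rightarrow> nat \<times> nat \<Rightarrow> real" where
  "\<kappa> \<omega> p q = kappa_CR S \<omega> (triple p) (triple q)"

lemma Sigma_hat_CR_index:
  assumes "a < d" "b < d"
  shows "Sigma_hat_CR S \<omega> $$ (a, b) = (1 / n) * (\<Sum>p\<in>pairs. \<Sum>q\<in>pairs.
    \<kappa> \<omega> p q * (v_hat S (fst p) \<omega> $ a * v_hat S (snd p) \<omega> $ b) * u_hat S (fst q) \<omega> * u_hat S (snd q) \<omega>)"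
proof -
  let ?f = "\<lambda>g1 i1 j1 g2 i2 j2. kappa_CR S \<omega> (g1, i1, j1) (g2, i2, j2) *
        (v_hat S i1 \<omega> $ a * v_hat S j1 \<omega> $ b) * u_hat S i2 \<omega> * u_hat S j2 \<omega>"
  have "(\<Sum>g1<ncl S. \<Sum>g2<ncl S. \<Sum>i1\<in>cl S g1. \<Sum>j1\<in>cl S g1. \<Sum>i2\<in>cl S g2. \<Sum>j2\<in>cl S g2. ?f g1 i1 j1 g2 i2 j2)
      = (\<Sum>g1<ncl S. \<Sum>i1\<in>cl S g1. \<Sum>j1\<in>cl S g1. \<Sum>g2<ncl S. \<Sum>i2\<in>cl S g2. \<Sum>j2\<in>cl S g2. ?f g1 i1 j1 g2 i2 j2)"
    by (rule sum.cong[OF refl], subst sum.swap, rule sum.cong[OF refl], rule sum.swap)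
  also have "\<dots> = (\<Sum>p\<in>pairs. \<Sum>q\<in>pairs. ?f (cof (fst p)) (fst p) (snd p) (cof (fst q)) (fst q) (snd q))"
    by (simp only: sum_pairs)
  finally show ?thesis using assms unfolding Sigma_hat_CR_def \<kappa>_def triple_def by simp
qed

lemma kappa_CR_norm_eq:
  "kappa_CR_norm S \<omega> = (MAX p\<in>pairs. \<Sum>q\<in>pairs. \<bar>\<kappa> \<omega> p q\<bar>)"
  unfolding kappa_CR_norm_def set_triples_image image_image sum_pairs \<kappa>_def triple_def ..

lemma finite_pairs: "finite pairs"
  by (rule finite_subset[of _ "{..<n} \<times> {..<n}"]) (auto simp: pairs_def)

subsection \<open>The annihilator matrix\<close>

context
  fixes \<omega> :: 'a
  assumes \<omega>: "\<omega> \<in> \<Omega>"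
begin

lemma w_carrier: "i < n \<Longrightarrow> wv S i \<omega> \<in> carrier_vec m"
  using wf \<omega> unfolding well_formed_def by blast

lemma x_carrier: "i < n \<Longrightarrow> xv S i \<omega> \<in> carrier_vec d"
  using wf \<omega> unfolding well_formed_def by blast

lemma MM_index:
  assumes "i < n" "j < n"
  shows "MM \<omega> i j = (if i = j then 1 else 0) -
    (\<Sum>a<m. \<Sum>b<m. wv S i \<omega> $ a * (mat_inv (gram_w S \<omega>) $$ (a, b) * wv S j \<omega> $ b))"
proof -
  let ?J = "mat_inv (gram_w S \<omega>)"
  have J: "?J \<in> carrier_mat m m" unfolding gram_w_def by (rule mat_inv_carrier[OF gram_carrier])
  have "wv S i \<omega> \<bullet> (?J *\<^sub>v wv S j \<omega>) = (\<Sum>a<m. wv S i \<omega> $ a * (?J *\<^sub>v wv S j \<omega>) $ a)"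
    using J by (simp add: scalar_prod_def atLeast0LessThan)
  also have "\<dots> = (\<Sum>a<m. \<Sum>b<m. wv S i \<omega> $ a * (?J $$ (a, b) * wv S j \<omega> $ b))"
    using mult_mat_vec_index_sum[OF J w_carrier[OF assms(2)]] by (simp add: sum_distrib_left)
  finally show ?thesis using assms unfolding MM_def annihilator_def by simp
qed

context
  assumes det: "det (gram_w S \<omega>) \<noteq> 0"
begin

lemma MM_w: assumes "i < n" "c < m" shows "(\<Sum>j<n. MM \<omega> i j * wv S j \<omega> $ c) = 0"
proof -
  let ?G = "\<lambda>a b. gram_w S \<omega> $$ (a, b)" and ?J = "\<lambda>a b. mat_inv (gram_w S \<omega>) $$ (a, b)"
  let ?w = "\<lambda>i a. wv S i \<omega> $ a"
  have "(\<Sum>j<n. (\<Sum>a<m. \<Sum>b<m. ?w i a * (?J a b * ?w j b)) * ?w j c)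
      = (\<Sum>j<n. \<Sum>a<m. \<Sum>b<m. ?w i a * (?J a b * (?w j b * ?w j c)))"
    by (simp add: sum_distrib_right mult.assoc)
  also have "\<dots> = (\<Sum>a<m. \<Sum>b<m. \<Sum>j<n. ?w i a * (?J a b * (?w j b * ?w j c)))"
    by (subst sum.swap, rule sum.cong[OF refl], rule sum.swap)
  also have "\<dots> = (\<Sum>a<m. ?w i a * (\<Sum>b<m. ?J a b * ?G b c))"
    using assms(2) unfolding gram_w_def by (simp add: gram_index sum_distrib_left)
  also have "\<dots> = (\<Sum>a<m. ?w i a * (if a = c then 1 else 0))"
    using mat_inv_mult_index(2)[OF gram_carrier det[unfolded gram_w_def] _ assms(2)]
    unfolding gram_w_def by simp
  also have "\<dots> = ?w i c" using assms(2) by (rule sum_if_eq_lessThan)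
  finally have "(\<Sum>j<n. (\<Sum>a<m. \<Sum>b<m. ?w i a * (?J a b * ?w j b)) * ?w j c) = ?w i c" .
  then show ?thesis using assms(1)
    by (simp add: MM_index left_diff_distrib sum_subtractf if_distrib[of "\<lambda>x. x * _"] cong: if_cong)
qed

lemma MM_sym: assumes "i < n" "j < n" shows "MM \<omega> i j = MM \<omega> j i"
proof -
  let ?J = "\<lambda>a b. mat_inv (gram_w S \<omega>) $$ (a, b)"
  have "?J a b = ?J b a" if "a < m" "b < m" for a b
    by (rule mat_inv_symmetric[OF _ det])
       (use that in \<open>auto simp: gram_w_def gram_index mult.commute intro: gram_carrier\<close>)
  then have "(\<Sum>a<m. \<Sum>b<m. wv S i \<omega> $ a * (?J a b * wv S j \<omega> $ b))
      = (\<Sum>b<m. \<Sum>a<m. wv S j \<omega> $ b * (?J b a * wv S i \<omega> $ a))"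
    by (subst sum.swap) (intro sum.cong refl, simp add: ac_simps)
  then show ?thesis using assms by (simp add: MM_index)
qed

text \<open>A column of \<open>MM\<close> is a unit vector minus a linear function of the
  \<open>w\<close>, and the latter is annihilated by \<open>MM_w\<close>.\<close>

lemma MM_idem: assumes "i < n" "j < n" shows "(\<Sum>k<n. MM \<omega> i k * MM \<omega> k j) = MM \<omega> i j"
proof -
  let ?y = "\<lambda>a. \<Sum>b<m. mat_inv (gram_w S \<omega>) $$ (a, b) * wv S j \<omega> $ b"
  have "(\<Sum>k<n. MM \<omega> i k * MM \<omega> k j)
      = (\<Sum>k<n. MM \<omega> i k * (if k = j then 1 else 0) - MM \<omega> i k * (\<Sum>a<m. wv S k \<omega> $ a * ?y a))"
    using assms by (intro sum.cong refl) (simp add: MM_index[of _ j] sum_distrib_left right_diff_distrib)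
  also have "\<dots> = MM \<omega> i j - (\<Sum>k<n. \<Sum>a<m. (MM \<omega> i k * wv S k \<omega> $ a) * ?y a)"
    using assms by (simp add: sum_subtractf sum_if_eq_lessThan sum_distrib_left mult.assoc)
  also have "(\<Sum>k<n. \<Sum>a<m. (MM \<omega> i k * wv S k \<omega> $ a) * ?y a)
      = (\<Sum>a<m. (\<Sum>k<n. MM \<omega> i k * wv S k \<omega> $ a) * ?y a)"
    by (subst sum.swap) (simp add: sum_distrib_right)
  also have "\<dots> = 0" using MM_w[OF assms(1)] by simp
  finally show ?thesis by simp
qed

lemma MM_projection: "orthogonal_projection n (MM \<omega>)"
  by unfold_locales (auto intro: MM_sym MM_idem)

end

lemma v_hat_index: "a < d \<Longrightarrow> v_hat S i \<omega> $ a = (\<Sum>j<n. MM \<omega> i j * xv S j \<omega> $ a)"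
  unfolding v_hat_def partial_out_def MM_def by simp

subsection \<open>Residuals\<close>

context
  fixes \<beta> \<gamma>
  assumes model: "linear_model S \<beta> \<gamma>" and det: "det (gram_w S \<omega>) \<noteq> 0"
begin

interpretation orthogonal_projection n "MM \<omega>" by (rule MM_projection[OF det])

lemma y_eq: "i < n \<Longrightarrow> yv S i \<omega> = (\<Sum>a<d. \<beta> $ a * xv S i \<omega> $ a) + (\<Sum>b<m. \<gamma> $ b * wv S i \<omega> $ b) + uv S i \<omega>"
  using model \<omega> x_carrier[of i] w_carrier[of i] unfolding linear_model_def
  by (auto simp: scalar_prod_def atLeast0LessThan)

lemma v_hat_w: assumes "a < d" "b < m" shows "(\<Sum>i<n. v_hat S i \<omega> $ a * wv S i \<omega> $ b) = 0"
proof -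
  have "(\<Sum>i<n. v_hat S i \<omega> $ a * wv S i \<omega> $ b) = (\<Sum>i<n. \<Sum>j<n. xv S j \<omega> $ a * (MM \<omega> j i * wv S i \<omega> $ b))"
    using assms sym by (simp add: v_hat_index sum_distrib_left sum_distrib_right ac_simps)
  also have "\<dots> = (\<Sum>j<n. xv S j \<omega> $ a * (\<Sum>i<n. MM \<omega> j i * wv S i \<omega> $ b))"
    by (subst sum.swap) (simp add: sum_distrib_left)
  also have "\<dots> = 0" using MM_w[OF det _ assms(2)] by simp
  finally show ?thesis .
qed

lemma v_hat_x: assumes "a < d" "b < d"
  shows "(\<Sum>i<n. v_hat S i \<omega> $ a * xv S i \<omega> $ b) = (\<Sum>i<n. v_hat S i \<omega> $ a * v_hat S i \<omega> $ b)"
  using assms inner_projection[of "\<lambda>i. xv S i \<omega> $ b" "\<lambda>i. xv S i \<omega> $ a"]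
  by (simp add: v_hat_index mult.commute)

definition \<delta> :: "nat \<Rightarrow> real" where "\<delta> a = beta_hat S \<omega> $ a - \<beta> $ a"

lemma u_hat_eq:
  assumes "i < n"
  shows "u_hat S i \<omega> = (\<Sum>k<n. MM \<omega> i k * uv S k \<omega>) - (\<Sum>a<d. \<delta> a * v_hat S i \<omega> $ a)"
proof -
  have "yv S j \<omega> - beta_hat S \<omega> \<bullet> xv S j \<omega>
     = uv S j \<omega> + (\<Sum>b<m. \<gamma> $ b * wv S j \<omega> $ b) - (\<Sum>a<d. \<delta> a * xv S j \<omega> $ a)" if "j < n" for j
  proof -
    have "beta_hat S \<omega> \<bullet> xv S j \<omega> = (\<Sum>a<d. beta_hat S \<omega> $ a * xv S j \<omega> $ a)"
      using x_carrier[OF that] by (simp add: scalar_prod_def atLeast0LessThan)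
    then show ?thesis using y_eq[OF that]
      by (simp add: \<delta>_def left_diff_distrib sum_subtractf)
  qed
  then have "u_hat S i \<omega> = (\<Sum>j<n. MM \<omega> i j * (uv S j \<omega> + (\<Sum>b<m. \<gamma> $ b * wv S j \<omega> $ b) - (\<Sum>a<d. \<delta> a * xv S j \<omega> $ a)))"
    unfolding u_hat_def MM_def by simp
  also have "\<dots> = (\<Sum>j<n. MM \<omega> i j * uv S j \<omega>)
      + (\<Sum>j<n. \<Sum>b<m. \<gamma> $ b * (MM \<omega> i j * wv S j \<omega> $ b)) - (\<Sum>j<n. \<Sum>a<d. \<delta> a * (MM \<omega> i j * xv S j \<omega> $ a))"
    by (simp add: right_diff_distrib distrib_left sum.distrib sum_subtractf sum_distrib_left ac_simps)
  also have "(\<Sum>j<n. \<Sum>b<m. \<gamma> $ b * (MM \<omega> i j * wv S j \<omega> $ b)) = (\<Sum>b<m. \<gamma> $ b * (\<Sum>j<n. MM \<omega> i j * wv S j \<omega> $ b))"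
    by (subst sum.swap) (simp add: sum_distrib_left)
  also have "\<dots> = 0" using MM_w[OF det assms] by simp
  also have "(\<Sum>j<n. \<Sum>a<d. \<delta> a * (MM \<omega> i j * xv S j \<omega> $ a)) = (\<Sum>a<d. \<delta> a * v_hat S i \<omega> $ a)"
    by (subst sum.swap) (simp add: sum_distrib_left v_hat_index)
  finally show ?thesis by simp
qed

text \<open>The bound \<open>pd\<close> excludes a null vector of the Gram matrix of
  \<open>v_hat\<close>, so \<open>beta_hat\<close> solves the sample normal equations. Inserting the
  model leaves only the errors, because \<open>v_hat\<close> is orthogonal to \<open>w\<close> and
  has the same inner products with \<open>x\<close> as with itself.\<close>

lemma normal_equations:
  fixes \<Lambda> :: real
  assumes pd: "\<And>x :: nat \<Rightarrow> real. (\<Sum>a<d. (x a)\<^sup>2) \<le> \<Lambda> * (\<Sum>i<n. (\<Sum>a<d. v_hat S i \<omega> $ a * x a)\<^sup>2)"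
    and a: "a < d"
  shows "(\<Sum>b<d. (\<Sum>i<n. v_hat S i \<omega> $ a * v_hat S i \<omega> $ b) * \<delta> b) = (\<Sum>i<n. v_hat S i \<omega> $ a * uv S i \<omega>)"
proof -
  let ?v = "\<lambda>i a. v_hat S i \<omega> $ a"
  let ?G = "gram d n (\<lambda>i. v_hat S i \<omega>)"
  let ?r = "\<lambda>a. \<Sum>i<n. ?v i a * yv S i \<omega>"
  have G: "?G \<in> carrier_mat d d" by (rule gram_carrier)
  have dG: "det ?G \<noteq> 0"
  proof
    assume "det ?G = 0"
    then obtain x where x: "x \<in> carrier_vec d" "x \<noteq> 0\<^sub>v d" "?G *\<^sub>v x = 0\<^sub>v d"
      using det_0_iff_vec_prod_zero[OF G] by auto
    have Gx: "(\<Sum>b<d. (\<Sum>i<n. ?v i a * ?v i b) * x $ b) = 0" if "a < d" for a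
    proof -
      have "(\<Sum>b<d. ?G $$ (a, b) * x $ b) = 0"
        using mult_mat_vec_index_sum[OF G x(1) that] x(3) that by simp
      then show ?thesis using that by (simp add: gram_index)
    qed
    have "(\<Sum>i<n. (\<Sum>a<d. ?v i a * x $ a)\<^sup>2) = (\<Sum>i<n. \<Sum>a<d. \<Sum>b<d. x $ a * (?v i a * ?v i b * x $ b))"
      unfolding power2_eq_square sum_product by (simp add: ac_simps)
    also have "\<dots> = (\<Sum>a<d. \<Sum>b<d. \<Sum>i<n. x $ a * (?v i a * ?v i b * x $ b))"
      by (subst sum.swap, rule sum.cong[OF refl], rule sum.swap)
    also have "\<dots> = (\<Sum>a<d. x $ a * (\<Sum>b<d. (\<Sum>i<n. ?v i a * ?v i b) * x $ b))"
      by (simp add: sum_distrib_left sum_distrib_right)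
    also have "\<dots> = 0" using Gx by simp
    finally have "(\<Sum>a<d. (x $ a)\<^sup>2) \<le> 0" using pd[of "\<lambda>a. x $ a"] by simp
    then have "(\<Sum>a<d. (x $ a)\<^sup>2) = 0" by (intro antisym sum_nonneg) auto
    then have "\<forall>a<d. x $ a = 0" by (simp add: sum_nonneg_eq_0_iff)
    then have "x = 0\<^sub>v d" using x(1) by (intro eq_vecI) auto
    then show False using x(2) by simp
  qed
  have bh: "beta_hat S \<omega> $ c = (\<Sum>b<d. mat_inv ?G $$ (c, b) * ?r b)" if "c < d" for c
    unfolding beta_hat_def
    by (subst mult_mat_vec_index_sum[OF mat_inv_carrier[OF G] _ that]) auto
  have "(\<Sum>c<d. ?G $$ (a, c) * beta_hat S \<omega> $ c) = (\<Sum>c<d. \<Sum>b<d. ?G $$ (a, c) * mat_inv ?G $$ (c, b) * ?r b)"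
    by (simp add: bh sum_distrib_left mult.assoc)
  also have "\<dots> = (\<Sum>b<d. (\<Sum>c<d. ?G $$ (a, c) * mat_inv ?G $$ (c, b)) * ?r b)"
    by (subst sum.swap) (simp add: sum_distrib_right)
  also have "\<dots> = ?r a"
    using mat_inv_mult_index(1)[OF G dG a] a by (simp add: if_distrib[of "\<lambda>x. x * _"] cong: if_cong)
  finally have 1: "(\<Sum>b<d. (\<Sum>i<n. ?v i a * ?v i b) * beta_hat S \<omega> $ b) = ?r a"
    using a by (simp add: gram_index)
  have "?r a = (\<Sum>i<n. \<Sum>b<d. \<beta> $ b * (?v i a * xv S i \<omega> $ b)) + (\<Sum>i<n. \<Sum>b<m. \<gamma> $ b * (?v i a * wv S i \<omega> $ b))
      + (\<Sum>i<n. ?v i a * uv S i \<omega>)"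
    by (simp add: y_eq distrib_left sum.distrib sum_distrib_left ac_simps)
  also have "(\<Sum>i<n. \<Sum>b<d. \<beta> $ b * (?v i a * xv S i \<omega> $ b)) = (\<Sum>b<d. \<beta> $ b * (\<Sum>i<n. ?v i a * xv S i \<omega> $ b))"
    by (subst sum.swap) (simp add: sum_distrib_left)
  also have "\<dots> = (\<Sum>b<d. (\<Sum>i<n. ?v i a * ?v i b) * \<beta> $ b)"
    using v_hat_x[OF a] by (simp add: mult.commute)
  also have "(\<Sum>i<n. \<Sum>b<m. \<gamma> $ b * (?v i a * wv S i \<omega> $ b)) = (\<Sum>b<m. \<gamma> $ b * (\<Sum>i<n. ?v i a * wv S i \<omega> $ b))"
    by (subst sum.swap) (simp add: sum_distrib_left)
  also have "\<dots> = 0" using v_hat_w[OF a] by simp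
  finally show ?thesis using 1 unfolding \<delta>_def by (simp add: right_diff_distrib sum_subtractf)
qed

end

text \<open>\<open>v_pop\<close> differs from \<open>x\<close> by a linear function of
  \<open>w\<close>, which the projection annihilates. Hence \<open>v_hat\<close> is the projection
  of \<open>v_pop\<close>, and the contraction applies.\<close>

lemma v_hat_square_sum_le:
  assumes det: "det (gram_w S \<omega>) \<noteq> 0"
    and QV: "\<And>i a. i < n \<Longrightarrow> a < d \<Longrightarrow> v_pop S i \<omega> $ a = Q i a + V i a"
  shows "(\<Sum>i<n. \<Sum>a<d. (v_hat S i \<omega> $ a)\<^sup>2) \<le> 2 * (\<Sum>i<n. \<Sum>a<d. (Q i a)\<^sup>2) + 2 * (\<Sum>i<n. \<Sum>a<d. (V i a)\<^sup>2)"
proof -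
  interpret orthogonal_projection n "MM \<omega>" by (rule MM_projection[OF det])
  let ?P = "projection_coeff S"
  have P: "?P \<in> carrier_mat d m" unfolding projection_coeff_def
    by (rule mult_carrier_mat[of _ _ m]) (auto intro: mat_inv_carrier)
  have v: "v_hat S i \<omega> $ a = (\<Sum>j<n. MM \<omega> i j * v_pop S j \<omega> $ a)" if ia: "i < n" "a < d" for i a
  proof -
    have vp: "v_pop S j \<omega> $ a = xv S j \<omega> $ a - (\<Sum>b<m. ?P $$ (a, b) * wv S j \<omega> $ b)" if j: "j < n" for j
      using mult_mat_vec_index_sum[OF P w_carrier[OF j] ia(2)] P ia(2) unfolding v_pop_def by simp
    have "(\<Sum>j<n. MM \<omega> i j * v_pop S j \<omega> $ a)
        = v_hat S i \<omega> $ a - (\<Sum>j<n. \<Sum>b<m. ?P $$ (a, b) * (MM \<omega> i j * wv S j \<omega> $ b))"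
      using ia by (simp add: vp v_hat_index right_diff_distrib sum_subtractf sum_distrib_left ac_simps)
    also have "(\<Sum>j<n. \<Sum>b<m. ?P $$ (a, b) * (MM \<omega> i j * wv S j \<omega> $ b))
        = (\<Sum>b<m. ?P $$ (a, b) * (\<Sum>j<n. MM \<omega> i j * wv S j \<omega> $ b))"
      by (subst sum.swap) (simp add: sum_distrib_left)
    also have "\<dots> = 0" using MM_w[OF det ia(1)] by simp
    finally show ?thesis by simp
  qed
  have "(\<Sum>i<n. \<Sum>a<d. (v_hat S i \<omega> $ a)\<^sup>2) = (\<Sum>a<d. \<Sum>i<n. (\<Sum>j<n. MM \<omega> i j * v_pop S j \<omega> $ a)\<^sup>2)"
    by (subst sum.swap) (simp add: v)
  also have "\<dots> \<le> (\<Sum>a<d. \<Sum>i<n. (v_pop S i \<omega> $ a)\<^sup>2)" by (intro sum_mono projection_contraction)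
  also have "\<dots> \<le> (\<Sum>a<d. \<Sum>i<n. 2 * (Q i a)\<^sup>2 + 2 * (V i a)\<^sup>2)"
  proof (intro sum_mono)
    fix a i assume "a \<in> {..<d}" "i \<in> {..<n}"
    moreover have "0 \<le> (Q i a - V i a)\<^sup>2" by simp
    ultimately show "(v_pop S i \<omega> $ a)\<^sup>2 \<le> 2 * (Q i a)\<^sup>2 + 2 * (V i a)\<^sup>2"
      by (simp add: QV power2_diff power2_sum)
  qed
  also have "\<dots> = 2 * (\<Sum>i<n. \<Sum>a<d. (Q i a)\<^sup>2) + 2 * (\<Sum>i<n. \<Sum>a<d. (V i a)\<^sup>2)"
    by (subst sum.swap) (simp add: sum.distrib sum_distrib_left)
  finally show ?thesis .
qed

text \<open>Positions in \<open>triples\<close> correspond one to one to \<open>pairs\<close>, which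
  turns the matrix identities for the inverse into identities for sums over \<open>pairs\<close>.
  The symmetry of \<kappa> is inherited from that of the annihilator.\<close>

lemma kappa_kappa:
  assumes det: "det (gram_w S \<omega>) \<noteq> 0" and dK: "det (selected_kronecker S \<omega>) \<noteq> 0"
    and c: "\<And>g. g < ncl S \<Longrightarrow> card (cl S g) \<le> c"
    and \<kappa>b: "kappa_CR_norm S \<omega> \<le> \<kappa>b" "\<kappa>b \<ge> 0"
  shows "cluster_kappa n (MM \<omega>) pairs c (\<kappa> \<omega>) \<kappa>b"
proof -
  interpret orthogonal_projection n "MM \<omega>" by (rule MM_projection[OF det])
  interpret within_cluster_pairs n pairs c by (rule within_cluster_pairs[OF c])
  let ?K = "selected_kronecker S \<omega>" and ?pos = "\<lambda>p. triple_pos S (triple p)"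
  let ?L = "length (triples S)"
  have pos: "?pos p < ?L" if "p \<in> pairs" for p
    using that triple_pos[of "triple p"] set_triples_image by auto
  have pos_inj: "p = q" if "p \<in> pairs" "q \<in> pairs" "?pos p = ?pos q" for p q
    using that triple_pos(2)[of "triple p"] triple_pos(2)[of "triple q"] set_triples_image inj_triple
    by (metis imageI inj_on_def)
  show ?thesis
  proof
    show "(\<Sum>r\<in>pairs. \<kappa> \<omega> p r * (MM \<omega> (fst r) (fst q) * MM \<omega> (snd r) (snd q))) = (if p = q then 1 else 0)"
      if pq: "p \<in> pairs" "q \<in> pairs" for p q
    proof -
      have "(\<Sum>r\<in>pairs. \<kappa> \<omega> p r * (MM \<omega> (fst r) (fst q) * MM \<omega> (snd r) (snd q)))
          = (\<Sum>x<?L. mat_inv ?K $$ (?pos p, x) * ?K $$ (x, ?pos q))"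
        unfolding sum_triple_positions using pq
        by (intro sum.cong refl) (simp add: \<kappa>_def kappa_CR_def selected_kronecker_index)
      also have "\<dots> = (if ?pos p = ?pos q then 1 else 0)"
        by (rule mat_inv_mult_index(2)[OF selected_kronecker_carrier dK pos[OF pq(1)] pos[OF pq(2)]])
      finally show ?thesis using pos_inj[OF pq] by auto
    qed
    have surj: "\<exists>p\<in>pairs. x = ?pos p" if "x < ?L" for x
    proof -
      have "triples S ! x \<in> triple ` pairs" using that set_triples_image by (metis nth_mem)
      then show ?thesis using triple_pos_nth[OF that] by force
    qed
    have Ksym: "?K $$ (x, y) = ?K $$ (y, x)" if xy: "x < ?L" "y < ?L" for x y
    proof -
      obtain p q where pq: "p \<in> pairs" "q \<in> pairs" "x = ?pos p" "y = ?pos q" using surj xy by meson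
      then have "fst p < n" "snd p < n" "fst q < n" "snd q < n" unfolding pairs_def by auto
      then show ?thesis using pq sym[of "fst p" "fst q"] sym[of "snd p" "snd q"]
        by (simp add: selected_kronecker_index)
    qed
    show "\<kappa> \<omega> p q = \<kappa> \<omega> q p" if "p \<in> pairs" "q \<in> pairs" for p q
      unfolding \<kappa>_def kappa_CR_def
      by (rule mat_inv_symmetric[OF selected_kronecker_carrier dK Ksym]) (use pos that in auto)
    show "(\<Sum>q\<in>pairs. \<bar>\<kappa> \<omega> p q\<bar>) \<le> \<kappa>b" if "p \<in> pairs" for p
    proof -
      have "(\<Sum>q\<in>pairs. \<bar>\<kappa> \<omega> p q\<bar>) \<le> kappa_CR_norm S \<omega>"
        unfolding kappa_CR_norm_eq using that finite_pairs by (intro Max_ge finite_imageI imageI)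
      then show ?thesis using \<kappa>b(1) by linarith
    qed
  qed fact
qed

end

end

section \<open>Clustered errors given the regressors\<close>

lemma space_generated_by: "space (generated_by P F) = space P"
  unfolding generated_by_def by (auto simp: space_measure_of_conv)

lemma sets_generated_by:
  "sets (generated_by P F) = sigma_sets (space P) {f -` B \<inter> space P | f B. f \<in> F \<and> B \<in> sets borel}"
  unfolding generated_by_def by (rule sets_measure_of) auto

lemma generated_by_measurable: "f \<in> F \<Longrightarrow> f \<in> borel_measurable (generated_by P F)"
proof (rule measurableI)
  fix A :: "real set" assume "f \<in> F" "A \<in> sets borel"
  then show "f -` A \<inter> space (generated_by P F) \<in> sets (generated_by P F)"
    unfolding sets_generated_by space_generated_by by (intro sigma_sets.Basic) auto
qed simp

lemma subalgebra_generated_by: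
  assumes "space N = space P" "\<And>f. f \<in> F \<Longrightarrow> f \<in> borel_measurable N"
  shows "subalgebra N (generated_by P F)"
  unfolding subalgebra_def
proof
  show "sets (generated_by P F) \<subseteq> sets N"
    unfolding sets_generated_by assms(1)[symmetric]
    by (rule sets.sigma_sets_subset) (use assms(2) in \<open>auto intro: measurable_sets\<close>)
qed (simp add: assms(1) space_generated_by)

lemma subalgebra_generated_by_mono: "F \<subseteq> F' \<Longrightarrow> subalgebra (generated_by P F') (generated_by P F)"
  by (rule subalgebra_generated_by) (auto simp: space_generated_by intro: generated_by_measurable)

lemma subalgebra_sigma:
  assumes "X \<subseteq> Pow \<Omega>" "space F = \<Omega>" "sets F \<subseteq> X"
  shows "subalgebra (sigma \<Omega> X) F"
  unfolding subalgebra_def using assms by (auto simp: space_measure_of_conv intro: sigma_sets.Basic)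

lemma Int_finite_INT:
  assumes "\<Omega> \<in> sets N" "finite I" "\<And>i. i \<in> I \<Longrightarrow> B i \<in> sets N"
  shows "\<Omega> \<inter> (\<Inter>i\<in>I. B i) \<in> sets N"
proof (cases "I = {}")
  case False
  then show ?thesis using assms by (intro sets.Int sets.finite_INT)
qed (use assms in simp)

locale clustered_row = sample_row S for S :: "'a sample" +
  fixes c :: nat
  assumes indep: "cond_indep_sets (Pr S) (sigma_W S) (\<lambda>g. sets (sigma_cluster S g)) {..<ncl S}"
    and mean_zero: "\<And>i. i < n \<Longrightarrow> AE \<omega> in Pr S. real_cond_exp (Pr S) (sigma_XW S) (uv S i) \<omega> = 0"
    and cluster_card: "\<And>g. g < ncl S \<Longrightarrow> card (cl S g) \<le> c"
begin

sublocale prob_space "Pr S" using wf unfolding well_formed_def by blast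

section \<open>The generated \<sigma>-algebras and the leave-one-out property of a cluster\<close>

lemma u_integrable: "i < n \<Longrightarrow> integrable (Pr S) (uv S i)"
  and x_integrable: "i < n \<Longrightarrow> a < d \<Longrightarrow> integrable (Pr S) (\<lambda>\<omega>. xv S i \<omega> $ a)"
  and w_measurable: "i < n \<Longrightarrow> b < m \<Longrightarrow> (\<lambda>\<omega>. wv S i \<omega> $ b) \<in> borel_measurable (Pr S)"
  and ww_integrable: "i < n \<Longrightarrow> a < m \<Longrightarrow> b < m \<Longrightarrow> integrable (Pr S) (\<lambda>\<omega>. wv S i \<omega> $ a * wv S i \<omega> $ b)"
  using wf unfolding well_formed_def by blast+

lemma u_measurable[measurable]: "i < n \<Longrightarrow> uv S i \<in> borel_measurable (Pr S)"
  using u_integrable by auto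

lemma x_measurable: "i < n \<Longrightarrow> a < d \<Longrightarrow> (\<lambda>\<omega>. xv S i \<omega> $ a) \<in> borel_measurable (Pr S)"
  using x_integrable by auto

abbreviation "J \<equiv> sigma_XW S"
abbreviation "W \<equiv> sigma_W S"

definition Wgen :: "('a \<Rightarrow> real) set" where "Wgen = {\<lambda>\<omega>. wv S i \<omega> $ b | i b. i < n \<and> b < m}"
definition Xgen :: "nat set \<Rightarrow> ('a \<Rightarrow> real) set" where "Xgen I = {\<lambda>\<omega>. xv S i \<omega> $ a | i a. i \<in> I \<and> a < d}"
definition Ugen :: "nat set \<Rightarrow> ('a \<Rightarrow> real) set" where "Ugen I = {uv S i | i. i \<in> I}"

lemma sigma_gens:
  "W = generated_by (Pr S) Wgen" "J = generated_by (Pr S) (Xgen {..<n} \<union> Wgen)"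
  "sigma_cluster S g = generated_by (Pr S) (Ugen (cl S g) \<union> Xgen (cl S g))"
  unfolding sigma_W_def sigma_XW_def sigma_cluster_def Wgen_def Xgen_def Ugen_def by auto

lemma gens_measurable:
  "f \<in> Wgen \<Longrightarrow> f \<in> borel_measurable (Pr S)"
  "I \<subseteq> {..<n} \<Longrightarrow> f \<in> Xgen I \<Longrightarrow> f \<in> borel_measurable (Pr S)"
  "I \<subseteq> {..<n} \<Longrightarrow> f \<in> Ugen I \<Longrightarrow> f \<in> borel_measurable (Pr S)"
  unfolding Wgen_def Xgen_def Ugen_def using w_measurable x_measurable u_measurable by auto

lemma subalgebra_J: "subalgebra (Pr S) J"
  unfolding sigma_gens by (rule subalgebra_generated_by) (auto intro: gens_measurable)

lemma subalgebra_W: "subalgebra (Pr S) W"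
  unfolding sigma_gens by (rule subalgebra_generated_by) (auto intro: gens_measurable)

text \<open>All regressors are included, so that every coefficient of the errors is known given
  \<open>K g\<close>, along with the errors of all clusters but \<open>g\<close>.\<close>

definition K :: "nat \<Rightarrow> 'a measure" where
  "K g = generated_by (Pr S) (Xgen {..<n} \<union> Wgen \<union> Ugen {i\<in>{..<n}. cof i \<noteq> g})"

lemma subalgebra_K: "subalgebra (Pr S) (K g)"
  unfolding K_def
  by (rule subalgebra_generated_by) (auto intro: gens_measurable gens_measurable(3)[of "{i\<in>{..<n}. cof i \<noteq> g}"])

lemma subalgebra_K_J: "subalgebra (K g) J"
  unfolding K_def sigma_gens by (rule subalgebra_generated_by_mono) auto

lemma subalgebra_cluster: "g < ncl S \<Longrightarrow> subalgebra (Pr S) (sigma_cluster S g)"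
  unfolding sigma_gens using cl_subset
  by (intro subalgebra_generated_by) (auto intro: gens_measurable(2,3))

text \<open>A \<pi>-system for the clusters other than \<open>g\<close>. The factor
  \<open>\<Omega>\<close> matters when there is only one cluster, since the empty intersection is
  \<open>UNIV\<close>.\<close>

definition rest :: "nat \<Rightarrow> 'a set set" where
  "rest g = {\<Omega> \<inter> (\<Inter>h\<in>{..<ncl S} - {g}. B h) | B. B \<in> Pi ({..<ncl S} - {g}) (\<lambda>h. sets (sigma_cluster S h))}"

lemma rest_sets: "rest g \<subseteq> events"
proof
  fix X assume "X \<in> rest g"
  then obtain B where X: "X = \<Omega> \<inter> (\<Inter>h\<in>{..<ncl S} - {g}. B h)"
      and B: "B \<in> Pi ({..<ncl S} - {g}) (\<lambda>h. sets (sigma_cluster S h))"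
    unfolding rest_def by auto
  have "B h \<in> events" if "h \<in> {..<ncl S} - {g}" for h
    using subalgebra_cluster[of h] B that unfolding subalgebra_def by blast
  then show "X \<in> events" unfolding X by (intro Int_finite_INT) auto
qed

lemma rest_space: "\<Omega> \<in> rest g"
  unfolding rest_def
  by (rule CollectI, rule exI[of _ "\<lambda>_. \<Omega>"])
     (use sets.top[of "sigma_cluster S _"] in \<open>auto simp: sigma_gens space_generated_by\<close>)

lemma rest_Int_stable: "Int_stable (rest g)"
proof (rule Int_stableI)
  fix a b assume "a \<in> rest g" "b \<in> rest g"
  then obtain A B where *: "a = \<Omega> \<inter> (\<Inter>h\<in>{..<ncl S} - {g}. A h)" "b = \<Omega> \<inter> (\<Inter>h\<in>{..<ncl S} - {g}. B h)"
    "A \<in> Pi ({..<ncl S} - {g}) (\<lambda>h. sets (sigma_cluster S h))"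
    "B \<in> Pi ({..<ncl S} - {g}) (\<lambda>h. sets (sigma_cluster S h))"
    unfolding rest_def by auto
  then show "a \<inter> b \<in> rest g"
    unfolding rest_def by (intro CollectI exI[of _ "\<lambda>h. A h \<inter> B h"]) auto
qed

lemma cluster_in_rest:
  assumes h: "h < ncl S" "h \<noteq> g" and A: "A \<in> sets (sigma_cluster S h)"
  shows "A \<in> rest g"
proof -
  have "A \<subseteq> \<Omega>" using sets.sets_into_space[OF A] by (simp add: sigma_gens space_generated_by)
  moreover have "\<Omega> \<in> sets (sigma_cluster S k)" for k
    using sets.top[of "sigma_cluster S k"] by (simp add: sigma_gens space_generated_by)
  ultimately show ?thesis
    unfolding rest_def using h A
    by (intro CollectI exI[of _ "\<lambda>k. if k = h then A else \<Omega>"]) (auto split: if_splits)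
qed

text \<open>The product formulas for the full family of clusters and for the family without
  \<open>g\<close> differ exactly by the factor of \<open>g\<close>.\<close>

lemma cond_indep_rest:
  assumes g: "g < ncl S" and A: "A \<in> sets (sigma_cluster S g)" and B: "B \<in> rest g"
  shows "AE \<omega> in Pr S. real_cond_exp (Pr S) W (indicator (A \<inter> B)) \<omega> =
    real_cond_exp (Pr S) W (indicator A) \<omega> * real_cond_exp (Pr S) W (indicator B) \<omega>"
proof -
  interpret W: sigma_finite_subalgebra "Pr S" W by (rule sigma_finite_subalgebraI[OF subalgebra_W])
  have A\<Omega>: "A \<subseteq> \<Omega>" using sets.sets_into_space[OF A] by (simp add: sigma_gens space_generated_by)
  obtain C where C: "B = \<Omega> \<inter> (\<Inter>h\<in>{..<ncl S} - {g}. C h)"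
      "C \<in> Pi ({..<ncl S} - {g}) (\<lambda>h. sets (sigma_cluster S h))"
    using B unfolding rest_def by auto
  show ?thesis
  proof (cases "{..<ncl S} - {g} = {}")
    \<comment> \<open>\<open>cond_indep_sets\<close> speaks of nonempty families only. With a single
      cluster \<open>B\<close> is the whole space, whose conditional probability is 1.\<close>
    case True
    have B: "B = \<Omega>" unfolding C(1) True by simp
    have \<Omega>W: "\<Omega> \<in> sets W" using sets.top[of W] by (simp add: sigma_gens space_generated_by)
    have "AE \<omega> in Pr S. real_cond_exp (Pr S) W (indicator \<Omega>) \<omega> = indicator \<Omega> \<omega>"
      by (rule W.real_cond_exp_F_meas) (use \<Omega>W in \<open>auto simp: emeasure_eq_measure\<close>)
    moreover have "A \<inter> B = A" using A\<Omega> B by auto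
    ultimately show ?thesis unfolding B by auto
  next
    case False
    let ?D = "\<lambda>h. if h = g then A else C h"
    have sub: "C h \<subseteq> \<Omega>" if "h \<in> {..<ncl S} - {g}" for h
    proof -
      have "C h \<in> sets (sigma_cluster S h)" using C(2) that by auto
      then show ?thesis using sets.sets_into_space by (fastforce simp: sigma_gens space_generated_by)
    qed
    have B: "B = (\<Inter>h\<in>{..<ncl S} - {g}. C h)" using sub False unfolding C(1) by blast
    have AB: "A \<inter> B = (\<Inter>h\<in>{..<ncl S}. ?D h)" unfolding B using g by (auto split: if_splits)
    have D: "?D \<in> Pi {..<ncl S} (\<lambda>h. sets (sigma_cluster S h))" using A C(2) by (auto simp: Pi_iff)
    have "AE \<omega> in Pr S. real_cond_exp (Pr S) W (indicator (A \<inter> B)) \<omega> =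
        (\<Prod>h\<in>{..<ncl S}. real_cond_exp (Pr S) W (indicator (?D h)) \<omega>)"
      unfolding AB using indep[unfolded cond_indep_sets_def, THEN conjunct2, rule_format, OF subset_refl _ _ D] g
      by auto
    moreover have "AE \<omega> in Pr S. real_cond_exp (Pr S) W (indicator B) \<omega> =
        (\<Prod>h\<in>{..<ncl S} - {g}. real_cond_exp (Pr S) W (indicator (C h)) \<omega>)"
      unfolding B using indep[unfolded cond_indep_sets_def, THEN conjunct2, rule_format, OF _ False _ C(2)]
      by auto
    moreover have "(\<Prod>h\<in>{..<ncl S}. real_cond_exp (Pr S) W (indicator (?D h)) \<omega>)
        = real_cond_exp (Pr S) W (indicator A) \<omega> * (\<Prod>h\<in>{..<ncl S} - {g}. real_cond_exp (Pr S) W (indicator (C h)) \<omega>)" for \<omega>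
      using g by (subst prod.remove[of _ g]) auto
    ultimately show ?thesis by auto
  qed
qed

text \<open>An instance of \<open>nn_cond_exp_leave_one_out\<close>. What has to be verified is that
  \<open>W\<close> and the cluster of \<open>k\<close> generate \<open>?L\<close>, and that
  \<open>?G\<close> and the other clusters generate \<open>K (cof k)\<close>.\<close>

lemma nn_cond_exp_K:
  assumes k: "k < n" and f: "f \<in> borel_measurable (generated_by (Pr S) (Ugen (cl S (cof k)) \<union> Xgen (cl S (cof k)) \<union> Wgen))"
  shows "AE \<omega> in Pr S. nn_cond_exp (Pr S) (K (cof k)) f \<omega> = nn_cond_exp (Pr S) J f \<omega>"
proof -
  let ?g = "cof k"
  note g = cof(1)[OF k]
  let ?I = "cl S ?g"
  let ?L = "generated_by (Pr S) (Ugen ?I \<union> Xgen ?I \<union> Wgen)"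
  let ?G = "generated_by (Pr S) (Xgen ?I \<union> Wgen)"
  have I: "?I \<subseteq> {..<n}" by (rule cl_subset[OF g])
  have XI: "Xgen ?I \<subseteq> Xgen {..<n}" using I unfolding Xgen_def by blast
  have LW: "subalgebra ?L W" and Lc: "subalgebra ?L (sigma_cluster S ?g)" and GW: "subalgebra ?G W"
    unfolding sigma_gens by (intro subalgebra_generated_by_mono; blast)+
  have KG: "subalgebra (K ?g) ?G" unfolding K_def by (rule subalgebra_generated_by_mono) (use XI in blast)
  show ?thesis
  proof (rule nn_cond_exp_leave_one_out[where L="?L" and G="?G" and H="W" and \<A>="sets (sigma_cluster S ?g)" and \<B>="rest ?g"])
    show "subalgebra (Pr S) ?L"
      by (rule subalgebra_generated_by) (use I in \<open>auto intro: gens_measurable\<close>)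
    show "subalgebra ?L ?G" by (rule subalgebra_generated_by_mono) blast
    show "subalgebra J ?G" unfolding sigma_gens by (rule subalgebra_generated_by_mono) (use XI in blast)
    show "sets (sigma_cluster S ?g) \<subseteq> events" using subalgebra_cluster[OF g] unfolding subalgebra_def by blast
    show "\<Omega> \<in> sets (sigma_cluster S ?g)"
      using sets.top[of "sigma_cluster S ?g"] by (simp add: sigma_gens space_generated_by)
    let ?X = "{C \<inter> A |C A. C \<in> sets W \<and> A \<in> sets (sigma_cluster S ?g)}"
    have X: "?X \<subseteq> sets ?L" using LW Lc unfolding subalgebra_def by auto
    have sp: "space ?L = \<Omega>" "\<Omega> \<in> sets W" "\<Omega> \<in> sets (sigma_cluster S ?g)"
      using sets.top[of W] sets.top[of "sigma_cluster S ?g"] by (simp_all add: sigma_gens space_generated_by)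
    have XP: "?X \<subseteq> Pow \<Omega>" using X sets.space_closed[of ?L] sp by auto
    show "sets ?L = sigma_sets \<Omega> ?X"
    proof
      show "sigma_sets \<Omega> ?X \<subseteq> sets ?L" using sets.sigma_sets_subset[OF X] sp by simp
      have "subalgebra (sigma \<Omega> ?X) ?L"
      proof (rule subalgebra_generated_by)
        show "space (sigma \<Omega> ?X) = \<Omega>" by (simp add: space_measure_of_conv)
        have W: "subalgebra (sigma \<Omega> ?X) W"
        proof (rule subalgebra_sigma[OF XP])
          show "sets W \<subseteq> ?X"
          proof
            fix A assume A: "A \<in> sets W"
            then have "A = A \<inter> \<Omega>" using sets.sets_into_space[OF A] by (auto simp: sigma_gens space_generated_by)
            then show "A \<in> ?X" using A sp(3) by blast
          qed
        qed (simp add: sigma_gens space_generated_by)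
        have C: "subalgebra (sigma \<Omega> ?X) (sigma_cluster S ?g)"
        proof (rule subalgebra_sigma[OF XP])
          show "sets (sigma_cluster S ?g) \<subseteq> ?X"
          proof
            fix A assume A: "A \<in> sets (sigma_cluster S ?g)"
            then have "A = \<Omega> \<inter> A" using sets.sets_into_space[OF A] by (auto simp: sigma_gens space_generated_by)
            then show "A \<in> ?X" using A sp(2) by blast
          qed
        qed (simp add: sigma_gens space_generated_by)
        fix f assume "f \<in> Ugen ?I \<union> Xgen ?I \<union> Wgen"
        then have "f \<in> borel_measurable (sigma_cluster S ?g) \<or> f \<in> borel_measurable W"
          unfolding sigma_gens using generated_by_measurable[of f Wgen]
            generated_by_measurable[of f "Ugen ?I \<union> Xgen ?I"] by blast
        then show "f \<in> borel_measurable (sigma \<Omega> ?X)"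
          using measurable_from_subalg[OF W, of f borel] measurable_from_subalg[OF C, of f borel] by blast
      qed
      then show "sets ?L \<subseteq> sigma_sets \<Omega> ?X" unfolding subalgebra_def using XP by simp
    qed
    let ?Y = "{C \<inter> B |C B. C \<in> sets ?G \<and> B \<in> rest ?g}"
    have restK: "rest ?g \<subseteq> sets (K ?g)"
    proof
      fix X assume "X \<in> rest ?g"
      then obtain B where X: "X = \<Omega> \<inter> (\<Inter>h\<in>{..<ncl S} - {?g}. B h)"
          and B: "B \<in> Pi ({..<ncl S} - {?g}) (\<lambda>h. sets (sigma_cluster S h))"
        unfolding rest_def by auto
      have "B h \<in> sets (K ?g)" if h: "h \<in> {..<ncl S} - {?g}" for h
      proof -
        have "subalgebra (K ?g) (sigma_cluster S h)"
          unfolding K_def sigma_gens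
          by (rule subalgebra_generated_by_mono)
             (use h cl_eq[of h] in \<open>auto simp: Ugen_def Xgen_def\<close>)
        then show ?thesis using B h unfolding subalgebra_def by blast
      qed
      moreover have "\<Omega> \<in> sets (K ?g)" using sets.top[of "K ?g"] by (simp add: K_def space_generated_by)
      ultimately show "X \<in> sets (K ?g)" unfolding X by (intro Int_finite_INT) auto
    qed
    have Y: "?Y \<subseteq> sets (K ?g)" using KG restK unfolding subalgebra_def by auto
    have spK: "space (K ?g) = \<Omega>" "\<Omega> \<in> sets ?G"
      using sets.top[of ?G] by (simp_all add: K_def space_generated_by)
    have YP: "?Y \<subseteq> Pow \<Omega>" using Y sets.space_closed[of "K ?g"] spK by auto
    show "sets (K ?g) = sigma_sets \<Omega> ?Y"
    proof
      show "sigma_sets \<Omega> ?Y \<subseteq> sets (K ?g)" using sets.sigma_sets_subset[OF Y] spK by simp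
      have "subalgebra (sigma \<Omega> ?Y) (K ?g)"
        unfolding K_def
      proof (rule subalgebra_generated_by)
        show "space (sigma \<Omega> ?Y) = \<Omega>" by (simp add: space_measure_of_conv)
        have G: "subalgebra (sigma \<Omega> ?Y) ?G"
        proof (rule subalgebra_sigma[OF YP])
          show "sets ?G \<subseteq> ?Y"
          proof
            fix A assume A: "A \<in> sets ?G"
            then have "A = A \<inter> \<Omega>" using sets.sets_into_space[OF A] by (auto simp: space_generated_by)
            then show "A \<in> ?Y" using A rest_space by blast
          qed
        qed (simp add: space_generated_by)
        have C: "subalgebra (sigma \<Omega> ?Y) (sigma_cluster S h)" if h: "h < ncl S" "h \<noteq> ?g" for h
        proof (rule subalgebra_sigma[OF YP])
          show "sets (sigma_cluster S h) \<subseteq> ?Y"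
          proof
            fix A assume A: "A \<in> sets (sigma_cluster S h)"
            then have "A = \<Omega> \<inter> A" using sets.sets_into_space[OF A] by (auto simp: sigma_gens space_generated_by)
            then show "A \<in> ?Y" using cluster_in_rest[OF h A] spK(2) by blast
          qed
        qed (simp add: sigma_gens space_generated_by)
        have Ch: "f \<in> borel_measurable (sigma \<Omega> ?Y)" if "i < n" "cof i \<noteq> ?g" "f \<in> Ugen {i} \<union> Xgen {i}" for f i
        proof -
          have "f \<in> borel_measurable (sigma_cluster S (cof i))"
            unfolding sigma_gens using that cof(2)[OF that(1)]
            by (intro generated_by_measurable) (auto simp: Ugen_def Xgen_def)
          then show ?thesis using measurable_from_subalg[OF C[OF cof(1)[OF that(1)] that(2)]] by blast
        qed
        fix f assume "f \<in> Xgen {..<n} \<union> Wgen \<union> Ugen {i \<in> {..<n}. cof i \<noteq> ?g}"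
        then consider "f \<in> Xgen ?I \<union> Wgen" | i where "i < n" "cof i \<noteq> ?g" "f \<in> Ugen {i} \<union> Xgen {i}"
          using cl_eq[OF g] unfolding Xgen_def Ugen_def by auto
        then show "f \<in> borel_measurable (sigma \<Omega> ?Y)"
        proof cases
          case 1
          show ?thesis by (rule measurable_from_subalg[OF G generated_by_measurable[OF 1]])
        next
          case 2 then show ?thesis by (rule Ch)
        qed
      qed
      then show "sets (K ?g) \<subseteq> sigma_sets \<Omega> ?Y" unfolding subalgebra_def using YP by simp
    qed
    show "AE x in Pr S. real_cond_exp (Pr S) W (indicator (A \<inter> B)) x =
        real_cond_exp (Pr S) W (indicator A) x * real_cond_exp (Pr S) W (indicator B) x"
      if "A \<in> sets (sigma_cluster S ?g)" "B \<in> rest ?g" for A B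
      by (rule cond_indep_rest[OF g that])
  qed (use f GW subalgebra_K subalgebra_K_J rest_Int_stable rest_sets rest_space sets.Int_stable in auto)
qed

lemma real_cond_exp_K:
  assumes k: "k < n" and f: "f \<in> borel_measurable (generated_by (Pr S) (Ugen (cl S (cof k)) \<union> Xgen (cl S (cof k)) \<union> Wgen))"
  shows "AE \<omega> in Pr S. real_cond_exp (Pr S) (K (cof k)) f \<omega> = real_cond_exp (Pr S) J f \<omega>"
proof -
  note [measurable] = f
  have "AE \<omega> in Pr S. nn_cond_exp (Pr S) (K (cof k)) (\<lambda>\<omega>. ennreal (f \<omega>)) \<omega> = nn_cond_exp (Pr S) J (\<lambda>\<omega>. ennreal (f \<omega>)) \<omega>"
    by (rule nn_cond_exp_K[OF k]) measurable
  moreover have "AE \<omega> in Pr S. nn_cond_exp (Pr S) (K (cof k)) (\<lambda>\<omega>. ennreal (- f \<omega>)) \<omega> = nn_cond_exp (Pr S) J (\<lambda>\<omega>. ennreal (- f \<omega>)) \<omega>"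
    by (rule nn_cond_exp_K[OF k]) measurable
  ultimately show ?thesis unfolding real_cond_exp_def by eventually_elim simp
qed

lemma u_cluster_measurable:
  assumes "k < n" "l < n" "cof l = cof k"
  shows "uv S l \<in> borel_measurable (generated_by (Pr S) (Ugen (cl S (cof k)) \<union> Xgen (cl S (cof k)) \<union> Wgen))"
  using cof(2)[OF assms(2)] assms(3) by (intro generated_by_measurable) (auto simp: Ugen_def)

definition err :: "'a set \<Rightarrow> nat \<Rightarrow> 'a \<Rightarrow> real" where
  "err A k \<omega> = indicator A \<omega> * uv S k \<omega>"

text \<open>As \<open>A\<close> lies in \<open>J\<close>, hence in every \<open>K g\<close>, its
  indicator leaves all conditional expectations: means stay zero, and second moments stay the same
  given \<open>K\<close> and given \<open>J\<close>. Off \<open>A\<close> the error vanishes, so the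
  moment bound on \<open>A\<close> becomes a bound almost everywhere.\<close>

lemma clustered_errors_err:
  assumes A[measurable]: "A \<in> sets J" and B: "B \<ge> 0"
    and mom: "\<And>k \<omega>. k < n \<Longrightarrow> \<omega> \<in> A \<Longrightarrow> nn_cond_exp (Pr S) J (\<lambda>\<omega>. ennreal (uv S k \<omega> ^ 4)) \<omega> \<le> ennreal B"
  shows "clustered_errors (Pr S) J (\<lambda>k. K (cof k)) (err A) n cof B c"
proof
  interpret J: sigma_finite_subalgebra "Pr S" J by (rule sigma_finite_subalgebraI[OF subalgebra_J])
  have AK[measurable]: "A \<in> sets (K g)" for g using A subalgebra_K_J[of g] unfolding subalgebra_def by blast
  have AP[measurable]: "A \<in> events" using A subalgebra_J unfolding subalgebra_def by blast
  show "subalgebra (Pr S) J" by (rule subalgebra_J)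
  show "subalgebra (Pr S) (K (cof k))" "subalgebra (K (cof k)) J" for k
    by (rule subalgebra_K subalgebra_K_J)+
  show "err A k \<in> borel_measurable (Pr S)" if "k < n" for k
    unfolding err_def[abs_def] using that by measurable
  show "err A l \<in> borel_measurable (K (cof k))" if "k < n" "l < n" "cof k \<noteq> cof l" for k l
  proof -
    have [measurable]: "uv S l \<in> borel_measurable (K (cof k))"
      unfolding K_def by (rule generated_by_measurable) (use that in \<open>auto simp: Ugen_def\<close>)
    show ?thesis unfolding err_def[abs_def] by measurable
  qed
  show "0 \<le> B" by fact
  show "AE x in Pr S. nn_cond_exp (Pr S) J (\<lambda>x. ennreal (err A k x ^ 4)) x \<le> ennreal B" if k: "k < n" for k
  proof -
    note [measurable] = u_measurable[OF k]
    have "AE x in Pr S. indicator A x * nn_cond_exp (Pr S) J (\<lambda>x. ennreal (uv S k x ^ 4)) x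
        = nn_cond_exp (Pr S) J (\<lambda>x. indicator A x * ennreal (uv S k x ^ 4)) x"
      by (rule J.nn_cond_exp_prod) measurable
    moreover have "(\<lambda>x. indicator A x * ennreal (uv S k x ^ 4)) = (\<lambda>x. ennreal (err A k x ^ 4))"
      by (auto simp: err_def fun_eq_iff split: split_indicator)
    ultimately have "AE x in Pr S. indicator A x * nn_cond_exp (Pr S) J (\<lambda>x. ennreal (uv S k x ^ 4)) x
        = nn_cond_exp (Pr S) J (\<lambda>x. ennreal (err A k x ^ 4)) x" by simp
    then show ?thesis
    proof eventually_elim
      case (elim x)
      show ?case using mom[OF k, of x] by (cases "x \<in> A") (simp_all flip: elim)
    qed
  qed
  have ind: "AE x in Pr S. real_cond_exp (Pr S) (K g) (\<lambda>x. indicator A x * f x) x = indicator A x * real_cond_exp (Pr S) (K g) f x"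
    if "f \<in> borel_measurable (Pr S)" for f g
    by (rule sigma_finite_subalgebra.real_cond_exp_indicator[OF sigma_finite_subalgebraI[OF subalgebra_K] AK that])
  show "AE x in Pr S. real_cond_exp (Pr S) (K (cof k)) (err A k) x = 0" if k: "k < n" for k
    using ind[OF u_measurable[OF k], of "cof k"] real_cond_exp_K[OF k u_cluster_measurable[OF k k refl]] mean_zero[OF k]
    unfolding err_def[abs_def] by eventually_elim simp
  show "AE x in Pr S. real_cond_exp (Pr S) (K (cof k)) (\<lambda>x. err A k x * err A l x) x
      = real_cond_exp (Pr S) J (\<lambda>x. err A k x * err A l x) x" if kl: "k < n" "l < n" "cof k = cof l" for k l
  proof -
    note [measurable] = u_measurable[OF kl(1)] u_measurable[OF kl(2)]
      u_cluster_measurable[OF kl(1,1) refl] u_cluster_measurable[OF kl(1,2) kl(3)[symmetric]]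
    have eq: "(\<lambda>x. err A k x * err A l x) = (\<lambda>x. indicator A x * (uv S k x * uv S l x))"
      by (auto simp: err_def fun_eq_iff split: split_indicator)
    have "AE x in Pr S. real_cond_exp (Pr S) (K (cof k)) (\<lambda>x. uv S k x * uv S l x) x
        = real_cond_exp (Pr S) J (\<lambda>x. uv S k x * uv S l x) x"
      by (rule real_cond_exp_K[OF kl(1)]) measurable
    moreover have "AE x in Pr S. real_cond_exp (Pr S) J (\<lambda>x. indicator A x * (uv S k x * uv S l x)) x
        = indicator A x * real_cond_exp (Pr S) J (\<lambda>x. uv S k x * uv S l x) x"
      by (rule J.real_cond_exp_indicator) measurable
    moreover have "AE x in Pr S. real_cond_exp (Pr S) (K (cof k)) (\<lambda>x. indicator A x * (uv S k x * uv S l x)) x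
        = indicator A x * real_cond_exp (Pr S) (K (cof k)) (\<lambda>x. uv S k x * uv S l x) x"
      by (rule ind) measurable
    ultimately show ?thesis unfolding eq by eventually_elim simp
  qed
  show "card {l \<in> {..<n}. cof l = cof k} \<le> c" if "k < n" for k
    using cluster_card[OF cof(1)[OF that]] cl_eq[OF cof(1)[OF that]] by simp
qed

subsection \<open>Measurability of the sample statistics\<close>

lemma space_J: "space J = \<Omega>" by (simp add: sigma_gens space_generated_by)

lemma space_W: "space W = \<Omega>" by (simp add: sigma_gens space_generated_by)

lemma from_J: "f \<in> borel_measurable J \<Longrightarrow> f \<in> borel_measurable (Pr S)"
  by (rule measurable_from_subalg[OF subalgebra_J])

lemma x_J[measurable]: "i < n \<Longrightarrow> a < d \<Longrightarrow> (\<lambda>\<omega>. xv S i \<omega> $ a) \<in> borel_measurable J"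
  unfolding sigma_gens by (rule generated_by_measurable) (auto simp: Xgen_def)

lemma w_J[measurable]: "i < n \<Longrightarrow> b < m \<Longrightarrow> (\<lambda>\<omega>. wv S i \<omega> $ b) \<in> borel_measurable J"
  unfolding sigma_gens by (rule generated_by_measurable) (auto simp: Wgen_def)

lemma w_W[measurable]: "i < n \<Longrightarrow> b < m \<Longrightarrow> (\<lambda>\<omega>. wv S i \<omega> $ b) \<in> borel_measurable W"
  unfolding sigma_gens by (rule generated_by_measurable) (auto simp: Wgen_def)

lemma gram_w_carrier: "gram_w S \<omega> \<in> carrier_mat m m"
  unfolding gram_w_def by (rule gram_carrier)

lemma gram_w_J: "a < m \<Longrightarrow> b < m \<Longrightarrow> (\<lambda>\<omega>. gram_w S \<omega> $$ (a, b)) \<in> borel_measurable J"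
  unfolding gram_w_def by (simp add: gram_index)

lemma det_gram_w_J[measurable]: "(\<lambda>\<omega>. det (gram_w S \<omega>)) \<in> borel_measurable J"
  by (rule det_measurable[OF gram_w_carrier gram_w_J])

lemma MM_J[measurable]: assumes "i < n" "j < n" shows "(\<lambda>\<omega>. MM \<omega> i j) \<in> borel_measurable J"
proof -
  have "(\<lambda>\<omega>. (if i = j then 1 else 0) -
    (\<Sum>a<m. \<Sum>b<m. wv S i \<omega> $ a * (mat_inv (gram_w S \<omega>) $$ (a, b) * wv S j \<omega> $ b))) \<in> borel_measurable J"
    by (intro borel_measurable_diff borel_measurable_const borel_measurable_sum borel_measurable_times w_J
        mat_inv_measurable[OF gram_w_carrier gram_w_J]) (use assms in auto)
  then show ?thesis
    by (subst measurable_cong[OF MM_index[OF _ assms]]) (simp_all only: space_J)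
qed

lemma v_hat_J[measurable]: assumes "i < n" "a < d" shows "(\<lambda>\<omega>. v_hat S i \<omega> $ a) \<in> borel_measurable J"
proof -
  have "(\<lambda>\<omega>. \<Sum>j<n. MM \<omega> i j * xv S j \<omega> $ a) \<in> borel_measurable J" using assms by measurable
  then show ?thesis using v_hat_index[OF _ assms(2)] space_J by (subst measurable_cong) auto
qed

lemma selected_kronecker_J:
  assumes "x < length (triples S)" "y < length (triples S)"
  shows "(\<lambda>\<omega>. selected_kronecker S \<omega> $$ (x, y)) \<in> borel_measurable J"
proof -
  have "\<exists>p\<in>pairs. x = triple_pos S (triple p)" if "x < length (triples S)" for x
  proof -
    have "triples S ! x \<in> triple ` pairs" using that set_triples_image by (metis nth_mem)
    then show ?thesis using triple_pos_nth[OF that] by force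
  qed
  then obtain p q where pq: "p \<in> pairs" "q \<in> pairs" "x = triple_pos S (triple p)" "y = triple_pos S (triple q)"
    using assms by meson
  then have "fst p < n" "snd p < n" "fst q < n" "snd q < n" unfolding pairs_def by auto
  then show ?thesis using pq by (simp add: selected_kronecker_index)
qed

lemma det_selected_kronecker_J[measurable]: "(\<lambda>\<omega>. det (selected_kronecker S \<omega>)) \<in> borel_measurable J"
  by (rule det_measurable[OF selected_kronecker_carrier selected_kronecker_J])

lemma kappa_J[measurable]: assumes "p \<in> pairs" "q \<in> pairs" shows "(\<lambda>\<omega>. \<kappa> \<omega> p q) \<in> borel_measurable J"
  unfolding \<kappa>_def kappa_CR_def
  by (rule mat_inv_measurable[OF selected_kronecker_carrier selected_kronecker_J])
     (use assms triple_pos set_triples_image in auto)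

lemma kappa_CR_norm_J[measurable]: "kappa_CR_norm S \<in> borel_measurable J"
  unfolding kappa_CR_norm_eq[abs_def]
  by (intro borel_measurable_Max finite_pairs borel_measurable_sum borel_measurable_abs kappa_J)

lemma v_hat_carrier: "v_hat S i \<omega> \<in> carrier_vec d"
  unfolding v_hat_def partial_out_def by simp

lemma vec_norm_v_hat_J[measurable]: "i < n \<Longrightarrow> (\<lambda>\<omega>. vec_norm (v_hat S i \<omega>)) \<in> borel_measurable J"
  unfolding vec_norm_eq[OF v_hat_carrier] by measurable

lemma Sigma_cond_carrier: "Sigma_cond S \<omega> \<in> carrier_mat d d"
  unfolding Sigma_cond_def by simp

lemma Sigma_cond_measurable:
  "a < d \<Longrightarrow> b < d \<Longrightarrow> (\<lambda>\<omega>. Sigma_cond S \<omega> $$ (a, b)) \<in> borel_measurable (Pr S)"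
  unfolding Sigma_cond_def by simp

lemma inverse_norm_Sigma_cond_measurable: "(\<lambda>\<omega>. inverse_norm (Sigma_cond S \<omega>)) \<in> borel_measurable (Pr S)"
  by (rule inverse_norm_measurable[OF Sigma_cond_carrier Sigma_cond_measurable])

lemma V_vec_carrier: "\<omega> \<in> \<Omega> \<Longrightarrow> i < n \<Longrightarrow> V_vec S i \<omega> \<in> carrier_vec d"
  using x_carrier[of \<omega> i] unfolding V_vec_def cond_exp_W_def by (auto intro: minus_carrier_vec)

lemma V_vec_index: "a < d \<Longrightarrow> V_vec S i \<omega> $ a = xv S i \<omega> $ a - real_cond_exp (Pr S) W (\<lambda>\<omega>. xv S i \<omega> $ a) \<omega>"
  unfolding V_vec_def cond_exp_W_def by simp

lemma V_vec_measurable[measurable]: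
  assumes "i < n" "a < d" shows "(\<lambda>\<omega>. V_vec S i \<omega> $ a) \<in> borel_measurable (Pr S)"
proof -
  note [measurable] = x_measurable[OF assms]
  show ?thesis unfolding V_vec_index[OF assms(2)] by measurable
qed

lemma vec_norm_V_measurable[measurable]:
  assumes "i < n" shows "(\<lambda>\<omega>. vec_norm (V_vec S i \<omega>)) \<in> borel_measurable (Pr S)"
proof -
  have "(\<lambda>\<omega>. sqrt (\<Sum>a<d. (V_vec S i \<omega> $ a)\<^sup>2)) \<in> borel_measurable (Pr S)" using assms by measurable
  then show ?thesis using vec_norm_eq[OF V_vec_carrier[OF _ assms]] by (subst measurable_cong) auto
qed

lemma Q_vec_carrier: "Q_vec S i \<omega> \<in> carrier_vec d"
  unfolding Q_vec_def cond_exp_W_def by simp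

lemma Q_vec_index: "a < d \<Longrightarrow> Q_vec S i \<omega> $ a = real_cond_exp (Pr S) W (\<lambda>\<omega>. v_pop S i \<omega> $ a) \<omega>"
  unfolding Q_vec_def cond_exp_W_def by simp

lemma vec_norm_Q_measurable[measurable]: "(\<lambda>\<omega>. vec_norm (Q_vec S i \<omega>)) \<in> borel_measurable (Pr S)"
  unfolding vec_norm_eq[OF Q_vec_carrier] by (simp add: Q_vec_index)

lemma C_moment_measurable: "C_moment S \<in> borel_measurable (Pr S)"
proof -
  have [measurable]: "(\<lambda>\<omega>. lambda_min (cond_exp_Gamma_tilde S \<omega>)) \<in> borel_measurable (Pr S)"
    by (rule lambda_min_measurable[where n=d]) (auto simp: cond_exp_Gamma_tilde_def)
  show ?thesis unfolding C_moment_def[abs_def] by measurable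
qed

lemma C_moment_ge:
  assumes "i < n"
  shows "nn_cond_exp (Pr S) J (\<lambda>\<omega>. ennreal ((uv S i \<omega>)^4)) \<omega> \<le> C_moment S \<omega>"
    "nn_cond_exp (Pr S) W (\<lambda>\<omega>. ennreal ((vec_norm (V_vec S i \<omega>))^4)) \<omega> \<le> C_moment S \<omega>"
proof -
  let ?f = "\<lambda>i. nn_cond_exp (Pr S) J (\<lambda>\<omega>. ennreal ((uv S i \<omega>)^4)) \<omega> +
        nn_cond_exp (Pr S) W (\<lambda>\<omega>. ennreal ((vec_norm (V_vec S i \<omega>))^4)) \<omega> +
        1 / nn_cond_exp (Pr S) J (\<lambda>\<omega>. ennreal ((uv S i \<omega>)\<^sup>2)) \<omega>"
  have "?f i \<le> Max (?f ` {..<n})" using assms by (intro Max_ge) auto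
  also have "\<dots> \<le> C_moment S \<omega>" unfolding C_moment_def by simp
  finally have *: "?f i \<le> C_moment S \<omega>" .
  have "nn_cond_exp (Pr S) J (\<lambda>\<omega>. ennreal ((uv S i \<omega>)^4)) \<omega> \<le> ?f i"
    by (simp add: add.assoc)
  then show "nn_cond_exp (Pr S) J (\<lambda>\<omega>. ennreal ((uv S i \<omega>)^4)) \<omega> \<le> C_moment S \<omega>" using * by (rule order_trans)
  have "nn_cond_exp (Pr S) W (\<lambda>\<omega>. ennreal ((vec_norm (V_vec S i \<omega>))^4)) \<omega> \<le> ?f i"
    by (intro add_increasing2 add_increasing) auto
  then show "nn_cond_exp (Pr S) W (\<lambda>\<omega>. ennreal ((vec_norm (V_vec S i \<omega>))^4)) \<omega> \<le> C_moment S \<omega>"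
    using * by (rule order_trans)
qed

subsection \<open>Size of the partialled-out regressors\<close>

text \<open>The linear part of \<open>v_pop\<close> is \<open>W\<close>-measurable and therefore
  cancels against its conditional expectation. Its integrability comes from that of the squares of
  \<open>w\<close>.\<close>

lemma v_pop_decomposition:
  "AE \<omega> in Pr S. \<forall>i<n. \<forall>a<d. v_pop S i \<omega> $ a = Q_vec S i \<omega> $ a + V_vec S i \<omega> $ a"
proof -
  interpret W: sigma_finite_subalgebra "Pr S" W by (rule sigma_finite_subalgebraI[OF subalgebra_W])
  let ?P = "projection_coeff S"
  have P: "?P \<in> carrier_mat d m" unfolding projection_coeff_def
    by (rule mult_carrier_mat[of _ _ m]) (auto intro: mat_inv_carrier)
  have main: "AE \<omega> in Pr S. v_pop S i \<omega> $ a = Q_vec S i \<omega> $ a + V_vec S i \<omega> $ a" if ia: "i < n" "a < d" for i a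
  proof -
    note [measurable] = x_measurable[OF ia]
    let ?q = "\<lambda>\<omega>. \<Sum>b<m. ?P $$ (a, b) * wv S i \<omega> $ b"
    have vp: "v_pop S i \<omega> $ a = xv S i \<omega> $ a - ?q \<omega>" if "\<omega> \<in> \<Omega>" for \<omega>
      using mult_mat_vec_index_sum[OF P w_carrier[OF that ia(1)] ia(2)] P ia(2) unfolding v_pop_def by simp
    have wi: "integrable (Pr S) (\<lambda>\<omega>. wv S i \<omega> $ b)" if b: "b < m" for b
    proof (rule Bochner_Integration.integrable_bound)
      show "integrable (Pr S) (\<lambda>\<omega>. 1 + wv S i \<omega> $ b * wv S i \<omega> $ b)" using ww_integrable[OF ia(1) b b] by auto
      have "\<bar>x\<bar> \<le> 1 + x * x" for x :: real
        using abs_mult_le_sum_squares[of 1 x] by (simp add: power2_eq_square add_increasing2)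
      then show "AE \<omega> in Pr S. norm (wv S i \<omega> $ b) \<le> norm (1 + wv S i \<omega> $ b * wv S i \<omega> $ b)"
        by (auto intro: order_trans[OF _ abs_ge_self])
    qed (rule w_measurable[OF ia(1) b])
    have qi: "integrable (Pr S) ?q" using wi by auto
    have qW: "?q \<in> borel_measurable W" using ia by measurable
    have m: "(\<lambda>\<omega>. xv S i \<omega> $ a - ?q \<omega>) \<in> borel_measurable (Pr S)" using qi x_integrable[OF ia] by auto
    have "(\<lambda>\<omega>. v_pop S i \<omega> $ a) \<in> borel_measurable (Pr S)"
      by (rule measurable_cong[THEN iffD2, OF vp m])
    then have "AE \<omega> in Pr S. real_cond_exp (Pr S) W (\<lambda>\<omega>. v_pop S i \<omega> $ a) \<omega>
        = real_cond_exp (Pr S) W (\<lambda>\<omega>. xv S i \<omega> $ a - ?q \<omega>) \<omega>"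
      using m vp by (intro W.real_cond_exp_cong) auto
    moreover have "AE \<omega> in Pr S. real_cond_exp (Pr S) W (\<lambda>\<omega>. xv S i \<omega> $ a - ?q \<omega>) \<omega>
        = real_cond_exp (Pr S) W (\<lambda>\<omega>. xv S i \<omega> $ a) \<omega> - real_cond_exp (Pr S) W ?q \<omega>"
      by (rule W.real_cond_exp_diff[OF x_integrable[OF ia] qi])
    moreover have "AE \<omega> in Pr S. real_cond_exp (Pr S) W ?q \<omega> = ?q \<omega>"
      by (rule W.real_cond_exp_F_meas[OF qi qW])
    moreover have "AE \<omega> in Pr S. v_pop S i \<omega> $ a = xv S i \<omega> $ a - ?q \<omega>" using vp by (rule AE_I2)
    ultimately show ?thesis
      by eventually_elim (simp add: Q_vec_index[OF ia(2)] V_vec_index[OF ia(2)])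
  qed
  then have "AE \<omega> in Pr S. \<forall>i\<in>{..<n}. \<forall>a\<in>{..<d}. v_pop S i \<omega> $ a = Q_vec S i \<omega> $ a + V_vec S i \<omega> $ a"
    by (intro AE_finite_allI) auto
  then show ?thesis by eventually_elim auto
qed

definition Q_mean_square :: "'a \<Rightarrow> ennreal" where
  "Q_mean_square \<omega> = ennreal (1 / n) * (\<Sum>i<n. ennreal ((vec_norm (Q_vec S i \<omega>))\<^sup>2))"

lemma Q_mean_square_measurable[measurable]: "Q_mean_square \<in> borel_measurable (Pr S)"
  unfolding Q_mean_square_def[abs_def] by measurable

lemma nn_integral_Q_mean_square: "(\<integral>\<^sup>+\<omega>. Q_mean_square \<omega> \<partial>Pr S) = chi S"
  unfolding Q_mean_square_def chi_def by (simp add: nn_integral_cmult nn_integral_sum del: sum_ennreal)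

definition V_moment_event :: "real \<Rightarrow> 'a set" where
  "V_moment_event B = {\<omega>\<in>\<Omega>. \<forall>i<n. nn_cond_exp (Pr S) W (\<lambda>\<omega>. ennreal ((vec_norm (V_vec S i \<omega>))^4)) \<omega> \<le> ennreal B}"

text \<open>\<open>V\<close> is not assumed to have unconditional fourth moments. Restricted to the
  \<open>W\<close>-measurable event, its mean square has expectation at most \<open>1 + B\<close>,
  so that Markov's inequality applies.\<close>

definition V_mean_square :: "real \<Rightarrow> 'a \<Rightarrow> ennreal" where
  "V_mean_square B \<omega> = indicator (V_moment_event B) \<omega> * (ennreal (1 / n) * (\<Sum>i<n. ennreal ((vec_norm (V_vec S i \<omega>))\<^sup>2)))"

lemma V_moment_event_W[measurable]: "V_moment_event B \<in> sets W"
proof -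
  have "{\<omega>\<in>space W. \<forall>i\<in>{..<n}. nn_cond_exp (Pr S) W (\<lambda>\<omega>. ennreal ((vec_norm (V_vec S i \<omega>))^4)) \<omega> \<le> ennreal B} \<in> sets W"
  proof (intro sets.sets_Collect_finite_All)
    fix i
    have [measurable]: "nn_cond_exp (Pr S) W f \<in> borel_measurable W" for f by (rule borel_measurable_nn_cond_exp)
    show "{\<omega>\<in>space W. nn_cond_exp (Pr S) W (\<lambda>\<omega>. ennreal ((vec_norm (V_vec S i \<omega>))^4)) \<omega> \<le> ennreal B} \<in> sets W"
      by (rule borel_measurable_le) (rule borel_measurable_nn_cond_exp, simp)
  qed simp
  then show ?thesis unfolding V_moment_event_def space_W by (simp only: lessThan_iff Ball_def)
qed

lemma V_moment_event_sets[measurable]: "V_moment_event B \<in> events"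
  using V_moment_event_W subalgebra_W unfolding subalgebra_def by blast

lemma V_mean_square_measurable[measurable]: "V_mean_square B \<in> borel_measurable (Pr S)"
  unfolding V_mean_square_def[abs_def] by measurable

lemma nn_integral_V_mean_square:
  assumes "n > 0" "B \<ge> 0"
  shows "(\<integral>\<^sup>+\<omega>. V_mean_square B \<omega> \<partial>Pr S) \<le> ennreal (1 + B)"
proof -
  interpret W: sigma_finite_subalgebra "Pr S" W by (rule sigma_finite_subalgebraI[OF subalgebra_W])
  let ?F = "V_moment_event B"
  define C where "C = 1 + B"
  define g where "g i \<omega> = indicator ?F \<omega> * ennreal ((vec_norm (V_vec S i \<omega>))\<^sup>2)" for i \<omega>
  have C: "C \<ge> 0" using assms unfolding C_def by simp
  have gm[measurable]: "g i \<in> borel_measurable (Pr S)" if "i < n" for i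
    unfolding g_def[abs_def] using that by measurable
  have one: "(\<integral>\<^sup>+\<omega>. indicator ?F \<omega> * ennreal ((vec_norm (V_vec S i \<omega>))\<^sup>2) \<partial>Pr S) \<le> ennreal C" if i: "i < n" for i
  proof -
    note [measurable] = vec_norm_V_measurable[OF i]
    let ?v = "\<lambda>\<omega>. vec_norm (V_vec S i \<omega>)"
    have "(\<integral>\<^sup>+\<omega>. indicator ?F \<omega> * ennreal ((?v \<omega>)\<^sup>2) \<partial>Pr S)
        \<le> (\<integral>\<^sup>+\<omega>. 1 + indicator ?F \<omega> * ennreal ((?v \<omega>)^4) \<partial>Pr S)"
    proof (rule nn_integral_mono)
      fix \<omega>
      have "ennreal ((?v \<omega>)\<^sup>2) \<le> 1 + ennreal ((?v \<omega>)^4)"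
        using ennreal_leI[OF square_le_one_plus_fourth[of "?v \<omega>"]] by simp
      then show "indicator ?F \<omega> * ennreal ((?v \<omega>)\<^sup>2) \<le> 1 + indicator ?F \<omega> * ennreal ((?v \<omega>)^4)"
        by (auto split: split_indicator)
    qed
    also have "\<dots> = 1 + (\<integral>\<^sup>+\<omega>. indicator ?F \<omega> * ennreal ((?v \<omega>)^4) \<partial>Pr S)"
      by (subst nn_integral_add) (auto simp: emeasure_space_1)
    also have "(\<integral>\<^sup>+\<omega>. indicator ?F \<omega> * ennreal ((?v \<omega>)^4) \<partial>Pr S)
        = (\<integral>\<^sup>+\<omega>. indicator ?F \<omega> * nn_cond_exp (Pr S) W (\<lambda>\<omega>. ennreal ((?v \<omega>)^4)) \<omega> \<partial>Pr S)"
      by (rule W.nn_cond_exp_intg[symmetric]) measurable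
    also have "\<dots> \<le> (\<integral>\<^sup>+\<omega>. ennreal B \<partial>Pr S)"
      by (rule nn_integral_mono) (use i in \<open>auto simp: V_moment_event_def split: split_indicator\<close>)
    also have "\<dots> = ennreal B" by (simp add: emeasure_space_1)
    also have "1 + ennreal B = ennreal C" using assms unfolding C_def by simp
    finally show ?thesis by (simp add: add_left_mono)
  qed
  have "(\<integral>\<^sup>+\<omega>. V_mean_square B \<omega> \<partial>Pr S) = (\<integral>\<^sup>+\<omega>. ennreal (1 / n) * (\<Sum>i<n. g i \<omega>) \<partial>Pr S)"
    unfolding V_mean_square_def g_def
    by (intro nn_integral_cong) (simp only: sum_distrib_left mult.left_commute)
  also have "\<dots> = ennreal (1 / n) * (\<Sum>i<n. \<integral>\<^sup>+\<omega>. g i \<omega> \<partial>Pr S)"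
  proof -
    have "(\<lambda>\<omega>. \<Sum>i<n. g i \<omega>) \<in> borel_measurable (Pr S)" by (intro borel_measurable_sum gm) auto
    moreover have "(\<integral>\<^sup>+\<omega>. (\<Sum>i<n. g i \<omega>) \<partial>Pr S) = (\<Sum>i<n. \<integral>\<^sup>+\<omega>. g i \<omega> \<partial>Pr S)"
      by (rule nn_integral_sum) (use gm in auto)
    ultimately show ?thesis by (simp add: nn_integral_cmult)
  qed
  also have "\<dots> \<le> ennreal (1 / n) * (\<Sum>i<n. ennreal C)"
    using one unfolding g_def by (intro mult_left_mono sum_mono) auto
  also have "\<dots> = ennreal ((1 / n) * (n * C))"
  proof -
    have "(\<Sum>i<n. ennreal C) = ennreal (\<Sum>i<n. C)" using C by (intro sum_ennreal) auto
    also have "\<dots> = ennreal (n * C)" by simp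
    finally show ?thesis using C by (subst ennreal_mult) auto
  qed
  also have "\<dots> = ennreal (1 + B)" using assms by (simp add: C_def)
  finally show ?thesis .
qed

lemma v_hat_mean_square_le:
  assumes \<omega>: "\<omega> \<in> \<Omega>" "n > 0" and det: "det (gram_w S \<omega>) \<noteq> 0"
    and dec: "\<forall>i<n. \<forall>a<d. v_pop S i \<omega> $ a = Q_vec S i \<omega> $ a + V_vec S i \<omega> $ a"
    and Q: "Q_mean_square \<omega> \<le> ennreal B4" "B4 \<ge> 0"
    and V: "V_mean_square B \<omega> \<le> ennreal B5" "\<omega> \<in> V_moment_event B" "B5 \<ge> 0"
  shows "(1 / n) * (\<Sum>i<n. \<Sum>a<d. (v_hat S i \<omega> $ a)\<^sup>2) \<le> 2 * (B4 + B5)"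
proof -
  have "ennreal ((1 / n) * (\<Sum>i<n. \<Sum>a<d. (Q_vec S i \<omega> $ a)\<^sup>2)) \<le> ennreal B4"
    using Q(1) unfolding Q_mean_square_def vec_norm_square[OF Q_vec_carrier]
    by (simp add: sum_nonneg flip: ennreal_mult)
  then have Q': "(1 / n) * (\<Sum>i<n. \<Sum>a<d. (Q_vec S i \<omega> $ a)\<^sup>2) \<le> B4"
    using Q(2) by (subst (asm) ennreal_le_iff) auto
  have "ennreal ((1 / n) * (\<Sum>i<n. \<Sum>a<d. (V_vec S i \<omega> $ a)\<^sup>2)) \<le> ennreal B5"
    using V(1,2) unfolding V_mean_square_def
    by (simp add: vec_norm_square[OF V_vec_carrier[OF \<omega>(1)]] sum_nonneg flip: ennreal_mult)
  then have V': "(1 / n) * (\<Sum>i<n. \<Sum>a<d. (V_vec S i \<omega> $ a)\<^sup>2) \<le> B5"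
    using V(3) by (subst (asm) ennreal_le_iff) auto
  have "(1 / n) * (\<Sum>i<n. \<Sum>a<d. (v_hat S i \<omega> $ a)\<^sup>2)
      \<le> (1 / n) * (2 * (\<Sum>i<n. \<Sum>a<d. (Q_vec S i \<omega> $ a)\<^sup>2) + 2 * (\<Sum>i<n. \<Sum>a<d. (V_vec S i \<omega> $ a)\<^sup>2))"
    using dec by (intro mult_left_mono v_hat_square_sum_le[OF \<omega>(1) det]) auto
  also have "\<dots> = 2 * ((1 / n) * (\<Sum>i<n. \<Sum>a<d. (Q_vec S i \<omega> $ a)\<^sup>2)) + 2 * ((1 / n) * (\<Sum>i<n. \<Sum>a<d. (V_vec S i \<omega> $ a)\<^sup>2))"
    by (simp add: algebra_simps)
  also have "\<dots> \<le> 2 * B4 + 2 * B5" by (intro add_mono mult_left_mono Q' V') auto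
  finally show ?thesis by simp
qed

subsection \<open>The conditional variance\<close>

text \<open>On \<open>A\<close> the errors equal the truncated ones. The indicator is moved into the
  conditional expectation, where all products are integrable, and out again; the score itself may
  fail to be square integrable.\<close>

lemma Sigma_cond_eq:
  assumes A[measurable]: "A \<in> sets J" and E: "clustered_errors (Pr S) J (\<lambda>k. K (cof k)) (err A) n cof B c"
    and vC: "\<And>\<omega> i a. \<omega> \<in> A \<Longrightarrow> i < n \<Longrightarrow> a < d \<Longrightarrow> \<bar>v_hat S i \<omega> $ a\<bar> \<le> C" and C: "C \<ge> 0"
  shows "AE \<omega> in Pr S. \<omega> \<in> A \<longrightarrow> (\<forall>a<d. \<forall>b<d. Sigma_cond S \<omega> $$ (a, b) =
    (1 / n) * (\<Sum>k<n. \<Sum>l<n. v_hat S k \<omega> $ a * v_hat S l \<omega> $ b * clustered_errors.s (Pr S) J (err A) k l \<omega>))"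
proof -
  interpret E: clustered_errors "Pr S" J "\<lambda>k. K (cof k)" "err A" n cof B c by (rule E)
  have AP[measurable]: "A \<in> events" using A subalgebra_J unfolding subalgebra_def by blast
  note v_P = from_J[OF v_hat_J]
  have sm: "score S a \<in> borel_measurable (Pr S)" if "a < d" for a
    unfolding score_def[abs_def]
    by (intro borel_measurable_times borel_measurable_const borel_measurable_sum v_P u_measurable) (use that in auto)
  let ?m = "\<lambda>a. real_cond_exp (Pr S) J (score S a)"
  \<comment> \<open>The conditional mean of the score vanishes on \<open>A\<close>, so the
    conditional covariance is a second moment there.\<close>
  have m0: "AE \<omega> in Pr S. \<omega> \<in> A \<longrightarrow> ?m a \<omega> = 0" if a: "a < d" for a
  proof -
    have "AE \<omega> in Pr S. real_cond_exp (Pr S) J (\<lambda>\<omega>. \<Sum>k\<in>{..<n}. (indicator A \<omega> * ((1 / sqrt n) * v_hat S k \<omega> $ a)) * err A k \<omega>) \<omega>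
        = (\<Sum>k\<in>{..<n}. (indicator A \<omega> * ((1 / sqrt n) * v_hat S k \<omega> $ a)) * real_cond_exp (Pr S) J (err A k) \<omega>)"
    proof (rule E.J.real_cond_exp_weighted_sum[where D="(1 / sqrt n) * C"])
      show "(\<lambda>\<omega>. indicator A \<omega> * ((1 / sqrt n) * v_hat S k \<omega> $ a)) \<in> borel_measurable J" if "k \<in> {..<n}" for k
        using that a by simp
      show "\<bar>indicator A \<omega> * ((1 / sqrt n) * v_hat S k \<omega> $ a)\<bar> \<le> (1 / sqrt n) * C" if "k \<in> {..<n}" for k \<omega>
        using vC[of \<omega> k a] that a C by (cases "\<omega> \<in> A") (auto simp: abs_mult divide_right_mono)
    qed (auto intro: E.error_integrable)
    moreover have "(\<lambda>\<omega>. \<Sum>k\<in>{..<n}. (indicator A \<omega> * ((1 / sqrt n) * v_hat S k \<omega> $ a)) * err A k \<omega>)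
        = (\<lambda>\<omega>. indicator A \<omega> * score S a \<omega>)"
      by (auto simp: fun_eq_iff err_def score_def sum_distrib_left split: split_indicator)
    moreover have "AE \<omega> in Pr S. real_cond_exp (Pr S) J (\<lambda>\<omega>. indicator A \<omega> * score S a \<omega>) \<omega> = indicator A \<omega> * ?m a \<omega>"
      by (rule E.J.real_cond_exp_indicator[OF A sm[OF a]])
    moreover have "AE \<omega> in Pr S. \<forall>k\<in>{..<n}. real_cond_exp (Pr S) J (err A k) \<omega> = 0"
    proof (rule AE_finite_allI)
      fix k assume "k \<in> {..<n}"
      then have k: "k < n" by simp
      show "AE \<omega> in Pr S. real_cond_exp (Pr S) J (err A k) \<omega> = 0"
        using E.J.real_cond_exp_indicator[OF A u_measurable[OF k]] mean_zero[OF k]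
        unfolding err_def[abs_def] by eventually_elim simp
    qed simp
    ultimately show ?thesis by (auto split: split_indicator_asm)
  qed
  have main: "AE \<omega> in Pr S. \<omega> \<in> A \<longrightarrow> Sigma_cond S \<omega> $$ (a, b) =
    (1 / n) * (\<Sum>k<n. \<Sum>l<n. v_hat S k \<omega> $ a * v_hat S l \<omega> $ b * E.s k l \<omega>)" if ab: "a < d" "b < d" for a b
  proof -
    let ?f = "\<lambda>\<omega>. (score S a \<omega> - ?m a \<omega>) * (score S b \<omega> - ?m b \<omega>)"
    let ?I = "{..<n} \<times> {..<n}"
    let ?w = "\<lambda>p \<omega>. indicator A \<omega> * ((1 / n) * (v_hat S (fst p) \<omega> $ a * v_hat S (snd p) \<omega> $ b))"
    let ?e = "\<lambda>p \<omega>. err A (fst p) \<omega> * err A (snd p) \<omega>"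
    have fm: "?f \<in> borel_measurable (Pr S)" using sm[OF ab(1)] sm[OF ab(2)] by measurable
    have wm: "?w p \<in> borel_measurable J" if "p \<in> ?I" for p using that ab by auto
    have em: "integrable (Pr S) (?e p)" if "p \<in> ?I" for p using that by (auto intro: E.product_integrable)
    have "AE \<omega> in Pr S. real_cond_exp (Pr S) J (\<lambda>\<omega>. \<Sum>p\<in>?I. ?w p \<omega> * ?e p \<omega>) \<omega>
        = (\<Sum>p\<in>?I. ?w p \<omega> * real_cond_exp (Pr S) J (?e p) \<omega>)"
    proof (rule E.J.real_cond_exp_weighted_sum[where D="(1 / n) * (C * C)"])
      show "\<bar>?w p \<omega>\<bar> \<le> (1 / n) * (C * C)" if p: "p \<in> ?I" for p \<omega>
      proof (cases "\<omega> \<in> A")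
        case True
        have "\<bar>v_hat S (fst p) \<omega> $ a\<bar> * \<bar>v_hat S (snd p) \<omega> $ b\<bar> \<le> C * C"
          using vC[OF True] p ab C by (intro mult_mono) auto
        then have "(1 / n) * (\<bar>v_hat S (fst p) \<omega> $ a\<bar> * \<bar>v_hat S (snd p) \<omega> $ b\<bar>) \<le> (1 / n) * (C * C)"
          by (intro mult_left_mono) auto
        then show ?thesis using True by (simp add: abs_mult)
      qed (use C in simp)
    qed (use wm em in auto)
    moreover have "AE \<omega> in Pr S. real_cond_exp (Pr S) J (\<lambda>\<omega>. indicator A \<omega> * ?f \<omega>) \<omega> = indicator A \<omega> * real_cond_exp (Pr S) J ?f \<omega>"
      by (rule E.J.real_cond_exp_indicator[OF A fm])
    moreover have "AE \<omega> in Pr S. real_cond_exp (Pr S) J (\<lambda>\<omega>. indicator A \<omega> * ?f \<omega>) \<omega> = real_cond_exp (Pr S) J (\<lambda>\<omega>. \<Sum>p\<in>?I. ?w p \<omega> * ?e p \<omega>) \<omega>"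
    proof (rule E.J.real_cond_exp_cong)
      show "(\<lambda>\<omega>. \<Sum>p\<in>?I. ?w p \<omega> * ?e p \<omega>) \<in> borel_measurable (Pr S)"
        by (intro borel_measurable_sum borel_measurable_times from_J[OF wm] borel_measurable_integrable[OF em])
      show "AE \<omega> in Pr S. indicator A \<omega> * ?f \<omega> = (\<Sum>p\<in>?I. ?w p \<omega> * ?e p \<omega>)"
        using m0[OF ab(1)] m0[OF ab(2)]
      proof eventually_elim
        case (elim \<omega>)
        show ?case
        proof (cases "\<omega> \<in> A")
          case True
          have "score S a \<omega> * score S b \<omega> = (\<Sum>k<n. \<Sum>l<n. (1 / sqrt n * (1 / sqrt n)) *
             ((v_hat S k \<omega> $ a * v_hat S l \<omega> $ b) * (uv S k \<omega> * uv S l \<omega>)))"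
          proof -
            have "score S a \<omega> * score S b \<omega> = (1 / sqrt n * (1 / sqrt n)) *
                ((\<Sum>k<n. v_hat S k \<omega> $ a * uv S k \<omega>) * (\<Sum>l<n. v_hat S l \<omega> $ b * uv S l \<omega>))"
              unfolding score_def by (simp only: ac_simps)
            also have "\<dots> = (\<Sum>k<n. \<Sum>l<n. (1 / sqrt n * (1 / sqrt n)) *
                ((v_hat S k \<omega> $ a * v_hat S l \<omega> $ b) * (uv S k \<omega> * uv S l \<omega>)))"
              by (subst sum_product, unfold sum_distrib_left) (intro sum.cong refl, simp only: ac_simps)
            finally show ?thesis .
          qed
          then show ?thesis using True elim
            by (simp add: sum.cartesian_product split_beta err_def ac_simps)
        qed simp
      qed
    qed (use fm in measurable)
    ultimately have "AE \<omega> in Pr S. indicator A \<omega> * real_cond_exp (Pr S) J ?f \<omega> = (\<Sum>p\<in>?I. ?w p \<omega> * E.s (fst p) (snd p) \<omega>)"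
      unfolding E.s_def by eventually_elim simp
    then show ?thesis
    proof eventually_elim
      case (elim \<omega>)
      show ?case
      proof
        assume "\<omega> \<in> A"
        then have "real_cond_exp (Pr S) J ?f \<omega> = (\<Sum>p\<in>?I. (1 / n) * (v_hat S (fst p) \<omega> $ a * v_hat S (snd p) \<omega> $ b * E.s (fst p) (snd p) \<omega>))"
          using elim by (simp add: mult.assoc)
        then show "Sigma_cond S \<omega> $$ (a, b) =
            (1 / n) * (\<Sum>k<n. \<Sum>l<n. v_hat S k \<omega> $ a * v_hat S l \<omega> $ b * E.s k l \<omega>)"
          unfolding Sigma_cond_def using ab
          by (simp add: sum_distrib_left sum.cartesian_product split_beta)
      qed
    qed
  qed
  have "AE \<omega> in Pr S. \<forall>a\<in>{..<d}. \<forall>b\<in>{..<d}. \<omega> \<in> A \<longrightarrow> Sigma_cond S \<omega> $$ (a, b) =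
    (1 / n) * (\<Sum>k<n. \<Sum>l<n. v_hat S k \<omega> $ a * v_hat S l \<omega> $ b * E.s k l \<omega>)"
    using main by (intro AE_finite_allI) auto
  then show ?thesis by eventually_elim auto
qed

subsection \<open>Error bound for a single sample\<close>

text \<open>Each clause restricts a \<open>J\<close>-measurable quantity: determinants stand in for
  smallest eigenvalues, and the mean square of \<open>v_hat\<close> for those of \<open>Q\<close>
  and \<open>V\<close>. The parameter \<zeta> bounds \<open>max |v_hat| / sqrt n\<close>.\<close>

definition regular_event :: "real \<Rightarrow> real \<Rightarrow> real \<Rightarrow> real \<Rightarrow> 'a set" where
  "regular_event B \<kappa>b V \<zeta> = {\<omega>\<in>\<Omega>. det (gram_w S \<omega>) \<noteq> 0 \<and> det (selected_kronecker S \<omega>) \<noteq> 0 \<and>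
     (\<forall>k\<in>{..<n}. nn_cond_exp (Pr S) J (\<lambda>\<omega>. ennreal (uv S k \<omega> ^ 4)) \<omega> \<le> ennreal B) \<and>
     kappa_CR_norm S \<omega> \<le> \<kappa>b \<and> (1 / n) * (\<Sum>i<n. \<Sum>a<d. (v_hat S i \<omega> $ a)\<^sup>2) \<le> V \<and>
     (\<forall>i\<in>{..<n}. (vec_norm (v_hat S i \<omega>))\<^sup>2 \<le> \<zeta>\<^sup>2 * real n)}"

lemma regular_event_J:
  fixes B \<kappa>b V \<zeta> :: real
  shows "regular_event B \<kappa>b V \<zeta> \<in> sets J"
proof -
  have "{\<omega>\<in>space J. det (gram_w S \<omega>) \<noteq> 0} \<in> sets J" "{\<omega>\<in>space J. det (selected_kronecker S \<omega>) \<noteq> 0} \<in> sets J"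
    "{\<omega>\<in>space J. kappa_CR_norm S \<omega> \<le> \<kappa>b} \<in> sets J"
    by measurable
  moreover have "(\<lambda>\<omega>. (1 / real n) * (\<Sum>i<n. \<Sum>a<d. (v_hat S i \<omega> $ a)\<^sup>2)) \<in> borel_measurable J"
    by (intro borel_measurable_times borel_measurable_const borel_measurable_sum borel_measurable_power v_hat_J) auto
  then have "{\<omega>\<in>space J. (1 / n) * (\<Sum>i<n. \<Sum>a<d. (v_hat S i \<omega> $ a)\<^sup>2) \<le> V} \<in> sets J" by measurable
  moreover have "{\<omega>\<in>space J. \<forall>k\<in>{..<n}. nn_cond_exp (Pr S) J (\<lambda>\<omega>. ennreal (uv S k \<omega> ^ 4)) \<omega> \<le> ennreal B} \<in> sets J"
    by (intro sets.sets_Collect_finite_All borel_measurable_le borel_measurable_nn_cond_exp) auto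
  moreover have "{\<omega>\<in>space J. \<forall>i\<in>{..<n}. (vec_norm (v_hat S i \<omega>))\<^sup>2 \<le> \<zeta>\<^sup>2 * real n} \<in> sets J"
    by (intro sets.sets_Collect_finite_All borel_measurable_le borel_measurable_power vec_norm_v_hat_J) auto
  ultimately show ?thesis
    unfolding regular_event_def space_J[symmetric] by (intro sets.sets_Collect_conj) (simp_all only: space_J)
qed

lemma regular_eventI:
  assumes \<omega>: "\<omega> \<in> \<Omega>" and n: "n > 0" and B: "B \<ge> 0" "B4 \<ge> 0" "B5 \<ge> 0"
    and gram: "lambda_min (gram_w S \<omega>) > 0" and sel: "lambda_min (selected_kronecker S \<omega>) > 0"
    and C: "C_moment S \<omega> \<le> ennreal B" and k: "kappa_CR_norm S \<omega> \<le> \<kappa>b"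
    and dec: "\<forall>i<n. \<forall>a<d. v_pop S i \<omega> $ a = Q_vec S i \<omega> $ a + V_vec S i \<omega> $ a"
    and Q: "Q_mean_square \<omega> \<le> ennreal B4" and V: "V_mean_square B \<omega> \<le> ennreal B5"
    and max: "(MAX i\<in>{..<n}. vec_norm (v_hat S i \<omega>)) / sqrt (real n) \<le> \<zeta>"
  shows "\<omega> \<in> regular_event B \<kappa>b (2 * (B4 + B5)) \<zeta>"
proof -
  have dg: "det (gram_w S \<omega>) \<noteq> 0" by (rule lambda_min_pos_det[OF gram_w_carrier gram])
  have ds: "det (selected_kronecker S \<omega>) \<noteq> 0" by (rule lambda_min_pos_det[OF selected_kronecker_carrier sel])
  have VB: "\<omega> \<in> V_moment_event B"
    unfolding V_moment_event_def using \<omega> C_moment_ge(2)[of _ \<omega>] C by (auto intro: order_trans)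
  have "(1 / n) * (\<Sum>i<n. \<Sum>a<d. (v_hat S i \<omega> $ a)\<^sup>2) \<le> 2 * (B4 + B5)"
    by (rule v_hat_mean_square_le[OF \<omega> n dg dec Q B(2) V VB B(3)])
  moreover have "(vec_norm (v_hat S i \<omega>))\<^sup>2 \<le> \<zeta>\<^sup>2 * real n" if i: "i < n" for i
  proof -
    have "vec_norm (v_hat S i \<omega>) \<le> (MAX i\<in>{..<n}. vec_norm (v_hat S i \<omega>))" using i by (intro Max_ge) auto
    also have "\<dots> \<le> \<zeta> * sqrt (real n)" using max n by (simp add: pos_divide_le_eq)
    finally have "(vec_norm (v_hat S i \<omega>))\<^sup>2 \<le> (\<zeta> * sqrt (real n))\<^sup>2"
      by (rule power_mono) (simp add: vec_norm_eq[OF v_hat_carrier] sum_nonneg)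
    then show ?thesis by (simp add: power_mult_distrib)
  qed
  moreover have "nn_cond_exp (Pr S) J (\<lambda>\<omega>. ennreal (uv S i \<omega> ^ 4)) \<omega> \<le> ennreal B" if "i < n" for i
    using C_moment_ge(1)[OF that, of \<omega>] C by (rule order_trans)
  ultimately show ?thesis unfolding regular_event_def using \<omega> dg ds k by auto
qed

text \<open>\<open>weight\<close> and \<open>form\<close> are \<open>w\<close> and \<open>H\<close>
  as functions on the whole space, needed for measurability; the locale of \<open>w\<close> and
  \<open>H\<close> can be entered only at points of the regular event.\<close>

definition weight :: "nat \<Rightarrow> nat \<Rightarrow> 'a \<Rightarrow> nat \<times> nat \<Rightarrow> real" where
  "weight a b \<omega> p = (\<Sum>q\<in>pairs. \<kappa> \<omega> q p * (v_hat S (fst q) \<omega> $ a * v_hat S (snd q) \<omega> $ b))"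

definition form :: "nat \<Rightarrow> nat \<Rightarrow> 'a \<Rightarrow> nat \<Rightarrow> nat \<Rightarrow> real" where
  "form a b \<omega> k l = (\<Sum>p\<in>pairs. weight a b \<omega> p * MM \<omega> (fst p) k * MM \<omega> (snd p) l)"

lemma pairs_less: "p \<in> pairs \<Longrightarrow> fst p < n" "p \<in> pairs \<Longrightarrow> snd p < n"
  unfolding pairs_def by auto

lemma weight_J: "a < d \<Longrightarrow> b < d \<Longrightarrow> p \<in> pairs \<Longrightarrow> (\<lambda>\<omega>. weight a b \<omega> p) \<in> borel_measurable J"
  unfolding weight_def
  by (intro borel_measurable_sum borel_measurable_times kappa_J v_hat_J pairs_less)

lemma form_J: "a < d \<Longrightarrow> b < d \<Longrightarrow> k < n \<Longrightarrow> l < n \<Longrightarrow> (\<lambda>\<omega>. form a b \<omega> k l) \<in> borel_measurable J"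
  unfolding form_def
  by (intro borel_measurable_sum borel_measurable_times weight_J MM_J pairs_less)

context
  fixes B \<kappa>b V \<zeta> :: real
  assumes B: "B \<ge> 0" and \<kappa>b: "\<kappa>b \<ge> 0" and V: "V > 0" and n: "n > 0" and c: "c > 0"
begin

abbreviation "A \<equiv> regular_event B \<kappa>b V \<zeta>"

lemma A_J[measurable]: "A \<in> sets J" by (rule regular_event_J)

lemma A_events[measurable]: "A \<in> events" using A_J subalgebra_J unfolding subalgebra_def by blast

interpretation E: clustered_errors "Pr S" J "\<lambda>k. K (cof k)" "err A" n cof B c
  by (rule clustered_errors_err[OF A_J B]) (auto simp: regular_event_def)

lemma A_D:
  assumes "\<omega> \<in> A"
  shows "\<omega> \<in> \<Omega>" "det (gram_w S \<omega>) \<noteq> 0" "det (selected_kronecker S \<omega>) \<noteq> 0" "kappa_CR_norm S \<omega> \<le> \<kappa>b"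
    "(1 / n) * (\<Sum>i<n. \<Sum>a<d. (v_hat S i \<omega> $ a)\<^sup>2) \<le> V"
    "\<And>i. i < n \<Longrightarrow> (\<Sum>a<d. (v_hat S i \<omega> $ a)\<^sup>2) \<le> \<zeta>\<^sup>2 * real n"
  using assms unfolding regular_event_def vec_norm_square[OF v_hat_carrier] by auto

lemma v_hat_square_le:
  assumes "\<omega> \<in> A" "i < n" "a < d" shows "(v_hat S i \<omega> $ a)\<^sup>2 \<le> \<zeta>\<^sup>2 * real n"
proof -
  have "(v_hat S i \<omega> $ a)\<^sup>2 \<le> (\<Sum>a<d. (v_hat S i \<omega> $ a)\<^sup>2)"
    using assms(3) by (intro member_le_sum) auto
  then show ?thesis using A_D(6)[OF assms(1,2)] by linarith
qed

lemma v_hat_coordinate_sum_le: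
  assumes "\<omega> \<in> A" "a < d" shows "(\<Sum>i<n. (v_hat S i \<omega> $ a)\<^sup>2) \<le> n * V"
proof -
  have "(\<Sum>i<n. (v_hat S i \<omega> $ a)\<^sup>2) \<le> (\<Sum>i<n. \<Sum>a<d. (v_hat S i \<omega> $ a)\<^sup>2)"
    using assms(2) by (intro sum_mono member_le_sum) auto
  also have "\<dots> = n * ((1 / n) * (\<Sum>i<n. \<Sum>a<d. (v_hat S i \<omega> $ a)\<^sup>2))" using n by simp
  also have "\<dots> \<le> n * V" by (intro mult_left_mono A_D(5)[OF assms(1)]) simp
  finally show ?thesis .
qed

text \<open>The bound of \<open>w_sum_bound\<close> divided by \<open>n\<close>: every coordinate of
  \<open>v_hat\<close> has square sum at most \<open>n * V\<close>.\<close>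

definition K1 :: real where "K1 = \<kappa>b * c * V"

lemma K1: "K1 \<ge> 0" unfolding K1_def using \<kappa>b V by simp

context
  fixes a b :: nat
  assumes ab: "a < d" "b < d"
begin

text \<open>For the third bound, the sum of squared weights is at most their maximum
  \<open>\<kappa>b * (\<zeta>\<^sup>2 * n)\<close> times their sum \<open>n * K1\<close>. Division
  by \<open>n\<^sup>2\<close> leaves the factor \<open>\<zeta>\<^sup>2\<close> that makes the
  fluctuation small.\<close>

lemma pointwise_bounds:
  assumes \<omega>: "\<omega> \<in> A"
  shows "\<And>p. p \<in> pairs \<Longrightarrow> \<bar>weight a b \<omega> p\<bar> \<le> \<kappa>b * (\<zeta>\<^sup>2 * real n)"
    "(\<Sum>p\<in>pairs. \<bar>weight a b \<omega> p\<bar>) \<le> n * K1"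
    "(\<Sum>k<n. \<Sum>l<n. (form a b \<omega> k l / n)\<^sup>2) \<le> \<kappa>b * \<zeta>\<^sup>2 * K1"
proof -
  interpret cluster_kappa n "MM \<omega>" pairs c "\<kappa> \<omega>" \<kappa>b "\<lambda>i. v_hat S i \<omega> $ a" "\<lambda>i. v_hat S i \<omega> $ b"
    by (rule kappa_kappa[OF A_D(1-3)[OF \<omega>] cluster_card A_D(4)[OF \<omega>] \<kappa>b])
  have w: "weight a b \<omega> = w" unfolding w_def[abs_def] weight_def[abs_def] ..
  have f: "form a b \<omega> = H" unfolding H_def[abs_def] form_def[abs_def] w ..
  show wb: "\<bar>weight a b \<omega> p\<bar> \<le> \<kappa>b * (\<zeta>\<^sup>2 * real n)" if "p \<in> pairs" for p
    unfolding w by (rule w_bound[OF that]) (use v_hat_square_le[OF \<omega>] ab in auto)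
  have "(\<Sum>p\<in>pairs. \<bar>weight a b \<omega> p\<bar>) \<le> \<kappa>b * (c * ((\<Sum>i<n. (v_hat S i \<omega> $ a)\<^sup>2) + (\<Sum>i<n. (v_hat S i \<omega> $ b)\<^sup>2)) / 2)"
    unfolding w by (rule w_sum_bound)
  also have "\<dots> \<le> \<kappa>b * (c * (n * V + n * V) / 2)"
    using v_hat_coordinate_sum_le[OF \<omega>] ab \<kappa>b
    by (intro mult_left_mono divide_right_mono add_mono) auto
  also have "\<dots> = n * K1" unfolding K1_def by simp
  finally show ws: "(\<Sum>p\<in>pairs. \<bar>weight a b \<omega> p\<bar>) \<le> n * K1" .
  have "(\<Sum>k<n. \<Sum>l<n. (form a b \<omega> k l)\<^sup>2) \<le> (\<Sum>p\<in>pairs. (weight a b \<omega> p)\<^sup>2)"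
    unfolding w f by (rule H_square_sum_le)
  also have "\<dots> \<le> (\<Sum>p\<in>pairs. \<kappa>b * (\<zeta>\<^sup>2 * real n) * \<bar>weight a b \<omega> p\<bar>)"
  proof (rule sum_mono)
    fix p assume "p \<in> pairs"
    then have "\<bar>weight a b \<omega> p\<bar> * \<bar>weight a b \<omega> p\<bar> \<le> \<kappa>b * (\<zeta>\<^sup>2 * real n) * \<bar>weight a b \<omega> p\<bar>"
      by (intro mult_right_mono wb) auto
    then show "(weight a b \<omega> p)\<^sup>2 \<le> \<kappa>b * (\<zeta>\<^sup>2 * real n) * \<bar>weight a b \<omega> p\<bar>" by (simp add: power2_eq_square)
  qed
  also have "\<dots> \<le> \<kappa>b * (\<zeta>\<^sup>2 * real n) * (n * K1)"
    unfolding sum_distrib_left[symmetric] using ws \<kappa>b by (intro mult_left_mono) auto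
  finally have "(\<Sum>k<n. \<Sum>l<n. (form a b \<omega> k l)\<^sup>2) / n\<^sup>2 \<le> \<kappa>b * (\<zeta>\<^sup>2 * real n) * (n * K1) / n\<^sup>2"
    by (rule divide_right_mono) simp
  also have "\<dots> = \<kappa>b * \<zeta>\<^sup>2 * K1" using n by (simp add: power2_eq_square)
  finally show "(\<Sum>k<n. \<Sum>l<n. (form a b \<omega> k l / n)\<^sup>2) \<le> \<kappa>b * \<zeta>\<^sup>2 * K1"
    by (simp add: power_divide sum_divide_distrib)
qed

text \<open>On \<open>A\<close> this is, almost surely, the error of the estimator that uses
  \<open>M u\<close> in place of \<open>u_hat\<close>.\<close>

definition fluctuation :: "'a \<Rightarrow> real" where
  "fluctuation \<omega> = (\<Sum>k<n. \<Sum>l<n. indicator A \<omega> * (form a b \<omega> k l / n) * E.Z k l \<omega>)"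

text \<open>On \<open>A\<close> this is the weighted mean of the squares of \<open>M u\<close> that
  appears in \<open>estimator_error_bound\<close>. The root of the weight is put inside, so that
  each summand is the square of a linear form in the errors with \<open>J\<close>-measurable
  coefficients.\<close>

definition residual_term :: "'a \<Rightarrow> real" where
  "residual_term \<omega> = (1 / n) * (\<Sum>p\<in>pairs. (\<Sum>k<n. indicator A \<omega> * sqrt \<bar>weight a b \<omega> p\<bar> * MM \<omega> (fst p) k * err A k \<omega>)\<^sup>2
      + (\<Sum>k<n. indicator A \<omega> * sqrt \<bar>weight a b \<omega> p\<bar> * MM \<omega> (snd p) k * err A k \<omega>)\<^sup>2)"

lemma fluctuation_measurable: "fluctuation \<in> borel_measurable (Pr S)"
proof -
  have "E.Z k l \<in> borel_measurable (Pr S)" if "k < n" "l < n" for k l using that by simp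
  then show ?thesis unfolding fluctuation_def[abs_def]
    by (intro borel_measurable_sum borel_measurable_times borel_measurable_divide borel_measurable_const
        borel_measurable_indicator A_events from_J[OF form_J] ab) auto
qed

lemma nn_integral_fluctuation:
  "(\<integral>\<^sup>+\<omega>. ennreal ((fluctuation \<omega>)\<^sup>2) \<partial>Pr S) \<le> ennreal (2 * (real c)\<^sup>2 * (2 * B + 2 * (1 + B)\<^sup>2) * (\<kappa>b * \<zeta>\<^sup>2 * K1))"
proof -
  let ?\<eta> = "\<kappa>b * \<zeta>\<^sup>2 * K1"
  define h where "h k l \<omega> = indicator A \<omega> * (form a b \<omega> k l / n)" for k l \<omega>
  have \<eta>: "?\<eta> \<ge> 0" using \<kappa>b K1 by simp
  have hm: "h k l \<in> borel_measurable J" if "k < n" "l < n" for k l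
    unfolding h_def[abs_def]
    by (intro borel_measurable_times borel_measurable_divide borel_measurable_const
        borel_measurable_indicator A_J form_J ab that)
  have sum_le: "(\<Sum>k<n. \<Sum>l<n. (h k l \<omega>)\<^sup>2) \<le> ?\<eta>" for \<omega>
    using pointwise_bounds(3)[of \<omega>] \<eta> unfolding h_def by (cases "\<omega> \<in> A") auto
  \<comment> \<open>An entry is dominated by the Frobenius norm; this gives the uniform bound on
    coefficients required for integrability.\<close>
  have hC: "\<bar>h k l \<omega>\<bar> \<le> sqrt ?\<eta>" if "k < n" "l < n" for k l \<omega>
  proof -
    have "(h k l \<omega>)\<^sup>2 \<le> (\<Sum>l<n. (h k l \<omega>)\<^sup>2)" using that by (intro member_le_sum) auto
    also have "\<dots> \<le> (\<Sum>k<n. \<Sum>l<n. (h k l \<omega>)\<^sup>2)"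
      using that by (intro member_le_sum[of k _ "\<lambda>k. \<Sum>l<n. (h k l \<omega>)\<^sup>2"]) (auto intro: sum_nonneg)
    finally have "(h k l \<omega>)\<^sup>2 \<le> ?\<eta>" using sum_le[of \<omega>] by linarith
    then show ?thesis using real_sqrt_le_mono by fastforce
  qed
  note q = E.quadratic_form_second_moment[of h "sqrt ?\<eta>", OF hm hC]
  have eq: "fluctuation \<omega> = (\<Sum>k<n. \<Sum>l<n. h k l \<omega> * E.Z k l \<omega>)" for \<omega>
    unfolding fluctuation_def h_def ..
  have "(\<integral>\<omega>. (\<Sum>k<n. \<Sum>l<n. (h k l \<omega>)\<^sup>2) \<partial>Pr S) \<le> (\<integral>\<omega>. ?\<eta> \<partial>Pr S)"
  proof (rule integral_mono)
    show "integrable (Pr S) (\<lambda>\<omega>. \<Sum>k<n. \<Sum>l<n. (h k l \<omega>)\<^sup>2)"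
    proof (rule integrable_const_bound[where B="?\<eta>"])
      show "AE \<omega> in Pr S. norm (\<Sum>k<n. \<Sum>l<n. (h k l \<omega>)\<^sup>2) \<le> ?\<eta>"
        using sum_le by (auto simp: sum_nonneg)
    qed (intro borel_measurable_sum borel_measurable_power from_J[OF hm]; simp)
  qed (use sum_le in auto)
  then have "(\<integral>\<omega>. (\<Sum>k<n. \<Sum>l<n. (h k l \<omega>)\<^sup>2) \<partial>Pr S) \<le> ?\<eta>" by (simp add: prob_space)
  then have "2 * (real c)\<^sup>2 * (2 * B + 2 * (1 + B)\<^sup>2) * (\<integral>\<omega>. (\<Sum>k<n. \<Sum>l<n. (h k l \<omega>)\<^sup>2) \<partial>Pr S)
      \<le> 2 * (real c)\<^sup>2 * (2 * B + 2 * (1 + B)\<^sup>2) * ?\<eta>"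
    using B by (intro mult_left_mono) auto
  then have le: "(\<integral>\<omega>. (fluctuation \<omega>)\<^sup>2 \<partial>Pr S) \<le> 2 * (real c)\<^sup>2 * (2 * B + 2 * (1 + B)\<^sup>2) * ?\<eta>"
    using q(2) unfolding eq by linarith
  have "(\<integral>\<^sup>+\<omega>. ennreal ((fluctuation \<omega>)\<^sup>2) \<partial>Pr S) = ennreal (\<integral>\<omega>. (fluctuation \<omega>)\<^sup>2 \<partial>Pr S)"
    using q(1) unfolding eq by (intro nn_integral_eq_integral) auto
  then show ?thesis using le by (simp add: ennreal_leI)
qed

text \<open>A row of \<open>MM\<close> has square sum at most 1, so the coefficients of each linear
  form have square sum at most the weight, and the weights add up to at most \<open>n * K1\<close>.
  The factor 2 counts the two indices of a pair, and the bound on the mean is free of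
  \<zeta>.\<close>

lemma residual_term_bounds:
  "residual_term \<in> borel_measurable (Pr S)"
  "(\<integral>\<^sup>+\<omega>. ennreal (residual_term \<omega>) \<partial>Pr S) \<le> ennreal (2 * c * (1 + B) * K1)"
  "\<And>\<omega>. residual_term \<omega> \<ge> 0"
proof -
  define \<alpha> where "\<alpha> i p k \<omega> = indicator A \<omega> * sqrt \<bar>weight a b \<omega> p\<bar> * MM \<omega> i k" for i p k \<omega>
  define D where "D = sqrt (\<kappa>b * (\<zeta>\<^sup>2 * real n))"
  have am: "\<alpha> i p k \<in> borel_measurable J" if "i < n" "p \<in> pairs" "k < n" for i p k
  proof -
    note [measurable] = weight_J[OF ab that(2)] MM_J[OF that(1,3)]
    show ?thesis unfolding \<alpha>_def[abs_def] by measurable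
  qed
  have row: "(\<Sum>k<n. (\<alpha> i p k \<omega>)\<^sup>2) \<le> indicator A \<omega> * \<bar>weight a b \<omega> p\<bar>" if "i < n" for i p \<omega>
  proof (cases "\<omega> \<in> A")
    case True
    interpret orthogonal_projection n "MM \<omega>" by (rule MM_projection[OF A_D(1,2)[OF True]])
    have "(\<Sum>k<n. (\<alpha> i p k \<omega>)\<^sup>2) = \<bar>weight a b \<omega> p\<bar> * (\<Sum>k<n. (MM \<omega> i k)\<^sup>2)"
      using True by (simp add: \<alpha>_def power_mult_distrib sum_distrib_left)
    also have "\<dots> \<le> \<bar>weight a b \<omega> p\<bar> * 1" by (intro mult_left_mono row_square_sum_le that) simp
    finally show ?thesis using True by simp
  qed (simp add: \<alpha>_def)
  have aC: "\<bar>\<alpha> i p k \<omega>\<bar> \<le> D" if "i < n" "p \<in> pairs" "k < n" for i p k \<omega>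
  proof -
    have "(\<alpha> i p k \<omega>)\<^sup>2 \<le> (\<Sum>k<n. (\<alpha> i p k \<omega>)\<^sup>2)" using that by (intro member_le_sum) auto
    also have "\<dots> \<le> indicator A \<omega> * \<bar>weight a b \<omega> p\<bar>" by (rule row[OF that(1)])
    also have "\<dots> \<le> \<kappa>b * (\<zeta>\<^sup>2 * real n)" using pointwise_bounds(1)[OF _ that(2)] \<kappa>b by (cases "\<omega> \<in> A") auto
    finally show ?thesis unfolding D_def using real_sqrt_le_mono by fastforce
  qed
  have wi: "integrable (Pr S) (\<lambda>\<omega>. indicator A \<omega> * \<bar>weight a b \<omega> p\<bar>)" if "p \<in> pairs" for p
  proof (rule integrable_const_bound[where B="\<kappa>b * (\<zeta>\<^sup>2 * real n)"])
    show "AE \<omega> in Pr S. norm (indicator A \<omega> * \<bar>weight a b \<omega> p\<bar>) \<le> \<kappa>b * (\<zeta>\<^sup>2 * real n)"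
    proof (rule AE_I2)
      fix \<omega> show "norm (indicator A \<omega> * \<bar>weight a b \<omega> p\<bar>) \<le> \<kappa>b * (\<zeta>\<^sup>2 * real n)"
        using pointwise_bounds(1)[OF _ that] \<kappa>b by (cases "\<omega> \<in> A") auto
    qed
  qed (intro borel_measurable_times borel_measurable_indicator A_events borel_measurable_abs from_J[OF weight_J] ab that)
  have one: "integrable (Pr S) (\<lambda>\<omega>. (\<Sum>k<n. \<alpha> i p k \<omega> * err A k \<omega>)\<^sup>2)"
    "(\<integral>\<omega>. (\<Sum>k<n. \<alpha> i p k \<omega> * err A k \<omega>)\<^sup>2 \<partial>Pr S) \<le> c * (1 + B) * (\<integral>\<omega>. indicator A \<omega> * \<bar>weight a b \<omega> p\<bar> \<partial>Pr S)"
    if ip: "i < n" "p \<in> pairs" for i p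
  proof -
    note l = E.linear_form_second_moment[of "\<alpha> i p" D, OF am[OF ip] aC[OF ip]]
    show "integrable (Pr S) (\<lambda>\<omega>. (\<Sum>k<n. \<alpha> i p k \<omega> * err A k \<omega>)\<^sup>2)" by (rule l(1))
    have "(\<integral>\<omega>. (\<Sum>k<n. (\<alpha> i p k \<omega>)\<^sup>2) \<partial>Pr S) \<le> (\<integral>\<omega>. indicator A \<omega> * \<bar>weight a b \<omega> p\<bar> \<partial>Pr S)"
    proof (rule integral_mono[OF _ wi[OF ip(2)] row[OF ip(1)]])
      show "integrable (Pr S) (\<lambda>\<omega>. \<Sum>k<n. (\<alpha> i p k \<omega>)\<^sup>2)"
      proof (rule Bochner_Integration.integrable_bound[OF wi[OF ip(2)]])
        show "AE \<omega> in Pr S. norm (\<Sum>k<n. (\<alpha> i p k \<omega>)\<^sup>2) \<le> norm (indicator A \<omega> * \<bar>weight a b \<omega> p\<bar>)"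
          using row[OF ip(1), of p] by (intro AE_I2) (auto simp: sum_nonneg)
      qed (intro borel_measurable_sum borel_measurable_power from_J[OF am[OF ip]]; simp)
    qed
    then have "c * (1 + B) * (\<integral>\<omega>. (\<Sum>k<n. (\<alpha> i p k \<omega>)\<^sup>2) \<partial>Pr S) \<le> c * (1 + B) * (\<integral>\<omega>. indicator A \<omega> * \<bar>weight a b \<omega> p\<bar> \<partial>Pr S)"
      using B by (intro mult_left_mono) auto
    with l(2) show "(\<integral>\<omega>. (\<Sum>k<n. \<alpha> i p k \<omega> * err A k \<omega>)\<^sup>2 \<partial>Pr S) \<le> c * (1 + B) * (\<integral>\<omega>. indicator A \<omega> * \<bar>weight a b \<omega> p\<bar> \<partial>Pr S)"
      by linarith
  qed
  have eq: "residual_term \<omega> = (1 / n) * (\<Sum>p\<in>pairs. (\<Sum>k<n. \<alpha> (fst p) p k \<omega> * err A k \<omega>)\<^sup>2 + (\<Sum>k<n. \<alpha> (snd p) p k \<omega> * err A k \<omega>)\<^sup>2)" for \<omega>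
    unfolding residual_term_def \<alpha>_def ..
  have i: "integrable (Pr S) residual_term"
    unfolding eq[abs_def] by (intro integrable_mult_right Bochner_Integration.integrable_sum Bochner_Integration.integrable_add one(1) pairs_less)
  then show "residual_term \<in> borel_measurable (Pr S)" by auto
  show pos: "residual_term \<omega> \<ge> 0" for \<omega>
    unfolding eq by (intro mult_nonneg_nonneg sum_nonneg add_nonneg_nonneg) auto
  have "(\<integral>\<omega>. residual_term \<omega> \<partial>Pr S) = (1 / n) * (\<Sum>p\<in>pairs. (\<integral>\<omega>. (\<Sum>k<n. \<alpha> (fst p) p k \<omega> * err A k \<omega>)\<^sup>2 \<partial>Pr S)
      + (\<integral>\<omega>. (\<Sum>k<n. \<alpha> (snd p) p k \<omega> * err A k \<omega>)\<^sup>2 \<partial>Pr S))"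
    unfolding eq using one(1) pairs_less
    by (simp add: Bochner_Integration.integral_sum Bochner_Integration.integral_add)
  also have "\<dots> \<le> (1 / n) * (\<Sum>p\<in>pairs. c * (1 + B) * (\<integral>\<omega>. indicator A \<omega> * \<bar>weight a b \<omega> p\<bar> \<partial>Pr S)
      + c * (1 + B) * (\<integral>\<omega>. indicator A \<omega> * \<bar>weight a b \<omega> p\<bar> \<partial>Pr S))"
    by (intro mult_left_mono sum_mono add_mono one(2) pairs_less) auto
  also have "\<dots> = 2 * c * (1 + B) * ((1 / n) * (\<Sum>p\<in>pairs. (\<integral>\<omega>. indicator A \<omega> * \<bar>weight a b \<omega> p\<bar> \<partial>Pr S)))"
    by (simp only: mult_2[symmetric] sum_distrib_left of_nat_mult of_nat_numeral ac_simps)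
  also have "(\<Sum>p\<in>pairs. (\<integral>\<omega>. indicator A \<omega> * \<bar>weight a b \<omega> p\<bar> \<partial>Pr S)) = (\<integral>\<omega>. (\<Sum>p\<in>pairs. indicator A \<omega> * \<bar>weight a b \<omega> p\<bar>) \<partial>Pr S)"
    by (rule Bochner_Integration.integral_sum[symmetric, OF wi])
  also have "2 * c * (1 + B) * ((1 / n) * (\<integral>\<omega>. (\<Sum>p\<in>pairs. indicator A \<omega> * \<bar>weight a b \<omega> p\<bar>) \<partial>Pr S)) \<le> 2 * c * (1 + B) * ((1 / n) * (n * K1))"
  proof (intro mult_left_mono)
    have "(\<integral>\<omega>. (\<Sum>p\<in>pairs. indicator A \<omega> * \<bar>weight a b \<omega> p\<bar>) \<partial>Pr S) \<le> (\<integral>\<omega>. n * K1 \<partial>Pr S)"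
    proof (rule integral_mono)
      show "integrable (Pr S) (\<lambda>\<omega>. \<Sum>p\<in>pairs. indicator A \<omega> * \<bar>weight a b \<omega> p\<bar>)"
        by (intro Bochner_Integration.integrable_sum wi)
      show "(\<Sum>p\<in>pairs. indicator A \<omega> * \<bar>weight a b \<omega> p\<bar>) \<le> n * K1" for \<omega>
        using pointwise_bounds(2)[of \<omega>] K1 by (cases "\<omega> \<in> A") auto
    qed simp
    then show "(\<integral>\<omega>. (\<Sum>p\<in>pairs. indicator A \<omega> * \<bar>weight a b \<omega> p\<bar>) \<partial>Pr S) \<le> n * K1" by (simp add: prob_space)
  qed (use B in auto)
  finally have "(\<integral>\<omega>. residual_term \<omega> \<partial>Pr S) \<le> 2 * c * (1 + B) * K1" using n by simp
  then show "(\<integral>\<^sup>+\<omega>. ennreal (residual_term \<omega>) \<partial>Pr S) \<le> ennreal (2 * c * (1 + B) * K1)"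
    using i pos by (subst nn_integral_eq_integral) (auto intro: ennreal_leI)
qed

end

definition score_norm :: "'a \<Rightarrow> real" where
  "score_norm \<omega> = (\<Sum>a<d. (\<Sum>i<n. indicator A \<omega> * ((1 / sqrt n) * v_hat S i \<omega> $ a) * err A i \<omega>)\<^sup>2)"

text \<open>The normalisation by \<open>1 / sqrt n\<close> gives the coefficients a total square sum
  of at most \<open>V\<close>, so the bound on the mean involves neither \<open>n\<close> nor
  \<zeta>.\<close>

lemma score_norm_bounds:
  "score_norm \<in> borel_measurable (Pr S)"
  "(\<integral>\<^sup>+\<omega>. ennreal (score_norm \<omega>) \<partial>Pr S) \<le> ennreal (c * (1 + B) * V)"
proof -
  define \<alpha> where "\<alpha> a i \<omega> = indicator A \<omega> * ((1 / sqrt n) * v_hat S i \<omega> $ a)" for a i \<omega>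
  have am: "\<alpha> a i \<in> borel_measurable J" if "a < d" "i < n" for a i
    unfolding \<alpha>_def[abs_def]
    by (intro borel_measurable_times borel_measurable_indicator A_J borel_measurable_const v_hat_J that)
  have sum_le: "(\<Sum>a<d. \<Sum>i<n. (\<alpha> a i \<omega>)\<^sup>2) \<le> V" for \<omega>
  proof (cases "\<omega> \<in> A")
    case True
    have "(\<Sum>a<d. \<Sum>i<n. (\<alpha> a i \<omega>)\<^sup>2) = (1 / n) * (\<Sum>i<n. \<Sum>a<d. (v_hat S i \<omega> $ a)\<^sup>2)"
      using True by (subst sum.swap) (simp add: \<alpha>_def power_divide sum_divide_distrib)
    then show ?thesis using A_D(5)[OF True] by simp
  qed (use V in \<open>simp add: \<alpha>_def\<close>)
  have sq: "(\<alpha> a i \<omega>)\<^sup>2 \<le> V" if "a < d" "i < n" for a i \<omega>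
  proof -
    have "(\<alpha> a i \<omega>)\<^sup>2 \<le> (\<Sum>i<n. (\<alpha> a i \<omega>)\<^sup>2)" using that by (intro member_le_sum) auto
    also have "\<dots> \<le> (\<Sum>a<d. \<Sum>i<n. (\<alpha> a i \<omega>)\<^sup>2)"
      using that by (intro member_le_sum[of a _ "\<lambda>a. \<Sum>i<n. (\<alpha> a i \<omega>)\<^sup>2"]) (auto intro: sum_nonneg)
    finally show ?thesis using sum_le[of \<omega>] by linarith
  qed
  have aC: "\<bar>\<alpha> a i \<omega>\<bar> \<le> sqrt V" if "a < d" "i < n" for a i \<omega>
    using real_sqrt_le_mono[OF sq[OF that]] by simp
  have sqi: "integrable (Pr S) (\<lambda>\<omega>. \<Sum>i<n. (\<alpha> a i \<omega>)\<^sup>2)" if a: "a < d" for a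
  proof (rule Bochner_Integration.integrable_sum)
    fix i assume "i \<in> {..<n}"
    then have i: "i < n" by simp
    show "integrable (Pr S) (\<lambda>\<omega>. (\<alpha> a i \<omega>)\<^sup>2)"
      by (rule integrable_const_bound[where B=V])
         (use sq[OF a i] from_J[OF am[OF a i]] in auto)
  qed
  have l: "integrable (Pr S) (\<lambda>\<omega>. (\<Sum>i<n. \<alpha> a i \<omega> * err A i \<omega>)\<^sup>2)"
    "(\<integral>\<omega>. (\<Sum>i<n. \<alpha> a i \<omega> * err A i \<omega>)\<^sup>2 \<partial>Pr S) \<le> c * (1 + B) * (\<integral>\<omega>. (\<Sum>i<n. (\<alpha> a i \<omega>)\<^sup>2) \<partial>Pr S)" if "a < d" for a
    using E.linear_form_second_moment[of "\<alpha> a" "sqrt V", OF am[OF that] aC[OF that]] by auto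
  have eq: "score_norm \<omega> = (\<Sum>a<d. (\<Sum>i<n. \<alpha> a i \<omega> * err A i \<omega>)\<^sup>2)" for \<omega>
    unfolding score_norm_def \<alpha>_def ..
  have i: "integrable (Pr S) score_norm" unfolding eq[abs_def]
    by (intro Bochner_Integration.integrable_sum l) simp
  then show "score_norm \<in> borel_measurable (Pr S)" by auto
  have "(\<integral>\<omega>. score_norm \<omega> \<partial>Pr S) = (\<Sum>a<d. (\<integral>\<omega>. (\<Sum>i<n. \<alpha> a i \<omega> * err A i \<omega>)\<^sup>2 \<partial>Pr S))"
    unfolding eq by (rule Bochner_Integration.integral_sum) (simp add: l(1))
  also have "\<dots> \<le> (\<Sum>a<d. c * (1 + B) * (\<integral>\<omega>. (\<Sum>i<n. (\<alpha> a i \<omega>)\<^sup>2) \<partial>Pr S))"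
    by (intro sum_mono l(2)) simp
  also have "\<dots> = c * (1 + B) * (\<Sum>a<d. (\<integral>\<omega>. (\<Sum>i<n. (\<alpha> a i \<omega>)\<^sup>2) \<partial>Pr S))" by (simp add: sum_distrib_left)
  also have "(\<Sum>a<d. (\<integral>\<omega>. (\<Sum>i<n. (\<alpha> a i \<omega>)\<^sup>2) \<partial>Pr S)) = (\<integral>\<omega>. (\<Sum>a<d. \<Sum>i<n. (\<alpha> a i \<omega>)\<^sup>2) \<partial>Pr S)"
    by (rule Bochner_Integration.integral_sum[symmetric]) (simp add: sqi)
  also have "c * (1 + B) * \<dots> \<le> c * (1 + B) * V"
  proof (rule mult_left_mono)
    have "(\<integral>\<omega>. (\<Sum>a<d. \<Sum>i<n. (\<alpha> a i \<omega>)\<^sup>2) \<partial>Pr S) \<le> (\<integral>\<omega>. V \<partial>Pr S)"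
      by (rule integral_mono) (use sum_le sqi in \<open>auto intro!: Bochner_Integration.integrable_sum[of _ _ "\<lambda>a \<omega>. \<Sum>i<n. (\<alpha> a i \<omega>)\<^sup>2"]\<close>)
    then show "(\<integral>\<omega>. (\<Sum>a<d. \<Sum>i<n. (\<alpha> a i \<omega>)\<^sup>2) \<partial>Pr S) \<le> V" by (simp add: prob_space)
  qed (use B in auto)
  finally have le: "(\<integral>\<omega>. score_norm \<omega> \<partial>Pr S) \<le> c * (1 + B) * V" .
  have "score_norm \<omega> \<ge> 0" for \<omega> unfolding score_norm_def by (intro sum_nonneg) auto
  then show "(\<integral>\<^sup>+\<omega>. ennreal (score_norm \<omega>) \<partial>Pr S) \<le> ennreal (c * (1 + B) * V)"
    using i le by (subst nn_integral_eq_integral) (auto intro: ennreal_leI)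
qed

text \<open>Let \<open>\<Lambda> = (c * (1 + B))\<^sup>2 * L\<^sup>2 * V\<close>. The estimation
  error of \<open>beta_hat\<close> is at most \<open>\<Lambda> * sqrt (R8 / n)\<close> and
  \<open>|v_hat|\<close> is at most \<open>\<zeta> * sqrt n\<close>. Hence residuals differ from
  \<open>M u\<close> by at most \<open>\<zeta> * \<Lambda> * sqrt R8\<close>.\<close>

lemma entry_error_bound:
  assumes model: "linear_model S \<beta> \<gamma>" and ab: "a < d" "b < d" and L: "L > 0" and \<zeta>: "\<zeta> \<ge> 0" and R: "R8 \<ge> 0"
  shows "AE \<omega> in Pr S. \<omega> \<in> A \<longrightarrow> inverse_norm (Sigma_cond S \<omega>) \<le> ennreal L \<longrightarrow>
    residual_term a b \<omega> \<le> R7 \<longrightarrow> score_norm \<omega> \<le> R8 \<longrightarrow>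
    \<bar>Sigma_hat_CR S \<omega> $$ (a, b) - Sigma_cond S \<omega> $$ (a, b)\<bar> \<le> \<bar>fluctuation a b \<omega>\<bar>
      + (\<zeta> * ((c * (1 + B))\<^sup>2 * L\<^sup>2 * V) * sqrt R8) * (2 * K1 + R7)
      + (\<zeta> * ((c * (1 + B))\<^sup>2 * L\<^sup>2 * V) * sqrt R8)\<^sup>2 * K1"
proof -
  have vb: "\<bar>v_hat S i \<omega> $ a\<bar> \<le> sqrt (\<zeta>\<^sup>2 * real n)" if "\<omega> \<in> A" "i < n" "a < d" for \<omega> i a
    using real_sqrt_le_mono[OF v_hat_square_le[OF that]] by simp
  have "AE \<omega> in Pr S. \<forall>k\<in>{..<n}. \<forall>l\<in>{..<n}. \<bar>E.s k l \<omega>\<bar> \<le> 1 + B"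
    by (intro AE_finite_allI E.s_bound) auto
  moreover have "AE \<omega> in Pr S. \<forall>k\<in>{..<n}. \<forall>l\<in>{..<n}. cof k \<noteq> cof l \<longrightarrow> E.s k l \<omega> = 0"
  proof (intro AE_finite_allI)
    fix k l assume "k \<in> {..<n}" "l \<in> {..<n}"
    then show "AE \<omega> in Pr S. cof k \<noteq> cof l \<longrightarrow> E.s k l \<omega> = 0"
      using E.s_cross[of k l] by (cases "cof k = cof l") auto
  qed auto
  moreover have "AE \<omega> in Pr S. \<omega> \<in> A \<longrightarrow> (\<forall>a<d. \<forall>b<d. Sigma_cond S \<omega> $$ (a, b) =
    (1 / n) * (\<Sum>k<n. \<Sum>l<n. v_hat S k \<omega> $ a * v_hat S l \<omega> $ b * E.s k l \<omega>))"
    by (rule Sigma_cond_eq[OF A_J E.clustered_errors_axioms vb]) auto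
  ultimately show ?thesis
  proof eventually_elim
    case (elim \<omega>)
    show ?case
    proof (intro impI)
      assume \<omega>: "\<omega> \<in> A" and Ln: "inverse_norm (Sigma_cond S \<omega>) \<le> ennreal L"
        and R7: "residual_term a b \<omega> \<le> R7" and R8: "score_norm \<omega> \<le> R8"
      interpret cluster_kappa n "MM \<omega>" pairs c "\<kappa> \<omega>" \<kappa>b "\<lambda>i. v_hat S i \<omega> $ a" "\<lambda>i. v_hat S i \<omega> $ b"
        by (rule kappa_kappa[OF A_D(1-3)[OF \<omega>] cluster_card A_D(4)[OF \<omega>] \<kappa>b])
      have w: "weight a b \<omega> = w" unfolding w_def[abs_def] weight_def[abs_def] ..
      have f: "form a b \<omega> = H" unfolding H_def[abs_def] form_def[abs_def] w ..
      let ?v = "\<lambda>i a. v_hat S i \<omega> $ a" and ?s = "\<lambda>k l. E.s k l \<omega>"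
      let ?\<Lambda> = "(real c * (1 + B))\<^sup>2 * L\<^sup>2 * V" and ?G = "Sigma_cond S \<omega>"
      have s0: "?s k l = 0" if "k < n" "l < n" "(k, l) \<notin> pairs" for k l
        using elim(2) that unfolding pairs_def by auto
      have G: "?G $$ (a, b) = (1 / n) * (\<Sum>k<n. \<Sum>l<n. ?v k a * ?v l b * ?s k l)" if "a < d" "b < d" for a b
        using elim(3) \<omega> that by auto
      have inv: "invertible_mat ?G" and nrm: "mat_norm (mat_inv ?G) \<le> L"
        using Ln L unfolding inverse_norm_def by (auto split: if_splits simp: top_unique)
      have dG: "det ?G \<noteq> 0" using inv invertible_mat_iff_det[OF Sigma_cond_carrier] by simp
      have nrm2: "(\<Sum>a<d. \<Sum>b<d. (mat_inv ?G $$ (a, b))\<^sup>2) \<le> L\<^sup>2"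
      proof -
        have "sqrt (\<Sum>a<d. \<Sum>b<d. (mat_inv ?G $$ (a, b))\<^sup>2) \<le> L"
          using nrm unfolding mat_norm_def carrier_matD[OF mat_inv_carrier[OF Sigma_cond_carrier]] .
        then show ?thesis by (rule sqrt_le_D)
      qed
      \<comment> \<open>The bound on the inverse of \<open>Sigma_cond\<close> becomes a lower bound
        for the Gram matrix of \<open>v_hat\<close>; in \<open>norm_le_quadratic_form\<close>,
        \<open>S\<close> is \<open>1 + B\<close> and \<open>A\<close> is \<open>V\<close>.\<close>
      have pd: "(\<Sum>a<d. (x a)\<^sup>2) \<le> ?\<Lambda> * ((1 / n) * (\<Sum>i<n. (\<Sum>a<d. ?v i a * x a)\<^sup>2))" for x :: "nat \<Rightarrow> real"
      proof (rule norm_le_quadratic_form[where \<sigma>="?s" and R="\<lambda>r b. mat_inv ?G $$ (r, b)"])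
        show "(\<Sum>r<d. ((1 / n) * (\<Sum>k<n. \<Sum>l<n. ?v k a * ?v l r * ?s k l)) * mat_inv ?G $$ (r, b)) = (if a = b then 1 else 0)"
          if "a < d" "b < d" for a b
          using mat_inv_mult_index(1)[OF Sigma_cond_carrier dG that] G that by simp
      qed (use s0 elim(1) B n c nrm2 L A_D(5)[OF \<omega>] V in auto)
      have pd': "(\<Sum>a<d. (x a)\<^sup>2) \<le> (?\<Lambda> * (1 / n)) * (\<Sum>i<n. (\<Sum>a<d. ?v i a * x a)\<^sup>2)" for x :: "nat \<Rightarrow> real"
        using pd[of x] by (simp only: mult.assoc)
      let ?\<delta> = "\<delta> \<omega> \<beta>"
      have \<Lambda>0: "?\<Lambda> \<ge> 0" using V by simp
      have sn: "score_norm \<omega> = (\<Sum>a<d. ((1 / sqrt n) * (\<Sum>i<n. ?v i a * uv S i \<omega>))\<^sup>2)"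
        using \<omega> unfolding score_norm_def err_def by (simp add: sum_distrib_left ac_simps)
      have "n * (\<Sum>a<d. (?\<delta> a)\<^sup>2) \<le> ?\<Lambda>\<^sup>2 * (\<Sum>a<d. ((1 / sqrt n) * (\<Sum>i<n. ?v i a * uv S i \<omega>))\<^sup>2)"
        by (rule least_squares_error_bound[OF n \<Lambda>0 pd normal_equations[OF A_D(1)[OF \<omega>] model A_D(2)[OF \<omega>] pd']])
      also have "\<dots> \<le> ?\<Lambda>\<^sup>2 * R8" using R8 unfolding sn by (intro mult_left_mono) auto
      finally have dn: "n * (\<Sum>a<d. (?\<delta> a)\<^sup>2) \<le> ?\<Lambda>\<^sup>2 * R8" .
      let ?\<phi> = "\<zeta> * ?\<Lambda> * sqrt R8"
      have \<phi>0: "?\<phi> \<ge> 0"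
        by (rule mult_nonneg_nonneg[OF mult_nonneg_nonneg[OF \<zeta> \<Lambda>0]]) (use R in simp)
      let ?f = "\<lambda>i. \<Sum>a<d. ?\<delta> a * ?v i a"
      have fb: "\<bar>?f i\<bar> \<le> ?\<phi>" if i: "i < n" for i
      proof -
        have "(?f i)\<^sup>2 \<le> (\<Sum>a<d. (?\<delta> a)\<^sup>2) * (\<Sum>a<d. (?v i a)\<^sup>2)" by (rule Cauchy_Schwarz_ineq_sum)
        also have "\<dots> \<le> (\<Sum>a<d. (?\<delta> a)\<^sup>2) * (\<zeta>\<^sup>2 * real n)"
          by (intro mult_left_mono A_D(6)[OF \<omega> i] sum_nonneg) auto
        also have "\<dots> = \<zeta>\<^sup>2 * (n * (\<Sum>a<d. (?\<delta> a)\<^sup>2))" by (simp only: ac_simps)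
        also have "\<dots> \<le> \<zeta>\<^sup>2 * (?\<Lambda>\<^sup>2 * R8)" by (intro mult_left_mono dn) auto
        also have "\<dots> = ?\<phi>\<^sup>2" using R by (simp only: power_mult_distrib real_sqrt_pow2 mult.assoc)
        finally have "\<bar>?f i\<bar> \<le> \<bar>?\<phi>\<bar>" by (simp only: abs_le_square_iff)
        then show ?thesis using \<phi>0 by simp
      qed
      let ?m = "\<lambda>i. \<Sum>k<n. MM \<omega> i k * uv S k \<omega>"
      let ?W = "\<Sum>p\<in>pairs. \<bar>w p\<bar>" and ?M = "\<Sum>p\<in>pairs. \<bar>w p\<bar> * ((?m (fst p))\<^sup>2 + (?m (snd p))\<^sup>2)"
      let ?F = "\<Sum>k<n. \<Sum>l<n. H k l * (uv S k \<omega> * uv S l \<omega> - ?s k l)"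
      have bound: "\<bar>(\<Sum>q\<in>pairs. \<Sum>p\<in>pairs. \<kappa> \<omega> q p * (?v (fst q) a * ?v (snd q) b) * u_hat S (fst p) \<omega> * u_hat S (snd p) \<omega>)
          - (\<Sum>k<n. \<Sum>l<n. ?v k a * ?v l b * ?s k l)\<bar> \<le> \<bar>?F\<bar> + ?\<phi> * (2 * ?W + ?M) + ?\<phi>\<^sup>2 * ?W"
        by (rule estimator_error_bound[OF s0 u_hat_eq[OF A_D(1)[OF \<omega>] model A_D(2)[OF \<omega>]] fb])
      have W: "(1 / n) * ?W \<le> K1"
        using pointwise_bounds(2)[OF ab \<omega>] n unfolding w by (simp add: field_simps)
      have M: "(1 / n) * ?M \<le> R7"
      proof -
        have sq: "(\<Sum>k<n. indicator A \<omega> * sqrt \<bar>w p\<bar> * MM \<omega> i k * err A k \<omega>)\<^sup>2 = \<bar>w p\<bar> * (?m i)\<^sup>2" for p i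
        proof -
          have "(\<Sum>k<n. indicator A \<omega> * sqrt \<bar>w p\<bar> * MM \<omega> i k * err A k \<omega>) = sqrt \<bar>w p\<bar> * ?m i"
            using \<omega> by (simp add: err_def sum_distrib_left sum_distrib_right ac_simps)
          then show ?thesis by (simp add: power_mult_distrib)
        qed
        show ?thesis using R7 unfolding residual_term_def[OF ab] w sq by (simp only: distrib_left)
      qed
      have F: "fluctuation a b \<omega> = (1 / n) * ?F"
        using \<omega> unfolding fluctuation_def[OF ab] f E.Z_def err_def by (simp add: sum_distrib_left)
      have "\<bar>Sigma_hat_CR S \<omega> $$ (a, b) - ?G $$ (a, b)\<bar> = (1 / n) *
          \<bar>(\<Sum>q\<in>pairs. \<Sum>p\<in>pairs. \<kappa> \<omega> q p * (?v (fst q) a * ?v (snd q) b) * u_hat S (fst p) \<omega> * u_hat S (snd p) \<omega>)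
          - (\<Sum>k<n. \<Sum>l<n. ?v k a * ?v l b * ?s k l)\<bar>"
        unfolding Sigma_hat_CR_index[OF ab] G[OF ab] right_diff_distrib[symmetric] abs_mult by simp
      also have "\<dots> \<le> (1 / n) * (\<bar>?F\<bar> + ?\<phi> * (2 * ?W + ?M) + ?\<phi>\<^sup>2 * ?W)"
        by (intro mult_left_mono bound) simp
      also have "\<dots> = \<bar>fluctuation a b \<omega>\<bar> + ?\<phi> * (2 * ((1 / n) * ?W) + (1 / n) * ?M) + ?\<phi>\<^sup>2 * ((1 / n) * ?W)"
        unfolding F abs_mult by (simp add: algebra_simps)
      also have "\<dots> \<le> \<bar>fluctuation a b \<omega>\<bar> + ?\<phi> * (2 * K1 + R7) + ?\<phi>\<^sup>2 * K1"
        using W M \<phi>0 by (intro add_mono mult_left_mono order_refl) auto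
      finally show "\<bar>Sigma_hat_CR S \<omega> $$ (a, b) - ?G $$ (a, b)\<bar> \<le> \<bar>fluctuation a b \<omega>\<bar> + ?\<phi> * (2 * K1 + R7) + ?\<phi>\<^sup>2 * K1" .
    qed
  qed
qed

end

end

section \<open>Consistency of the estimator\<close>

theorem theorem3:
  fixes D :: "nat \<Rightarrow> 'a sample" and d :: nat
    and \<beta> :: "real vec" and \<gamma> :: "nat \<Rightarrow> real vec"
  assumes size: "\<And>n. nobs (D n) = n" and dim: "\<And>n. dimx (D n) = d"
    and wf: "\<And>n. well_formed (D n)"
    and model: "\<And>n. linear_model (D n) \<beta> (\<gamma> n)"
    and A1_partition: "\<And>n. clusters_partition (D n)"
    and A1_indep: "\<And>n. cond_indep_sets (Pr (D n)) (sigma_W (D n))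
                          (\<lambda>g. sets (sigma_cluster (D n) g)) {..<ncl (D n)}"
    and A1_size: "(\<lambda>n. real (MAX g\<in>{..<ncl (D n)}. card (cl (D n) g))) \<in> O(\<lambda>_. 1)"
    and A2_rank: "prob_to_one (\<lambda>n. Pr (D n)) (\<lambda>n \<omega>. lambda_min (gram_w (D n) \<omega>) > 0)"
    and A2_dim: "limsup (\<lambda>n. ereal (real (dimw (D n)) / real n)) < 1"
    and A2_moments: "bounded_in_prob (\<lambda>n. Pr (D n)) (\<lambda>n. C_moment (D n))"
    and A2_Sigma: "bounded_in_prob (\<lambda>n. Pr (D n)) (\<lambda>n \<omega>. inverse_norm (Sigma_cond (D n) \<omega>))"
    and A3_mean: "\<And>n i. i < n \<Longrightarrow>
        AE \<omega> in Pr (D n). real_cond_exp (Pr (D n)) (sigma_XW (D n)) (uv (D n) i) \<omega> = 0"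
    and A3_chi: "\<exists>B::real. \<forall>\<^sub>F n in sequentially. chi (D n) \<le> ennreal B"
    and A3_lindeberg: "vanishes_in_prob (\<lambda>n. Pr (D n))
        (\<lambda>n \<omega>. (MAX i\<in>{..<n}. vec_norm (v_hat (D n) i \<omega>)) / sqrt (real n))"
    and kappa_rank: "prob_to_one (\<lambda>n. Pr (D n))
        (\<lambda>n \<omega>. lambda_min (selected_kronecker (D n) \<omega>) > 0)"
    and kappa_bound: "bounded_in_prob (\<lambda>n. Pr (D n)) (\<lambda>n \<omega>. ennreal (kappa_CR_norm (D n) \<omega>))"
  shows "vanishes_in_prob (\<lambda>n. Pr (D n))
           (\<lambda>n \<omega>. mat_norm (Sigma_hat_CR (D n) \<omega> - Sigma_cond (D n) \<omega>))"
proof -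
  let ?P = "\<lambda>n. Pr (D n)"
  have prob: "prob_space (?P n)" for n using wf[of n] unfolding well_formed_def by blast
  \<comment> \<open>Boundedness of the cluster sizes gives one \<open>c\<close> for all large
    \<open>n\<close>; \<open>max C 1\<close> makes it positive, as
    \<open>norm_le_quadratic_form\<close> requires.\<close>
  obtain c where c: "c > 0" and row: "\<forall>\<^sub>F n in sequentially. n > 0 \<and> clustered_row (D n) c"
  proof -
    obtain C where "\<forall>\<^sub>F n in sequentially. norm (real (MAX g\<in>{..<ncl (D n)}. card (cl (D n) g))) \<le> C * norm (1::real)"
      using A1_size by (elim landau_o.bigE)
    then have "\<forall>\<^sub>F n in sequentially. n > 0 \<and> clustered_row (D n) (nat \<lceil>max C 1\<rceil>)"
      using eventually_gt_at_top[of 0]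
    proof eventually_elim
      case (elim n)
      have "card (cl (D n) g) \<le> nat \<lceil>max C 1\<rceil>" if "g < ncl (D n)" for g
      proof -
        have "card (cl (D n) g) \<le> (MAX g\<in>{..<ncl (D n)}. card (cl (D n) g))"
          using that by (intro Max_ge) auto
        then have "real (card (cl (D n) g)) \<le> max C 1" using elim by simp
        then show ?thesis by linarith
      qed
      then have "clustered_row (D n) (nat \<lceil>max C 1\<rceil>)"
        by unfold_locales (use wf A1_partition A1_indep A3_mean size in auto)
      then show ?case using elim by simp
    qed
    then show ?thesis by (intro that[of "nat \<lceil>max C 1\<rceil>"]) auto
  qed
  have level: "\<exists>L>0. C / L \<le> t" if "C \<ge> 0" "t > 0" for C t :: real
    using that by (intro exI[of _ "(C + 1) / t"]) (auto simp: field_simps)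
  have entry: "with_prob ?P \<theta> (\<lambda>n \<omega>. \<bar>Sigma_hat_CR (D n) \<omega> $$ (a, b) - Sigma_cond (D n) \<omega> $$ (a, b)\<bar> \<le> \<epsilon>)"
    if ab: "a < d" "b < d" and pos: "\<epsilon> > 0" "\<theta> > 0" for a b and \<epsilon> \<theta> :: real
  proof -
    \<comment> \<open>The argument combines eleven exceptional events.\<close>
    define t where "t = \<theta> / 11"
    have t: "t > 0" using pos unfolding t_def by simp
    have E1: "with_prob ?P t (\<lambda>n \<omega>. lambda_min (gram_w (D n) \<omega>) > 0)"
      by (rule prob_to_oneD[OF prob A2_rank t])
    have E2: "with_prob ?P t (\<lambda>n \<omega>. lambda_min (selected_kronecker (D n) \<omega>) > 0)"
      by (rule prob_to_oneD[OF prob kappa_rank t])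
    obtain B where B: "B > 0" and E3: "with_prob ?P t (\<lambda>n \<omega>. C_moment (D n) \<omega> \<le> ennreal B)"
    proof (rule bounded_in_probD[OF A2_moments t])
      show "\<forall>\<^sub>F n in sequentially. C_moment (D n) \<in> borel_measurable (Pr (D n))"
        using row by eventually_elim (auto intro: clustered_row.C_moment_measurable)
    qed
    obtain L where L: "L > 0" and E4: "with_prob ?P t (\<lambda>n \<omega>. inverse_norm (Sigma_cond (D n) \<omega>) \<le> ennreal L)"
    proof (rule bounded_in_probD[OF A2_Sigma t])
      show "\<forall>\<^sub>F n in sequentially. (\<lambda>\<omega>. inverse_norm (Sigma_cond (D n) \<omega>)) \<in> borel_measurable (Pr (D n))"
        using row by eventually_elim (auto intro: clustered_row.inverse_norm_Sigma_cond_measurable)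
    qed
    obtain \<kappa>b where \<kappa>b: "\<kappa>b > 0" and E5: "with_prob ?P t (\<lambda>n \<omega>. ennreal (kappa_CR_norm (D n) \<omega>) \<le> ennreal \<kappa>b)"
    proof (rule bounded_in_probD[OF kappa_bound t])
      show "\<forall>\<^sub>F n in sequentially. (\<lambda>\<omega>. ennreal (kappa_CR_norm (D n) \<omega>)) \<in> borel_measurable (Pr (D n))"
        using row
      proof eventually_elim
        case (elim n)
        then interpret clustered_row "D n" c by simp
        show ?case using from_J[OF kappa_CR_norm_J] by measurable
      qed
    qed
    obtain X where X: "\<forall>\<^sub>F n in sequentially. chi (D n) \<le> ennreal X" using A3_chi by blast
    obtain B4 where B4: "B4 > 0" "max X 0 / B4 \<le> t" using level[of "max X 0" t] t by auto
    have E6: "with_prob ?P t (\<lambda>n \<omega>. clustered_row.Q_mean_square (D n) \<omega> \<le> ennreal B4)"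
    proof (rule with_prob_Markov[OF prob _ _ B4(1) _ B4(2)])
      show "\<forall>\<^sub>F n in sequentially. clustered_row.Q_mean_square (D n) \<in> borel_measurable (Pr (D n))"
        using row by eventually_elim (auto intro: clustered_row.Q_mean_square_measurable)
      show "\<forall>\<^sub>F n in sequentially. (\<integral>\<^sup>+\<omega>. clustered_row.Q_mean_square (D n) \<omega> \<partial>Pr (D n)) \<le> ennreal (max X 0)"
        using row X
      proof eventually_elim
        case (elim n)
        then show ?case using clustered_row.nn_integral_Q_mean_square[of "D n" c]
          by (auto intro: order_trans[OF _ ennreal_leI[OF max.cobounded1]])
      qed
    qed simp
    obtain B5 where B5: "B5 > 0" "(1 + B) / B5 \<le> t" using level[of "1 + B" t] t B by auto
    have E7: "with_prob ?P t (\<lambda>n \<omega>. clustered_row.V_mean_square (D n) B \<omega> \<le> ennreal B5)"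
    proof (rule with_prob_Markov[OF prob _ _ B5(1) _ B5(2)])
      show "\<forall>\<^sub>F n in sequentially. clustered_row.V_mean_square (D n) B \<in> borel_measurable (Pr (D n))"
        using row by eventually_elim (auto intro: clustered_row.V_mean_square_measurable)
      show "\<forall>\<^sub>F n in sequentially. (\<integral>\<^sup>+\<omega>. clustered_row.V_mean_square (D n) B \<omega> \<partial>Pr (D n)) \<le> ennreal (1 + B)"
        using row
      proof eventually_elim
        case (elim n)
        then show ?case using B size by (intro clustered_row.nn_integral_V_mean_square) auto
      qed
    qed (use B in simp)
    define V where "V = 2 * (B4 + B5)"
    have V: "V > 0" using B4 B5 unfolding V_def by simp
    define K0 where "K0 = \<kappa>b * real c * V"
    have K0: "K0 \<ge> 0" using \<kappa>b V unfolding K0_def by simp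
    obtain R7 where R7: "R7 > 0" "2 * c * (1 + B) * K0 / R7 \<le> t"
      using level[of "2 * c * (1 + B) * K0" t] t B K0 by auto
    obtain R8 where R8: "R8 > 0" "c * (1 + B) * V / R8 \<le> t"
      using level[of "c * (1 + B) * V" t] t B V by auto
    define \<Lambda> where "\<Lambda> = (real c * (1 + B))\<^sup>2 * L\<^sup>2 * V"
    define C0 where "C0 = 2 * (real c)\<^sup>2 * (2 * B + 2 * (1 + B)\<^sup>2)"
    have C0: "C0 \<ge> 0" using B unfolding C0_def by simp
    \<comment> \<open>\<open>B\<close>, \<open>L\<close>, \<open>\<kappa>b\<close>,
      \<open>V\<close>, \<open>R7\<close> and \<open>R8\<close> are fixed before \<zeta>, and both
      expressions tend to 0 with \<zeta>. The first is the cost of using residuals, the second the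
      Chebyshev bound for the fluctuation.\<close>
    obtain \<zeta> where \<zeta>: "\<zeta> > 0" "\<zeta> * \<Lambda> * sqrt R8 * (2 * K0 + R7) + (\<zeta> * \<Lambda> * sqrt R8)\<^sup>2 * K0 < \<epsilon> / 2"
      "C0 * (\<kappa>b * \<zeta>\<^sup>2 * K0) / (\<epsilon> / 2)\<^sup>2 < t"
    proof -
      have "((\<lambda>\<zeta>. \<zeta> * \<Lambda> * sqrt R8 * (2 * K0 + R7) + (\<zeta> * \<Lambda> * sqrt R8)\<^sup>2 * K0)
          \<longlongrightarrow> 0 * \<Lambda> * sqrt R8 * (2 * K0 + R7) + (0 * \<Lambda> * sqrt R8)\<^sup>2 * K0) (at_right 0)"
        by (intro tendsto_intros)
      then have "\<forall>\<^sub>F \<zeta> in at_right 0. \<zeta> * \<Lambda> * sqrt R8 * (2 * K0 + R7) + (\<zeta> * \<Lambda> * sqrt R8)\<^sup>2 * K0 < \<epsilon> / 2"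
        by (rule order_tendstoD) (use pos in simp)
      moreover have "((\<lambda>\<zeta>. C0 * (\<kappa>b * \<zeta>\<^sup>2 * K0) / (\<epsilon> / 2)\<^sup>2) \<longlongrightarrow> C0 * (\<kappa>b * 0\<^sup>2 * K0) / (\<epsilon> / 2)\<^sup>2) (at_right 0)"
        by (intro tendsto_intros) (use pos in simp)
      then have "\<forall>\<^sub>F \<zeta> in at_right 0. C0 * (\<kappa>b * \<zeta>\<^sup>2 * K0) / (\<epsilon> / 2)\<^sup>2 < t"
        by (rule order_tendstoD) (use t in simp)
      ultimately have "\<forall>\<^sub>F \<zeta> in at_right (0::real). 0 < \<zeta> \<and>
          \<zeta> * \<Lambda> * sqrt R8 * (2 * K0 + R7) + (\<zeta> * \<Lambda> * sqrt R8)\<^sup>2 * K0 < \<epsilon> / 2 \<and> C0 * (\<kappa>b * \<zeta>\<^sup>2 * K0) / (\<epsilon> / 2)\<^sup>2 < t"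
        using eventually_at_right_less[of 0] by eventually_elim auto
      then show ?thesis using that eventually_happens'[OF trivial_limit_at_right_real] by blast
    qed
    have E8: "with_prob ?P t (\<lambda>n \<omega>. \<bar>(MAX i\<in>{..<n}. vec_norm (v_hat (D n) i \<omega>)) / sqrt (real n)\<bar> \<le> \<zeta>)"
    proof (rule vanishes_in_probD[OF A3_lindeberg \<zeta>(1) t])
      show "\<forall>\<^sub>F n in sequentially. (\<lambda>\<omega>. (MAX i\<in>{..<n}. vec_norm (v_hat (D n) i \<omega>)) / sqrt (real n)) \<in> borel_measurable (Pr (D n))"
        using row
      proof eventually_elim
        case (elim n)
        then interpret clustered_row "D n" c by simp
        show ?case
          by (intro borel_measurable_divide borel_measurable_Max borel_measurable_const from_J[OF vec_norm_v_hat_J])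
             (simp_all add: size)
      qed
    qed
    have E9: "with_prob ?P t (\<lambda>n \<omega>. ennreal (clustered_row.residual_term (D n) B \<kappa>b V \<zeta> a b \<omega>) \<le> ennreal R7)"
    proof (rule with_prob_Markov[OF prob _ _ R7(1) _ R7(2)])
      show "\<forall>\<^sub>F n in sequentially. (\<lambda>\<omega>. ennreal (clustered_row.residual_term (D n) B \<kappa>b V \<zeta> a b \<omega>)) \<in> borel_measurable (Pr (D n))"
        using row
      proof eventually_elim
        case (elim n)
        then show ?case using clustered_row.residual_term_bounds(1)[of "D n" c B \<kappa>b V a b] B \<kappa>b V c ab size dim by simp
      qed
      show "\<forall>\<^sub>F n in sequentially. (\<integral>\<^sup>+\<omega>. ennreal (clustered_row.residual_term (D n) B \<kappa>b V \<zeta> a b \<omega>) \<partial>Pr (D n)) \<le> ennreal (2 * c * (1 + B) * K0)"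
        using row
      proof eventually_elim
        case (elim n)
        then show ?case
          using clustered_row.residual_term_bounds(2)[of "D n" c B \<kappa>b V a b \<zeta>] clustered_row.K1_def[of "D n" c B \<kappa>b V]
            B \<kappa>b V c ab size dim by (simp add: K0_def)
      qed
    qed (use B K0 in simp)
    have E10: "with_prob ?P t (\<lambda>n \<omega>. ennreal (clustered_row.score_norm (D n) B \<kappa>b V \<zeta> \<omega>) \<le> ennreal R8)"
    proof (rule with_prob_Markov[OF prob _ _ R8(1) _ R8(2)])
      show "\<forall>\<^sub>F n in sequentially. (\<lambda>\<omega>. ennreal (clustered_row.score_norm (D n) B \<kappa>b V \<zeta> \<omega>)) \<in> borel_measurable (Pr (D n))"
        using row
      proof eventually_elim
        case (elim n)
        then show ?case using clustered_row.score_norm_bounds(1)[of "D n" c B \<kappa>b V] B \<kappa>b V c size by simp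
      qed
      show "\<forall>\<^sub>F n in sequentially. (\<integral>\<^sup>+\<omega>. ennreal (clustered_row.score_norm (D n) B \<kappa>b V \<zeta> \<omega>) \<partial>Pr (D n)) \<le> ennreal (c * (1 + B) * V)"
        using row
      proof eventually_elim
        case (elim n)
        then show ?case using clustered_row.score_norm_bounds(2)[of "D n" c B \<kappa>b V] B \<kappa>b V c size by simp
      qed
    qed (use B V in simp)
    \<comment> \<open>Chebyshev's inequality: Markov's inequality for the square at level
      \<open>(\<epsilon> / 2)\<^sup>2\<close>, with the third property of \<zeta>.\<close>
    have E11: "with_prob ?P t (\<lambda>n \<omega>. ennreal ((clustered_row.fluctuation (D n) B \<kappa>b V \<zeta> a b \<omega>)\<^sup>2) \<le> ennreal ((\<epsilon> / 2)\<^sup>2))"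
    proof (rule with_prob_Markov[OF prob _ _ _ _ less_imp_le[OF \<zeta>(3)]])
      show "\<forall>\<^sub>F n in sequentially. (\<lambda>\<omega>. ennreal ((clustered_row.fluctuation (D n) B \<kappa>b V \<zeta> a b \<omega>)\<^sup>2)) \<in> borel_measurable (Pr (D n))"
        using row
      proof eventually_elim
        case (elim n)
        then show ?case using clustered_row.fluctuation_measurable[of "D n" c B \<kappa>b V a b] B \<kappa>b V c ab size dim by simp
      qed
      show "\<forall>\<^sub>F n in sequentially. (\<integral>\<^sup>+\<omega>. ennreal ((clustered_row.fluctuation (D n) B \<kappa>b V \<zeta> a b \<omega>)\<^sup>2) \<partial>Pr (D n))
          \<le> ennreal (C0 * (\<kappa>b * \<zeta>\<^sup>2 * K0))"
        using row
      proof eventually_elim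
        case (elim n)
        then show ?case
          using clustered_row.nn_integral_fluctuation[of "D n" c B \<kappa>b V a b \<zeta>] clustered_row.K1_def[of "D n" c B \<kappa>b V]
            B \<kappa>b V c ab size dim by (simp add: K0_def C0_def)
      qed
    qed (use pos C0 \<kappa>b K0 in auto)
    note E = with_prob_conj[OF prob E1 with_prob_conj[OF prob E2 with_prob_conj[OF prob E3 with_prob_conj[OF prob E4
      with_prob_conj[OF prob E5 with_prob_conj[OF prob E6 with_prob_conj[OF prob E7 with_prob_conj[OF prob E8
      with_prob_conj[OF prob E9 with_prob_conj[OF prob E10 E11]]]]]]]]]]
    have "with_prob ?P (t + (t + (t + (t + (t + (t + (t + (t + (t + (t + t))))))))))
        (\<lambda>n \<omega>. \<bar>Sigma_hat_CR (D n) \<omega> $$ (a, b) - Sigma_cond (D n) \<omega> $$ (a, b)\<bar> \<le> \<epsilon>)"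
    proof (rule with_prob_AE[OF prob E])
      show "\<forall>\<^sub>F n in sequentially. AE \<omega> in Pr (D n).
          lambda_min (gram_w (D n) \<omega>) > 0 \<and> lambda_min (selected_kronecker (D n) \<omega>) > 0 \<and>
          C_moment (D n) \<omega> \<le> ennreal B \<and> inverse_norm (Sigma_cond (D n) \<omega>) \<le> ennreal L \<and>
          ennreal (kappa_CR_norm (D n) \<omega>) \<le> ennreal \<kappa>b \<and> clustered_row.Q_mean_square (D n) \<omega> \<le> ennreal B4 \<and>
          clustered_row.V_mean_square (D n) B \<omega> \<le> ennreal B5 \<and>
          \<bar>(MAX i\<in>{..<n}. vec_norm (v_hat (D n) i \<omega>)) / sqrt (real n)\<bar> \<le> \<zeta> \<and>
          ennreal (clustered_row.residual_term (D n) B \<kappa>b V \<zeta> a b \<omega>) \<le> ennreal R7 \<and>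
          ennreal (clustered_row.score_norm (D n) B \<kappa>b V \<zeta> \<omega>) \<le> ennreal R8 \<and>
          ennreal ((clustered_row.fluctuation (D n) B \<kappa>b V \<zeta> a b \<omega>)\<^sup>2) \<le> ennreal ((\<epsilon> / 2)\<^sup>2) \<longrightarrow>
          \<bar>Sigma_hat_CR (D n) \<omega> $$ (a, b) - Sigma_cond (D n) \<omega> $$ (a, b)\<bar> \<le> \<epsilon>"
        using row
      proof eventually_elim
        case (elim n)
        then interpret clustered_row "D n" c by simp
        have n: "nobs (D n) > 0" using elim size by simp
        note par = less_imp_le[OF B] less_imp_le[OF \<kappa>b] V n c
        have K1: "K1 \<kappa>b V = K0" unfolding K1_def[OF par] K0_def ..
        have ab': "a < dimx (D n)" "b < dimx (D n)" using ab dim by auto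
        show ?case
          using v_pop_decomposition AE_space
            entry_error_bound[OF par model ab' L less_imp_le[OF \<zeta>(1)] less_imp_le[OF R8(1)], where ?R7.0=R7]
        proof eventually_elim
          case (elim \<omega>)
          show ?case
          proof (intro impI, elim conjE)
            assume h: "lambda_min (gram_w (D n) \<omega>) > 0" "lambda_min (selected_kronecker (D n) \<omega>) > 0"
              "C_moment (D n) \<omega> \<le> ennreal B" and hL: "inverse_norm (Sigma_cond (D n) \<omega>) \<le> ennreal L"
              and hk: "ennreal (kappa_CR_norm (D n) \<omega>) \<le> ennreal \<kappa>b" and hQ: "Q_mean_square \<omega> \<le> ennreal B4"
              and hV: "V_mean_square B \<omega> \<le> ennreal B5"
              and hm: "\<bar>(MAX i\<in>{..<n}. vec_norm (v_hat (D n) i \<omega>)) / sqrt (real n)\<bar> \<le> \<zeta>"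
              and hr: "ennreal (residual_term B \<kappa>b V \<zeta> a b \<omega>) \<le> ennreal R7"
              and hs: "ennreal (score_norm B \<kappa>b V \<zeta> \<omega>) \<le> ennreal R8"
              and hf: "ennreal ((fluctuation B \<kappa>b V \<zeta> a b \<omega>)\<^sup>2) \<le> ennreal ((\<epsilon> / 2)\<^sup>2)"
            have k: "kappa_CR_norm (D n) \<omega> \<le> \<kappa>b" using hk \<kappa>b by (simp add: ennreal_le_iff)
            have mx: "(MAX i\<in>{..<nobs (D n)}. vec_norm (v_hat (D n) i \<omega>)) / sqrt (real (nobs (D n))) \<le> \<zeta>"
              using hm unfolding size by linarith
            have A: "\<omega> \<in> regular_event B \<kappa>b V \<zeta>"
              unfolding V_def
              by (rule regular_eventI[OF elim(2) n less_imp_le[OF B] less_imp_le[OF B4(1)] less_imp_le[OF B5(1)]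
                    h k elim(1) hQ hV mx])
            have r: "residual_term B \<kappa>b V \<zeta> a b \<omega> \<le> R7" using hr R7(1) by (simp add: ennreal_le_iff)
            have sc: "score_norm B \<kappa>b V \<zeta> \<omega> \<le> R8" using hs R8(1) by (simp add: ennreal_le_iff)
            have "(fluctuation B \<kappa>b V \<zeta> a b \<omega>)\<^sup>2 \<le> (\<epsilon> / 2)\<^sup>2" using hf by (simp add: ennreal_le_iff)
            then have fl: "\<bar>fluctuation B \<kappa>b V \<zeta> a b \<omega>\<bar> \<le> \<epsilon> / 2" using pos by (simp add: abs_le_square_iff[symmetric])
            have "\<bar>Sigma_hat_CR (D n) \<omega> $$ (a, b) - Sigma_cond (D n) \<omega> $$ (a, b)\<bar>
                \<le> \<bar>fluctuation B \<kappa>b V \<zeta> a b \<omega>\<bar> + (\<zeta> * \<Lambda> * sqrt R8) * (2 * K0 + R7) + (\<zeta> * \<Lambda> * sqrt R8)\<^sup>2 * K0"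
              using elim(3) A hL r sc unfolding K1 \<Lambda>_def by blast
            then show "\<bar>Sigma_hat_CR (D n) \<omega> $$ (a, b) - Sigma_cond (D n) \<omega> $$ (a, b)\<bar> \<le> \<epsilon>"
              using fl \<zeta>(2) by linarith
          qed
        qed
      qed
    qed
    then show ?thesis by (rule with_prob_mono) (auto simp: t_def)
  qed
  show ?thesis
  proof (rule vanishes_in_probI[OF prob])
    fix \<epsilon> \<theta> :: real assume pos: "\<epsilon> > 0" "\<theta> > 0"
    \<comment> \<open>One more than the number of entries, which keeps \<open>N\<close> positive.
      The error is split evenly over the entries because the Frobenius norm is at most the sum of
      their absolute values.\<close>
    define N where "N = real (d * d) + 1"
    have N: "N > 0" unfolding N_def by linarith
    let ?I = "{..<d} \<times> {..<d}"
    let ?e = "\<lambda>p n \<omega>. \<bar>Sigma_hat_CR (D n) \<omega> $$ p - Sigma_cond (D n) \<omega> $$ p\<bar>"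
    have "with_prob ?P (real (card ?I) * (\<theta> / N)) (\<lambda>n \<omega>. \<forall>p\<in>?I. ?e p n \<omega> \<le> \<epsilon> / N)"
      by (rule with_prob_finite_ball[OF prob]) (use entry pos N in auto)
    then show "with_prob ?P \<theta> (\<lambda>n \<omega>. \<bar>mat_norm (Sigma_hat_CR (D n) \<omega> - Sigma_cond (D n) \<omega>)\<bar> \<le> \<epsilon>)"
    proof (rule with_prob_mono)
      have card: "real (card ?I) \<le> N" unfolding N_def by (simp add: card_cartesian_product)
      have "real (card ?I) * (\<theta> / N) \<le> N * (\<theta> / N)" using card pos N by (intro mult_right_mono) auto
      then show "real (card ?I) * (\<theta> / N) \<le> \<theta>" using N by simp
      have "\<bar>mat_norm (Sigma_hat_CR (D n) \<omega> - Sigma_cond (D n) \<omega>)\<bar> \<le> \<epsilon>" if h: "\<forall>p\<in>?I. ?e p n \<omega> \<le> \<epsilon> / N" for n \<omega>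
      proof -
        have "Sigma_hat_CR (D n) \<omega> \<in> carrier_mat d d" "Sigma_cond (D n) \<omega> \<in> carrier_mat d d"
          unfolding Sigma_hat_CR_def Sigma_cond_def by (simp_all add: dim)
        then have "mat_norm (Sigma_hat_CR (D n) \<omega> - Sigma_cond (D n) \<omega>) = L2_set (\<lambda>p. ?e p n \<omega>) ?I"
          unfolding mat_norm_def L2_set_def by (simp add: sum.cartesian_product split_beta)
        also have "\<dots> \<le> (\<Sum>p\<in>?I. ?e p n \<omega>)" by (rule L2_set_le_sum) simp
        also have "\<dots> \<le> real (card ?I) * (\<epsilon> / N)" by (rule sum_bounded_above) (use h in auto)
        also have "\<dots> \<le> N * (\<epsilon> / N)" using card pos N by (intro mult_right_mono) auto
        also have "\<dots> = \<epsilon>" using N by simp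
        finally show ?thesis unfolding mat_norm_def by (simp add: sum_nonneg)
      qed
      then show "\<forall>\<^sub>F n in sequentially. \<forall>\<omega>\<in>space (Pr (D n)). (\<forall>p\<in>?I. ?e p n \<omega> \<le> \<epsilon> / N) \<longrightarrow>
          \<bar>mat_norm (Sigma_hat_CR (D n) \<omega> - Sigma_cond (D n) \<omega>)\<bar> \<le> \<epsilon>"
        by simp
    qed
  qed
qed

end
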